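(* Let $\mathcal D$ be a small triangulated category with full subcategories $\mathcal E_i\subset\mathcal D$, $i\in\mathbb Z$, each closed under extensions, such that $\operatorname{Hom}_{\mathcal D}(X,Y[1])=0$ for all $X\in\mathcal E_i$, $Y\in\mathcal E_j$, $i\ge j$, and with a triangulated autoequivalence $X\mapsto X(1)$ such that $\mathcal E_i(1)=\mathcal E_{i+1}$. Let $\mathcal J\subset\mathcal E_0$ be a full subcategory such that every object of $\mathcal E_0$ is a finite direct sum of objects of $\mathcal J$, and let $A=(\operatorname{Hom}_{\mathcal D}(X,Y(n)[n]))_{Y,X\in\mathcal J;\,n\ge0}$ be the big graded ring of diagonal cohomology over $\operatorname{Ob}\mathcal J$. Let $\mathcal M$ be the minimal full subcategory of $\mathcal D$ containing all $\mathcal E_i$ and closed under extensions. Assume that every morphism $X\to Y[n]$ of degree $n\ge2$ in $\mathcal D$ between two objects $X,Y\in\mathcal M$ can be presented as the composition of a chain of morphisms $Z_{i-1}\to Z_i[1]$, $1\le i\le n$, with $Z_i\in\mathcal M$, $Z_0=X$, $Z_n=Y$. Then (1) $\operatorname{Hom}_{\mathcal D}(X,Y[n])=0$ for all $X\in\mathcal E_i$, $Y\in\mathcal E_j$, $n\ge1$ and $n>j-i$; (2) the big graded ring $A$ is quadratic.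
   Context: Closed under extensions: containing the middle term $Y$ of any distinguished triangle $X\to Y\to Z\to X[1]$ whose ends $X,Z$ are in the subcategory. Composition of a chain of morphisms $Z_{i-1}\to Z_i[1]$ means $Z_0\to Z_1[1]\to Z_2[2]\to\cdots\to Z_n[n]$ with the obvious shifts. A big graded ring $A$ over a set $\Sigma$ is a collection of abelian groups $A_{\sigma\tau;n}$ ($\sigma,\tau\in\Sigma$, $n\ge0$) with biadditive associative multiplications $A_{\sigma\tau;n}\times A_{\tau\rho;m}\to A_{\sigma\rho;n+m}$ and units $e_\sigma\in A_{\sigma\sigma;0}$; $A_n=(A_{\sigma\tau;n})_{\sigma,\tau}$ is a bimodule over the big ring $A_0$, i.e. over the preadditive category with object set $\Sigma$ given by $A_0$. For the big graded ring of diagonal cohomology $A=(\operatorname{Hom}_{\mathcal D}(X,Y(n)[n]))_{Y,X\in\mathcal J;\,n\ge0}$ over $\Sigma=\operatorname{Ob}\mathcal J$, one has $A_{YX;n}=\operatorname{Hom}_{\mathcal D}(X,Y(n)[n])$, and the product is composition, using the twist and the shift. The tensor product over $A_0$ of bimodules $K,L$ has components $(K\otimes_{A_0}L)_{\sigma\rho}$ generated by $k\otimes l$, $k\in K_{\sigma\tau}$, $l\in L_{\tau\rho}$, with biadditivity and $ka\otimes l=k\otimes al$. $A$ is quadratic if the natural maps $A_1^{\otimes n}/\sum_{1\le j\le n-1}A_1^{\otimes j-1}\otimes_{A_0}I\otimes_{A_0}A_1^{\otimes n-j-1}\to A_n$ are isomorphisms for all $n\ge2$, where tensor powers are over $A_0$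 and $I=\ker(A_1\otimes_{A_0}A_1\to A_2)$ (the sum meaning the sum of the images in $A_1^{\otimes n}$). *)

theory Defs
  imports "HOL-Algebra.Free_Abelian_Groups" "HOL-Algebra.Generated_Groups" "HOL.Hull"
begin

section \<open>Additive categories\<close>

text \<open>
  Every \<open>Hom C X Y\<close> is an abelian group, written multiplicatively as in HOL-Algebra: the operation
  \<open>\<otimes>\<close> is the addition of morphisms, \<open>\<one>\<close> is the zero morphism, \<open>inv\<close> is the negative and \<open>finprod\<close>
  is a finite sum. Composition is applied to bare arrows, and so are the functors below. This loses
  no generality, since the arrows of any small category can be tagged by their source and target;
  disjointness of the hom-sets is not required.
\<close>

record ('o, 'm) category_data =
  Obj :: "'o set"
  Hom :: "'o \<Rightarrow> 'o \<Rightarrow> 'm monoid"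
  idm :: "'o \<Rightarrow> 'm"
  cmp :: "'m \<Rightarrow> 'm \<Rightarrow> 'm"  (infixr \<open>\<cdot>\<index>\<close> 75)

locale preadditive_category =
  fixes C :: "('o, 'm, 'r) category_data_scheme" (structure)
  assumes hom_group:
      "\<lbrakk>X \<in> Obj C; Y \<in> Obj C\<rbrakk> \<Longrightarrow> comm_group (Hom C X Y)"
    and id_closed:
      "X \<in> Obj C \<Longrightarrow> idm C X \<in> carrier (Hom C X X)"
    and cmp_closed:
      "\<lbrakk>X \<in> Obj C; Y \<in> Obj C; Z \<in> Obj C; f \<in> carrier (Hom C X Y); g \<in> carrier (Hom C Y Z)\<rbrakk>
        \<Longrightarrow> g \<cdot> f \<in> carrier (Hom C X Z)"
    and id_left:
      "\<lbrakk>X \<in> Obj C; Y \<in> Obj C; f \<in> carrier (Hom C X Y)\<rbrakk> \<Longrightarrow> idm C Y \<cdot> f = f"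
    and id_right:
      "\<lbrakk>X \<in> Obj C; Y \<in> Obj C; f \<in> carrier (Hom C X Y)\<rbrakk> \<Longrightarrow> f \<cdot> idm C X = f"
    and cmp_assoc:
      "\<lbrakk>W \<in> Obj C; X \<in> Obj C; Y \<in> Obj C; Z \<in> Obj C;
        f \<in> carrier (Hom C W X); g \<in> carrier (Hom C X Y); h \<in> carrier (Hom C Y Z)\<rbrakk>
        \<Longrightarrow> h \<cdot> (g \<cdot> f) = (h \<cdot> g) \<cdot> f"
    and cmp_add_left:
      "\<lbrakk>X \<in> Obj C; Y \<in> Obj C; Z \<in> Obj C; f \<in> carrier (Hom C X Y);
        g \<in> carrier (Hom C Y Z); g' \<in> carrier (Hom C Y Z)\<rbrakk>
        \<Longrightarrow> (g \<otimes>\<^bsub>Hom C Y Z\<^esub> g') \<cdot> f = (g \<cdot> f) \<otimes>\<^bsub>Hom C X Z\<^esub> (g' \<cdot> f)"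
    and cmp_add_right:
      "\<lbrakk>X \<in> Obj C; Y \<in> Obj C; Z \<in> Obj C; f \<in> carrier (Hom C X Y);
        f' \<in> carrier (Hom C X Y); g \<in> carrier (Hom C Y Z)\<rbrakk>
        \<Longrightarrow> g \<cdot> (f \<otimes>\<^bsub>Hom C X Y\<^esub> f') = (g \<cdot> f) \<otimes>\<^bsub>Hom C X Z\<^esub> (g \<cdot> f')"

definition is_iso :: "('o, 'm, 'r) category_data_scheme \<Rightarrow> 'o \<Rightarrow> 'o \<Rightarrow> 'm \<Rightarrow> bool" where
  "is_iso C X Y f \<longleftrightarrow> f \<in> carrier (Hom C X Y) \<and>
     (\<exists>g \<in> carrier (Hom C Y X). g \<cdot>\<^bsub>C\<^esub> f = idm C X \<and> f \<cdot>\<^bsub>C\<^esub> g = idm C Y)"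

definition isomorphic :: "('o, 'm, 'r) category_data_scheme \<Rightarrow> 'o \<Rightarrow> 'o \<Rightarrow> bool" where
  "isomorphic C X Y \<longleftrightarrow> (\<exists>f. is_iso C X Y f)"

definition is_zero_object :: "('o, 'm, 'r) category_data_scheme \<Rightarrow> 'o \<Rightarrow> bool" where
  "is_zero_object C X \<longleftrightarrow> X \<in> Obj C \<and>
     (\<forall>Y \<in> Obj C. carrier (Hom C X Y) = {\<one>\<^bsub>Hom C X Y\<^esub>} \<and> carrier (Hom C Y X) = {\<one>\<^bsub>Hom C Y X\<^esub>})"

text \<open>
  \<open>X\<close> is a direct sum (biproduct) of the family \<open>Xs\<close>; the direct sums of the empty family are the
  zero objects.
\<close>

definition is_direct_sum :: "('o, 'm, 'r) category_data_scheme \<Rightarrow> 'o \<Rightarrow> 'o list \<Rightarrow> bool" where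
  "is_direct_sum C X Xs \<longleftrightarrow> X \<in> Obj C \<and> set Xs \<subseteq> Obj C \<and>
     (\<exists>\<iota> \<pi>. (\<forall>k < length Xs. \<iota> k \<in> carrier (Hom C (Xs ! k) X) \<and> \<pi> k \<in> carrier (Hom C X (Xs ! k))) \<and>
        (\<forall>k < length Xs. \<forall>l < length Xs.
           \<pi> k \<cdot>\<^bsub>C\<^esub> \<iota> l = (if k = l then idm C (Xs ! k) else \<one>\<^bsub>Hom C (Xs ! l) (Xs ! k)\<^esub>)) \<and>
        finprod (Hom C X X) (\<lambda>k. \<iota> k \<cdot>\<^bsub>C\<^esub> \<pi> k) {..<length Xs} = idm C X)"

locale additive_category = preadditive_category +
  assumes ex_direct_sum: "set Xs \<subseteq> Obj C \<Longrightarrow> \<exists>X. is_direct_sum C X Xs"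

locale additive_autoequivalence = additive_category C
  for C :: "('o, 'm, 'r) category_data_scheme" (structure) +
  fixes F0 :: "'o \<Rightarrow> 'o" and F1 :: "'m \<Rightarrow> 'm"
  assumes functor_obj: "X \<in> Obj C \<Longrightarrow> F0 X \<in> Obj C"
    and functor_hom:
      "\<lbrakk>X \<in> Obj C; Y \<in> Obj C\<rbrakk> \<Longrightarrow> F1 \<in> hom (Hom C X Y) (Hom C (F0 X) (F0 Y))"
    and functor_id: "X \<in> Obj C \<Longrightarrow> F1 (idm C X) = idm C (F0 X)"
    and functor_cmp:
      "\<lbrakk>X \<in> Obj C; Y \<in> Obj C; Z \<in> Obj C; f \<in> carrier (Hom C X Y); g \<in> carrier (Hom C Y Z)\<rbrakk>
        \<Longrightarrow> F1 (g \<cdot> f) = F1 g \<cdot> F1 f"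
    and fully_faithful:
      "\<lbrakk>X \<in> Obj C; Y \<in> Obj C\<rbrakk>
        \<Longrightarrow> bij_betw F1 (carrier (Hom C X Y)) (carrier (Hom C (F0 X) (F0 Y)))"
    and essentially_surjective: "Y \<in> Obj C \<Longrightarrow> \<exists>X \<in> Obj C. isomorphic C (F0 X) Y"


section \<open>Triangulated categories\<close>

text \<open>
  \<open>(X, Y, Z, f, g, h) \<in> dist D\<close> means that \<open>X \<rightarrow> Y \<rightarrow> Z \<rightarrow> X[1]\<close> with the morphisms \<open>f\<close>, \<open>g\<close>, \<open>h\<close> is a
  distinguished triangle. The shift \<open>X \<mapsto> X[1]\<close> is allowed to be an autoequivalence; strict
  automorphisms are a special case.
\<close>

record ('o, 'm) triangulated_data = "('o, 'm) category_data" +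
  sh0 :: "'o \<Rightarrow> 'o"
  sh1 :: "'m \<Rightarrow> 'm"
  dist :: "('o \<times> 'o \<times> 'o \<times> 'm \<times> 'm \<times> 'm) set"

locale triangulated_category = additive_category D
  for D :: "('o, 'm, 'r) triangulated_data_scheme" (structure) +
  assumes shift: "additive_autoequivalence D (sh0 D) (sh1 D)"
    and dist_typed:
      "(X, Y, Z, f, g, h) \<in> dist D \<Longrightarrow> X \<in> Obj D \<and> Y \<in> Obj D \<and> Z \<in> Obj D \<and>
         f \<in> carrier (Hom D X Y) \<and> g \<in> carrier (Hom D Y Z) \<and> h \<in> carrier (Hom D Z (sh0 D X))"
    and TR1_id:
      "\<lbrakk>X \<in> Obj D; is_zero_object D N\<rbrakk>
        \<Longrightarrow> (X, X, N, idm D X, \<one>\<^bsub>Hom D X N\<^esub>, \<one>\<^bsub>Hom D N (sh0 D X)\<^esub>) \<in> dist D"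
    and TR1_complete:
      "\<lbrakk>X \<in> Obj D; Y \<in> Obj D; f \<in> carrier (Hom D X Y)\<rbrakk>
        \<Longrightarrow> \<exists>Z g h. (X, Y, Z, f, g, h) \<in> dist D"
    and TR1_iso:
      "\<lbrakk>(X, Y, Z, f, g, h) \<in> dist D; X' \<in> Obj D; Y' \<in> Obj D; Z' \<in> Obj D;
        f' \<in> carrier (Hom D X' Y'); g' \<in> carrier (Hom D Y' Z'); h' \<in> carrier (Hom D Z' (sh0 D X'));
        is_iso D X X' a; is_iso D Y Y' b; is_iso D Z Z' c;
        b \<cdot> f = f' \<cdot> a; c \<cdot> g = g' \<cdot> b; sh1 D a \<cdot> h = h' \<cdot> c\<rbrakk>
        \<Longrightarrow> (X', Y', Z', f', g', h') \<in> dist D"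
    and TR2:
      "\<lbrakk>X \<in> Obj D; Y \<in> Obj D; Z \<in> Obj D;
        f \<in> carrier (Hom D X Y); g \<in> carrier (Hom D Y Z); h \<in> carrier (Hom D Z (sh0 D X))\<rbrakk>
        \<Longrightarrow> (X, Y, Z, f, g, h) \<in> dist D \<longleftrightarrow>
            (Y, Z, sh0 D X, g, h, inv\<^bsub>Hom D (sh0 D X) (sh0 D Y)\<^esub> (sh1 D f)) \<in> dist D"
    and TR3:
      "\<lbrakk>(X, Y, Z, f, g, h) \<in> dist D; (X', Y', Z', f', g', h') \<in> dist D;
        a \<in> carrier (Hom D X X'); b \<in> carrier (Hom D Y Y'); b \<cdot> f = f' \<cdot> a\<rbrakk>
        \<Longrightarrow> \<exists>c \<in> carrier (Hom D Z Z'). c \<cdot> g = g' \<cdot> b \<and> sh1 D a \<cdot> h = h' \<cdot> c"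
    and TR4:
      "\<lbrakk>(X, Y, Z', f, a, b) \<in> dist D; (Y, Z, X', g, c, d) \<in> dist D; (X, Z, Y', g \<cdot> f, p, q) \<in> dist D\<rbrakk>
        \<Longrightarrow> \<exists>u \<in> carrier (Hom D Z' Y'). \<exists>v \<in> carrier (Hom D Y' X').
              (Z', Y', X', u, v, sh1 D a \<cdot> d) \<in> dist D \<and>
              u \<cdot> a = p \<cdot> g \<and> q \<cdot> u = b \<and> v \<cdot> p = c \<and> d \<cdot> v = sh1 D f \<cdot> q"

text \<open>
  A triangulated functor consists of an additive functor \<open>(T0, T1)\<close> and of a natural isomorphism
  \<open>\<phi> X : T (X[1]) \<rightarrow> (T X)[1]\<close> through which it preserves distinguished triangles.
\<close>

locale triangulated_autoequivalence =
  triangulated_category D + additive_autoequivalence D T0 T1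
  for D :: "('o, 'm, 'r) triangulated_data_scheme" (structure)
    and T0 :: "'o \<Rightarrow> 'o" and T1 :: "'m \<Rightarrow> 'm" +
  fixes \<phi> :: "'o \<Rightarrow> 'm"
  assumes phi_iso: "X \<in> Obj D \<Longrightarrow> is_iso D (T0 (sh0 D X)) (sh0 D (T0 X)) (\<phi> X)"
    and phi_natural:
      "\<lbrakk>X \<in> Obj D; Y \<in> Obj D; f \<in> carrier (Hom D X Y)\<rbrakk>
        \<Longrightarrow> \<phi> Y \<cdot> T1 (sh1 D f) = sh1 D (T1 f) \<cdot> \<phi> X"
    and preserves_dist:
      "(X, Y, Z, f, g, h) \<in> dist D \<Longrightarrow> (T0 X, T0 Y, T0 Z, T1 f, T1 g, \<phi> X \<cdot> T1 h) \<in> dist D"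

text \<open>Full subcategories are given by their sets of objects.\<close>

definition closed_under_extensions ::
    "('o, 'm, 'r) triangulated_data_scheme \<Rightarrow> 'o set \<Rightarrow> bool" where
  "closed_under_extensions D S \<longleftrightarrow> S \<subseteq> Obj D \<and>
     (\<forall>X Y Z f g h. (X, Y, Z, f, g, h) \<in> dist D \<longrightarrow> X \<in> S \<longrightarrow> Z \<in> S \<longrightarrow> Y \<in> S)"

text \<open>
  The composition \<open>Z 0 \<rightarrow> (Z 1)[1] \<rightarrow> \<dots> \<rightarrow> (Z n)[n]\<close> of a chain \<open>z i : Z (i - 1) \<rightarrow> (Z i)[1]\<close>, \<open>1 \<le> i \<le> n\<close>.
\<close>

primrec chain_cmp ::
    "('o, 'm, 'r) triangulated_data_scheme \<Rightarrow> (nat \<Rightarrow> 'o) \<Rightarrow> (nat \<Rightarrow> 'm) \<Rightarrow> nat \<Rightarrow> 'm" where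
  "chain_cmp D Z z 0 = idm D (Z 0)"
| "chain_cmp D Z z (Suc n) = (sh1 D ^^ n) (z (Suc n)) \<cdot>\<^bsub>D\<^esub> chain_cmp D Z z n"


section \<open>Big graded rings\<close>

text \<open>
  \<open>cpt A \<sigma> \<tau> n\<close> is the abelian group with index \<open>\<sigma>\<tau>;n\<close>, again written multiplicatively, and
  \<open>mul A \<sigma> \<tau> \<rho> n m\<close> is the product of the components \<open>\<sigma>\<tau>;n\<close> and \<open>\<tau>\<rho>;m\<close>.
\<close>

record ('s, 'a) big_graded_data =
  cpt :: "'s \<Rightarrow> 's \<Rightarrow> nat \<Rightarrow> 'a monoid"
  mul :: "'s \<Rightarrow> 's \<Rightarrow> 's \<Rightarrow> nat \<Rightarrow> nat \<Rightarrow> 'a \<Rightarrow> 'a \<Rightarrow> 'a"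
  unt :: "'s \<Rightarrow> 'a"

locale big_graded_ring =
  fixes \<Sigma> :: "'s set" and A :: "('s, 'a, 'r) big_graded_data_scheme"
  assumes comp_group:
      "\<lbrakk>\<sigma> \<in> \<Sigma>; \<tau> \<in> \<Sigma>\<rbrakk> \<Longrightarrow> comm_group (cpt A \<sigma> \<tau> n)"
    and unt_closed: "\<sigma> \<in> \<Sigma> \<Longrightarrow> unt A \<sigma> \<in> carrier (cpt A \<sigma> \<sigma> 0)"
    and mul_closed:
      "\<lbrakk>\<sigma> \<in> \<Sigma>; \<tau> \<in> \<Sigma>; \<rho> \<in> \<Sigma>; a \<in> carrier (cpt A \<sigma> \<tau> n); b \<in> carrier (cpt A \<tau> \<rho> m)\<rbrakk>
        \<Longrightarrow> mul A \<sigma> \<tau> \<rho> n m a b \<in> carrier (cpt A \<sigma> \<rho> (n + m))"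
    and mul_add_left:
      "\<lbrakk>\<sigma> \<in> \<Sigma>; \<tau> \<in> \<Sigma>; \<rho> \<in> \<Sigma>; a \<in> carrier (cpt A \<sigma> \<tau> n); a' \<in> carrier (cpt A \<sigma> \<tau> n);
        b \<in> carrier (cpt A \<tau> \<rho> m)\<rbrakk>
        \<Longrightarrow> mul A \<sigma> \<tau> \<rho> n m (a \<otimes>\<^bsub>cpt A \<sigma> \<tau> n\<^esub> a') b =
            mul A \<sigma> \<tau> \<rho> n m a b \<otimes>\<^bsub>cpt A \<sigma> \<rho> (n + m)\<^esub> mul A \<sigma> \<tau> \<rho> n m a' b"
    and mul_add_right:
      "\<lbrakk>\<sigma> \<in> \<Sigma>; \<tau> \<in> \<Sigma>; \<rho> \<in> \<Sigma>; a \<in> carrier (cpt A \<sigma> \<tau> n); b \<in> carrier (cpt A \<tau> \<rho> m);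
        b' \<in> carrier (cpt A \<tau> \<rho> m)\<rbrakk>
        \<Longrightarrow> mul A \<sigma> \<tau> \<rho> n m a (b \<otimes>\<^bsub>cpt A \<tau> \<rho> m\<^esub> b') =
            mul A \<sigma> \<tau> \<rho> n m a b \<otimes>\<^bsub>cpt A \<sigma> \<rho> (n + m)\<^esub> mul A \<sigma> \<tau> \<rho> n m a b'"
    and mul_assoc:
      "\<lbrakk>\<sigma> \<in> \<Sigma>; \<tau> \<in> \<Sigma>; \<rho> \<in> \<Sigma>; \<upsilon> \<in> \<Sigma>; a \<in> carrier (cpt A \<sigma> \<tau> n);
        b \<in> carrier (cpt A \<tau> \<rho> m); c \<in> carrier (cpt A \<rho> \<upsilon> k)\<rbrakk>
        \<Longrightarrow> mul A \<sigma> \<rho> \<upsilon> (n + m) k (mul A \<sigma> \<tau> \<rho> n m a b) c =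
            mul A \<sigma> \<tau> \<upsilon> n (m + k) a (mul A \<tau> \<rho> \<upsilon> m k b c)"
    and unt_left:
      "\<lbrakk>\<sigma> \<in> \<Sigma>; \<tau> \<in> \<Sigma>; a \<in> carrier (cpt A \<sigma> \<tau> n)\<rbrakk> \<Longrightarrow> mul A \<sigma> \<sigma> \<tau> 0 n (unt A \<sigma>) a = a"
    and unt_right:
      "\<lbrakk>\<sigma> \<in> \<Sigma>; \<tau> \<in> \<Sigma>; a \<in> carrier (cpt A \<sigma> \<tau> n)\<rbrakk> \<Longrightarrow> mul A \<sigma> \<tau> \<tau> n 0 a (unt A \<tau>) = a"

text \<open>
  The tensor power of \<open>A\<^sub>1\<close> over \<open>A\<^sub>0\<close> with \<open>n\<close> factors is constructed in one step, since the type of an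
  iterated binary tensor product would depend on \<open>n\<close>. The pure tensor
  \<open>a\<^sub>1 \<otimes> \<dots> \<otimes> a\<^sub>n\<close> with \<open>a\<^sub>i\<close> in the component \<open>\<sigma>\<^sub>i\<^sub>-\<^sub>1\<sigma>\<^sub>i;1\<close> is the word
  \<open>[(a\<^sub>1, \<sigma>\<^sub>1), \<dots>, (a\<^sub>n, \<sigma>\<^sub>n)]\<close>; the index \<open>\<sigma>\<^sub>0\<close> is kept outside of the word.
\<close>

fun is_word ::
    "'s set \<Rightarrow> ('s, 'a, 'r) big_graded_data_scheme \<Rightarrow> 's \<Rightarrow> 's \<Rightarrow> ('a \<times> 's) list \<Rightarrow> bool" where
  "is_word \<Sigma> A \<sigma> \<rho> [] \<longleftrightarrow> \<sigma> = \<rho>"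
| "is_word \<Sigma> A \<sigma> \<rho> ((a, \<tau>) # w) \<longleftrightarrow> \<tau> \<in> \<Sigma> \<and> a \<in> carrier (cpt A \<sigma> \<tau> 1) \<and> is_word \<Sigma> A \<tau> \<rho> w"

definition word_group ::
    "'s set \<Rightarrow> ('s, 'a, 'r) big_graded_data_scheme \<Rightarrow> nat \<Rightarrow> 's \<Rightarrow> 's
      \<Rightarrow> (('a \<times> 's) list \<Rightarrow>\<^sub>0 int) monoid" where
  "word_group \<Sigma> A n \<sigma> \<rho> = free_Abelian_group {w. length w = n \<and> is_word \<Sigma> A \<sigma> \<rho> w}"

definition tensor_relations ::
    "'s set \<Rightarrow> ('s, 'a, 'r) big_graded_data_scheme \<Rightarrow> nat \<Rightarrow> 's \<Rightarrow> 's
      \<Rightarrow> (('a \<times> 's) list \<Rightarrow>\<^sub>0 int) set" where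
  "tensor_relations \<Sigma> A n \<sigma> \<rho> = generate (word_group \<Sigma> A n \<sigma> \<rho>)
    ({frag_of (u @ [(a \<otimes>\<^bsub>cpt A \<alpha> \<beta> 1\<^esub> b, \<beta>)] @ v) - frag_of (u @ [(a, \<beta>)] @ v) - frag_of (u @ [(b, \<beta>)] @ v)
       | u a b v \<alpha> \<beta>. \<alpha> \<in> \<Sigma> \<and> \<beta> \<in> \<Sigma> \<and> is_word \<Sigma> A \<sigma> \<alpha> u \<and> is_word \<Sigma> A \<beta> \<rho> v \<and>
           length u + 1 + length v = n \<and> a \<in> carrier (cpt A \<alpha> \<beta> 1) \<and> b \<in> carrier (cpt A \<alpha> \<beta> 1)} \<union>
     {frag_of (u @ [(mul A \<alpha> \<tau> \<tau>' 1 0 a c, \<tau>'), (b, \<beta>)] @ v) -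
      frag_of (u @ [(a, \<tau>), (mul A \<tau> \<tau>' \<beta> 0 1 c b, \<beta>)] @ v)
       | u a c b v \<alpha> \<tau> \<tau>' \<beta>. \<alpha> \<in> \<Sigma> \<and> \<tau> \<in> \<Sigma> \<and> \<tau>' \<in> \<Sigma> \<and> \<beta> \<in> \<Sigma> \<and>
           is_word \<Sigma> A \<sigma> \<alpha> u \<and> is_word \<Sigma> A \<beta> \<rho> v \<and> length u + 2 + length v = n \<and>
           a \<in> carrier (cpt A \<alpha> \<tau> 1) \<and> c \<in> carrier (cpt A \<tau> \<tau>' 0) \<and> b \<in> carrier (cpt A \<tau>' \<beta> 1)})"

definition tensor_power ::
    "'s set \<Rightarrow> ('s, 'a, 'r) big_graded_data_scheme \<Rightarrow> nat \<Rightarrow> 's \<Rightarrow> 's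
      \<Rightarrow> (('a \<times> 's) list \<Rightarrow>\<^sub>0 int) set monoid" where
  "tensor_power \<Sigma> A n \<sigma> \<rho> = word_group \<Sigma> A n \<sigma> \<rho> Mod tensor_relations \<Sigma> A n \<sigma> \<rho>"

fun word_product :: "('s, 'a, 'r) big_graded_data_scheme \<Rightarrow> 's \<Rightarrow> 's \<Rightarrow> ('a \<times> 's) list \<Rightarrow> 'a" where
  "word_product A \<sigma> \<rho> [] = unt A \<rho>"
| "word_product A \<sigma> \<rho> ((a, \<tau>) # w) = mul A \<sigma> \<tau> \<rho> 1 (length w) a (word_product A \<tau> \<rho> w)"

definition word_group_map ::
    "('s, 'a, 'r) big_graded_data_scheme \<Rightarrow> nat \<Rightarrow> 's \<Rightarrow> 's \<Rightarrow> (('a \<times> 's) list \<Rightarrow>\<^sub>0 int) \<Rightarrow> 'a" where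
  "word_group_map A n \<sigma> \<rho> x = finprod (cpt A \<sigma> \<rho> n)
     (\<lambda>w. word_product A \<sigma> \<rho> w [^]\<^bsub>cpt A \<sigma> \<rho> n\<^esub> Poly_Mapping.lookup x w) (Poly_Mapping.keys x)"

text \<open>
  The multiplication map from the tensor power to \<open>A\<^sub>n\<close>. As in the isomorphism theorems of HOL-Algebra,
  \<open>\<lambda>X. the_elem (h ` X)\<close> is the map on cosets induced by \<open>h\<close>.
\<close>

definition tensor_power_map ::
    "('s, 'a, 'r) big_graded_data_scheme \<Rightarrow> nat \<Rightarrow> 's \<Rightarrow> 's \<Rightarrow> (('a \<times> 's) list \<Rightarrow>\<^sub>0 int) set \<Rightarrow> 'a" where
  "tensor_power_map A n \<sigma> \<rho> = (\<lambda>X. the_elem (word_group_map A n \<sigma> \<rho> ` X))"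

definition quadratic_kernel ::
    "'s set \<Rightarrow> ('s, 'a, 'r) big_graded_data_scheme \<Rightarrow> 's \<Rightarrow> 's
      \<Rightarrow> (('a \<times> 's) list \<Rightarrow>\<^sub>0 int) set set" where
  "quadratic_kernel \<Sigma> A \<sigma> \<rho> =
     kernel (tensor_power \<Sigma> A 2 \<sigma> \<rho>) (cpt A \<sigma> \<rho> 2) (tensor_power_map A 2 \<sigma> \<rho>)"

text \<open>
  The sum over \<open>1 \<le> j \<le> n - 1\<close> of the images of the tensor products of \<open>j - 1\<close> factors \<open>A\<^sub>1\<close>, the
  kernel \<open>I\<close>, and \<open>n - j - 1\<close> factors \<open>A\<^sub>1\<close>: it is generated by the elements \<open>u \<otimes> t \<otimes> v\<close> with pure
  tensors \<open>u\<close>, \<open>v\<close> and with \<open>t\<close> in \<open>I\<close>. Here \<open>x\<close> runs over the representatives of \<open>t\<close>. An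
  empty tensor power is \<open>A\<^sub>0\<close>, and the empty word suffices there as \<open>I\<close> is a sub-bimodule.
\<close>

definition quadratic_relations ::
    "'s set \<Rightarrow> ('s, 'a, 'r) big_graded_data_scheme \<Rightarrow> nat \<Rightarrow> 's \<Rightarrow> 's
      \<Rightarrow> (('a \<times> 's) list \<Rightarrow>\<^sub>0 int) set set" where
  "quadratic_relations \<Sigma> A n \<sigma> \<rho> = generate (tensor_power \<Sigma> A n \<sigma> \<rho>)
    (\<Union>j \<in> {1..n - 1}.
      {tensor_relations \<Sigma> A n \<sigma> \<rho> #>\<^bsub>word_group \<Sigma> A n \<sigma> \<rho>\<^esub> frag_extend (\<lambda>w. frag_of (u @ w @ v)) x
        | u t x v \<alpha> \<beta>. \<alpha> \<in> \<Sigma> \<and> \<beta> \<in> \<Sigma> \<and> is_word \<Sigma> A \<sigma> \<alpha> u \<and> length u = j - 1 \<and>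
            t \<in> quadratic_kernel \<Sigma> A \<alpha> \<beta> \<and> x \<in> t \<and> is_word \<Sigma> A \<beta> \<rho> v \<and> length v = n - j - 1})"

definition quadratic :: "'s set \<Rightarrow> ('s, 'a, 'r) big_graded_data_scheme \<Rightarrow> bool" where
  "quadratic \<Sigma> A \<longleftrightarrow> big_graded_ring \<Sigma> A \<and>
     (\<forall>n \<ge> 2. \<forall>\<sigma> \<in> \<Sigma>. \<forall>\<rho> \<in> \<Sigma>.
        (\<lambda>X. the_elem (tensor_power_map A n \<sigma> \<rho> ` X))
          \<in> iso (tensor_power \<Sigma> A n \<sigma> \<rho> Mod quadratic_relations \<Sigma> A n \<sigma> \<rho>) (cpt A \<sigma> \<rho> n))"


section \<open>Diagonal cohomology\<close>

text \<open>
  The twist commutes with the shift only through \<open>\<phi>\<close>. The following isomorphisms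
  \<open>(X[n])(1) \<rightarrow> (X(1))[n]\<close> and \<open>(X[n])(m) \<rightarrow> (X(m))[n]\<close> are its iterates.
\<close>

primrec twist_shift ::
    "('o, 'm, 'r) triangulated_data_scheme \<Rightarrow> ('o \<Rightarrow> 'o) \<Rightarrow> ('o \<Rightarrow> 'm) \<Rightarrow> nat \<Rightarrow> 'o \<Rightarrow> 'm" where
  "twist_shift D T0 \<phi> 0 X = idm D (T0 X)"
| "twist_shift D T0 \<phi> (Suc n) X = sh1 D (twist_shift D T0 \<phi> n X) \<cdot>\<^bsub>D\<^esub> \<phi> ((sh0 D ^^ n) X)"

primrec twists_shift ::
    "('o, 'm, 'r) triangulated_data_scheme \<Rightarrow> ('o \<Rightarrow> 'o) \<Rightarrow> ('m \<Rightarrow> 'm) \<Rightarrow> ('o \<Rightarrow> 'm)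
      \<Rightarrow> nat \<Rightarrow> nat \<Rightarrow> 'o \<Rightarrow> 'm" where
  "twists_shift D T0 T1 \<phi> 0 n X = idm D ((sh0 D ^^ n) X)"
| "twists_shift D T0 T1 \<phi> (Suc m) n X =
     twist_shift D T0 \<phi> n ((T0 ^^ m) X) \<cdot>\<^bsub>D\<^esub> T1 (twists_shift D T0 T1 \<phi> m n X)"

text \<open>
  The component \<open>YX;n\<close> is the group of morphisms \<open>X \<rightarrow> Y(n)[n]\<close>. The product of \<open>g : Y \<rightarrow> Z(n)[n]\<close> and
  \<open>f : X \<rightarrow> Y(m)[m]\<close> is the composition
  \<open>X \<rightarrow> Y(m)[m] \<rightarrow> Z(n)[n](m)[m] \<rightarrow> Z(m)(n)[n][m] = Z(n + m)[n + m]\<close>.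
\<close>

definition diagonal_cohomology ::
    "('o, 'm, 'r) triangulated_data_scheme \<Rightarrow> ('o \<Rightarrow> 'o) \<Rightarrow> ('m \<Rightarrow> 'm) \<Rightarrow> ('o \<Rightarrow> 'm)
      \<Rightarrow> ('o, 'm) big_graded_data" where
  "diagonal_cohomology D T0 T1 \<phi> =
     \<lparr>cpt = (\<lambda>Y X n. Hom D X ((sh0 D ^^ n) ((T0 ^^ n) Y))),
      mul = (\<lambda>Z Y X n m g f.
        (sh1 D ^^ m) (twists_shift D T0 T1 \<phi> m n ((T0 ^^ n) Z) \<cdot>\<^bsub>D\<^esub> (T1 ^^ m) g) \<cdot>\<^bsub>D\<^esub> f),
      unt = (\<lambda>X. idm D X)\<rparr>"

end

theory Submission
  imports Defs
begin

text \<open>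
  As \<open>Hom(\<E>\<^sub>i, \<E>\<^sub>j[1]) = 0\<close> for \<open>i \<ge> j\<close>, every object of \<open>\<M>\<close> is an extension of an object built from
  \<open>\<E>\<^sub>k\<close>, \<open>k \<le> j\<close>, by a subobject built from \<open>\<E>\<^sub>k\<close>, \<open>k > j\<close>. The chain condition splits a last step
  \<open>Z \<rightarrow> Y[1]\<close> off a morphism \<open>X \<rightarrow> Y[n]\<close>. If \<open>Y\<close> is in \<open>\<E>\<^sub>j\<close>, this step kills the part of \<open>Z\<close> built from
  \<open>\<E>\<^sub>k\<close>, \<open>k \<ge> j\<close>, so that \<open>Z\<close> can be replaced by its quotient built from \<open>\<E>\<^sub>k\<close>, \<open>k < j\<close>, and (1) follows
  by induction on \<open>n\<close>. In the diagonal case (1) shows that an object of \<open>\<E>\<^sub>j\<^sub>-\<^sub>1\<close> suffices, hence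
  \<open>A\<close> is generated by \<open>A\<^sub>1\<close> over \<open>A\<^sub>0\<close>.

  For the relations let \<open>b : X \<rightarrow> W[n + 1]\<close> and \<open>a : W \<rightarrow> Y[1]\<close> have the product \<open>0\<close>. Then \<open>b\<close> lifts to the
  extension \<open>Z\<close> of \<open>W\<close> by \<open>Y\<close> with the class \<open>a\<close>, an object of \<open>\<M>\<close>. Splitting a last step off the lift gives
  \<open>b = e h\<close> and \<open>a e = a' e'\<close>, \<open>e' h = 0\<close> with \<open>e\<close>, \<open>a'\<close>, \<open>e'\<close> of degree one, so that
  \<open>a \<otimes> b = (a \<otimes> e - a' \<otimes> e') \<otimes> h + a' \<otimes> e' h\<close> comes from \<open>I \<otimes> A\<^sub>n\<close>.
\<close>

section \<open>A criterion for quadratic big graded rings\<close>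

text \<open>The chain condition supplies a middle object \<open>V\<close> of which only
  \<open>V \<in> M\<close> is known. It is cut down from both sides: the last map kills the part of
  \<open>V\<close> of high index, and by (1) the first map vanishes into the quotient of low index,
  so that a single slice \<open>E k\<close> remains. For relations these cuts leave a defect. Only
  the composite \<open>V \<rightarrow> Z[1] \<rightarrow> W[1]\<close> factors through the quotient
  \<open>U\<close> of \<open>V\<close>; the map to \<open>Z[1]\<close> need not. The connecting map
  \<open>U \<rightarrow> V'[1]\<close> of the cut \<open>V' \<rightarrow> V \<rightarrow> U\<close>
  records the difference, and the second product \<open>a' e'\<close> arises from it. As
  \<open>J\<close> generates \<open>E 0\<close> only by finite direct sums, an element of A is a row
  times a column. A relation with several terms is assembled into one composite through a direct
  sum, treated there, and expanded again. Arrows between twisted objects have to be read as elements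
  of A, and since twist and shift commute only up to \<open>\<phi>\<close>, this requires coherence
  identities.\<close>

lemma hom_finprod:
  assumes G: "comm_group G" and H: "comm_group H" and h: "h \<in> hom G H"
    and f: "\<And>i. i \<in> I \<Longrightarrow> f i \<in> carrier G"
  shows "h (finprod G f I) = finprod H (\<lambda>i. h (f i)) I"
proof -
  interpret G: comm_group G by fact
  interpret H: comm_group H by fact
  interpret group_hom G H h
    using h by unfold_locales
  show ?thesis
    using f
  proof (induction I rule: infinite_finite_induct)
    case (insert i I)
    then have "f \<in> I \<rightarrow> carrier G" "(\<lambda>i. h (f i)) \<in> I \<rightarrow> carrier H"
      by auto
    then show ?case
      using insert by (simp add: G.finprod_insert H.finprod_insert)
  qed simp_all
qed

text \<open>The universal property of the free abelian group, for the very product that defines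
  \<open>word_group_map\<close>. The keys change under addition, so the product is rewritten as
  \<open>gfinprod\<close> over the fixed set \<open>S\<close>, where additivity holds factor by
  factor.\<close>

lemma (in comm_group) finprod_keys_hom:
  assumes f: "f ` S \<subseteq> carrier G"
  defines "h \<equiv> \<lambda>x. finprod G (\<lambda>a. f a [^] Poly_Mapping.lookup x a) (Poly_Mapping.keys x)"
  shows "h \<in> hom (free_Abelian_group S) G"
    and "a \<in> S \<Longrightarrow> h (frag_of a) = f a"
proof -
  have h_eq: "h x = gfinprod G (\<lambda>a. f a [^] Poly_Mapping.lookup x a) S"
    if "Poly_Mapping.keys x \<subseteq> S" for x
  proof -
    have "gfinprod G (\<lambda>a. f a [^] Poly_Mapping.lookup x a) S =
        gfinprod G (\<lambda>a. f a [^] Poly_Mapping.lookup x a) (Poly_Mapping.keys x)"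
      by (rule gfinprod_mono_neutral_cong_right) (use that f in \<open>auto simp: in_keys_iff\<close>)
    also have "\<dots> = h x"
      unfolding h_def by (rule gfinprod_eq_finprod) (use that f in auto)
    finally show ?thesis by simp
  qed
  have fin: "Poly_Mapping.keys u \<subseteq> S \<Longrightarrow> finite {x \<in> S. f x [^] Poly_Mapping.lookup u x \<noteq> \<one>}"
    for u :: "_ \<Rightarrow>\<^sub>0 int"
    by (rule finite_subset [OF _ finite_keys [of u]]) (auto simp: in_keys_iff)
  show "h \<in> hom (free_Abelian_group S) G"
  proof (rule homI)
    fix x y
    assume xy: "x \<in> carrier (free_Abelian_group S)" "y \<in> carrier (free_Abelian_group S)"
    then have "Poly_Mapping.keys (x + y) \<subseteq> S"
      using keys_add[of x y] by auto
    then show "h (x \<otimes>\<^bsub>free_Abelian_group S\<^esub> y) = h x \<otimes> h y"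
      using f xy
      by (simp add: h_eq fin gfinprod_distrib image_subset_iff Poly_Mapping.lookup_add int_pow_mult
          cong: gfinprod_cong)
  qed (use f in \<open>auto simp: h_def intro!: finprod_closed\<close>)
  show "h (frag_of a) = f a" if "a \<in> S"
    using f that by (auto simp: h_def finprod_singleton)
qed

section \<open>Words, their products and the multiplication map\<close>

context big_graded_ring
begin

abbreviation wgrp where "wgrp \<equiv> word_group \<Sigma> A"
abbreviation wmap where "wmap \<equiv> word_group_map A"
abbreviation trel where "trel \<equiv> tensor_relations \<Sigma> A"
abbreviation tpow where "tpow \<equiv> tensor_power \<Sigma> A"
abbreviation tmap where "tmap \<equiv> tensor_power_map A"

abbreviation words :: "nat \<Rightarrow> 's \<Rightarrow> 's \<Rightarrow> ('a \<times> 's) list set" where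
  "words n \<sigma> \<rho> \<equiv> {w. length w = n \<and> is_word \<Sigma> A \<sigma> \<rho> w}"

lemma is_word_append_iff:
  "is_word \<Sigma> A \<sigma> \<rho> (u @ v) \<longleftrightarrow> (\<exists>\<alpha>. is_word \<Sigma> A \<sigma> \<alpha> u \<and> is_word \<Sigma> A \<alpha> \<rho> v)"
  by (induction u arbitrary: \<sigma>) auto

lemma is_word_append:
  "is_word \<Sigma> A \<sigma> \<alpha> u \<Longrightarrow> is_word \<Sigma> A \<alpha> \<rho> v \<Longrightarrow> is_word \<Sigma> A \<sigma> \<rho> (u @ v)"
  by (auto simp: is_word_append_iff)

lemma is_word_target: "is_word \<Sigma> A \<sigma> \<rho> w \<Longrightarrow> \<sigma> \<in> \<Sigma> \<Longrightarrow> \<rho> \<in> \<Sigma>"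
  by (induction w arbitrary: \<sigma>) auto

lemma word_product_closed:
  "\<lbrakk>\<sigma> \<in> \<Sigma>; is_word \<Sigma> A \<sigma> \<rho> w\<rbrakk> \<Longrightarrow> word_product A \<sigma> \<rho> w \<in> carrier (cpt A \<sigma> \<rho> (length w))"
proof (induction w arbitrary: \<sigma>)
  case (Cons x w)
  obtain a \<tau> where x: "x = (a, \<tau>)" by fastforce
  have "\<rho> \<in> \<Sigma>" using Cons.prems is_word_target by blast
  then show ?case
    using Cons x mul_closed[of \<sigma> \<tau> \<rho> a 1 "word_product A \<tau> \<rho> w" "length w"] by simp
qed (auto simp: unt_closed)

text \<open>Associativity of A, in the form that lets any stretch of a word be multiplied out on its
  own.\<close>

lemma word_product_append:
  "\<lbrakk>\<sigma> \<in> \<Sigma>; is_word \<Sigma> A \<sigma> \<alpha> u; is_word \<Sigma> A \<alpha> \<rho> v\<rbrakk> \<Longrightarrow>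
    word_product A \<sigma> \<rho> (u @ v) =
    mul A \<sigma> \<alpha> \<rho> (length u) (length v) (word_product A \<sigma> \<alpha> u) (word_product A \<alpha> \<rho> v)"
proof (induction u arbitrary: \<sigma>)
  case Nil
  then show ?case
    using unt_left word_product_closed is_word_target by (metis append_Nil is_word.simps(1) list.size(3) word_product.simps(1))
next
  case (Cons x w)
  obtain a \<tau> where x: "x = (a, \<tau>)" by fastforce
  have t: "\<tau> \<in> \<Sigma>" "\<alpha> \<in> \<Sigma>" "\<rho> \<in> \<Sigma>" "is_word \<Sigma> A \<tau> \<alpha> w" "a \<in> carrier (cpt A \<sigma> \<tau> 1)"
    using Cons.prems is_word_target x by auto
  then show ?case
    using Cons.IH[of \<tau>] Cons.prems x
      mul_assoc[of \<sigma> \<tau> \<alpha> \<rho> a 1 "word_product A \<tau> \<alpha> w" "length w" "word_product A \<alpha> \<rho> v" "length v"]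
      word_product_closed
    by simp
qed

lemma word_group_map_hom:
  assumes "\<sigma> \<in> \<Sigma>" "\<rho> \<in> \<Sigma>"
  shows "wmap n \<sigma> \<rho> \<in> hom (wgrp n \<sigma> \<rho>) (cpt A \<sigma> \<rho> n)"
  and "w \<in> words n \<sigma> \<rho> \<Longrightarrow> wmap n \<sigma> \<rho> (frag_of w) = word_product A \<sigma> \<rho> w"
proof -
  interpret G: comm_group "cpt A \<sigma> \<rho> n"
    using comp_group assms .
  have "word_product A \<sigma> \<rho> ` words n \<sigma> \<rho> \<subseteq> carrier (cpt A \<sigma> \<rho> n)"
    using word_product_closed assms by auto
  note * = G.finprod_keys_hom[OF this]
  show "wmap n \<sigma> \<rho> \<in> hom (wgrp n \<sigma> \<rho>) (cpt A \<sigma> \<rho> n)"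
    using *(1) unfolding word_group_def word_group_map_def .
  show "w \<in> words n \<sigma> \<rho> \<Longrightarrow> wmap n \<sigma> \<rho> (frag_of w) = word_product A \<sigma> \<rho> w"
    using *(2) unfolding word_group_map_def .
qed

lemma word_group_group: "comm_group (wgrp n \<sigma> \<rho>)"
  by (simp add: word_group_def abelian_free_Abelian_group)

lemma word_group_simps [simp]:
  "x \<in> carrier (wgrp n \<sigma> \<rho>) \<longleftrightarrow> Poly_Mapping.keys x \<subseteq> words n \<sigma> \<rho>"
  "x \<otimes>\<^bsub>wgrp n \<sigma> \<rho>\<^esub> y = x + y"
  "\<one>\<^bsub>wgrp n \<sigma> \<rho>\<^esub> = 0"
  by (simp_all add: word_group_def)

lemma word_group_map_group_hom:
  "\<sigma> \<in> \<Sigma> \<Longrightarrow> \<rho> \<in> \<Sigma> \<Longrightarrow>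
    group_hom (wgrp n \<sigma> \<rho>) (cpt A \<sigma> \<rho> n) (wmap n \<sigma> \<rho>)"
  using word_group_map_hom(1) word_group_group comp_group
  by (simp add: group_hom_def group_hom_axioms_def comm_group_def)

lemma mul_hom_left:
  "\<lbrakk>\<sigma> \<in> \<Sigma>; \<tau> \<in> \<Sigma>; \<rho> \<in> \<Sigma>; b \<in> carrier (cpt A \<tau> \<rho> m)\<rbrakk> \<Longrightarrow>
    (\<lambda>a. mul A \<sigma> \<tau> \<rho> n m a b) \<in> hom (cpt A \<sigma> \<tau> n) (cpt A \<sigma> \<rho> (n + m))"
  by (rule homI) (auto simp: mul_closed mul_add_left)

lemma mul_hom_right:
  "\<lbrakk>\<sigma> \<in> \<Sigma>; \<tau> \<in> \<Sigma>; \<rho> \<in> \<Sigma>; a \<in> carrier (cpt A \<sigma> \<tau> n)\<rbrakk> \<Longrightarrow>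
    mul A \<sigma> \<tau> \<rho> n m a \<in> hom (cpt A \<tau> \<rho> m) (cpt A \<sigma> \<rho> (n + m))"
  by (rule homI) (auto simp: mul_closed mul_add_right)

end

lemma keys_frag_extend_of:
  "Poly_Mapping.keys (frag_extend (\<lambda>w. frag_of (f w)) x) \<subseteq> f ` Poly_Mapping.keys x"
  using keys_frag_extend[of "\<lambda>w. frag_of (f w)" x] by auto

lemma hom_eq_on_free_Abelian_group:
  assumes "group G" "g \<in> hom (free_Abelian_group S) G" "h \<in> hom (free_Abelian_group S) G"
    and eq: "\<And>a. a \<in> S \<Longrightarrow> g (frag_of a) = h (frag_of a)"
    and x: "x \<in> carrier (free_Abelian_group S)"
  shows "g x = h x"
proof -
  interpret g: group_hom "free_Abelian_group S" G g
    using assms by (simp add: group_hom_def group_hom_axioms_def)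
  interpret h: group_hom "free_Abelian_group S" G h
    using assms by (simp add: group_hom_def group_hom_axioms_def)
  show ?thesis
  proof (rule free_Abelian_group_induct[where P = "\<lambda>x. g x = h x"])
    show "Poly_Mapping.keys x \<subseteq> S" using x by simp
    show "g 0 = h 0" using g.hom_one h.hom_one by simp
  next
    fix x y
    assume *: "Poly_Mapping.keys x \<subseteq> S" "Poly_Mapping.keys y \<subseteq> S" "g x = h x" "g y = h y"
    have c: "x \<in> carrier (free_Abelian_group S)" "y \<in> carrier (free_Abelian_group S)"
      "inv\<^bsub>free_Abelian_group S\<^esub> y \<in> carrier (free_Abelian_group S)" using * by auto
    have "inv\<^bsub>free_Abelian_group S\<^esub> y = - y"
      using * by simp
    then show "g (x - y) = h (x - y)"
      using *(3,4) g.hom_mult[OF c(1,3)] h.hom_mult[OF c(1,3)] g.hom_inv[OF c(2)] h.hom_inv[OF c(2)]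
      by (simp del: inv_free_Abelian_group)
  qed (rule eq)
qed

lemma frag_extend_hom:
  assumes "f ` S \<subseteq> T"
  shows "frag_extend (\<lambda>w. frag_of (f w)) \<in> hom (free_Abelian_group S) (free_Abelian_group T)"
  by (rule homI) (use assms keys_frag_extend_of[of f] in \<open>fastforce simp: frag_extend_add\<close>)+

context big_graded_ring
begin

text \<open>Both sides are homomorphisms in \<open>x\<close>, so it is enough to compare them on
  single words, where \<open>word_product_append\<close> applies. It shows that a tensor
  \<open>u \<otimes> x \<otimes> v\<close> dies in A as soon as \<open>x\<close> does.\<close>

lemma word_group_map_append:
  assumes S: "\<sigma> \<in> \<Sigma>" "\<alpha> \<in> \<Sigma>" "\<beta> \<in> \<Sigma>" "\<rho> \<in> \<Sigma>"
    and u: "is_word \<Sigma> A \<sigma> \<alpha> u" and v: "is_word \<Sigma> A \<beta> \<rho> v"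
    and x: "x \<in> carrier (wgrp n \<alpha> \<beta>)"
  shows "wmap (length u + (n + length v)) \<sigma> \<rho> (frag_extend (\<lambda>w. frag_of (u @ w @ v)) x) =
    mul A \<sigma> \<alpha> \<rho> (length u) (n + length v) (word_product A \<sigma> \<alpha> u)
      (mul A \<alpha> \<beta> \<rho> n (length v) (wmap n \<alpha> \<beta> x) (word_product A \<beta> \<rho> v))"
proof (rule hom_eq_on_free_Abelian_group[where S = "words n \<alpha> \<beta>" and G = "cpt A \<sigma> \<rho> (length u + (n + length v))"])
  have uvc: "word_product A \<sigma> \<alpha> u \<in> carrier (cpt A \<sigma> \<alpha> (length u))"
    "word_product A \<beta> \<rho> v \<in> carrier (cpt A \<beta> \<rho> (length v))"
    using word_product_closed S u v by auto
  show "group (cpt A \<sigma> \<rho> (length u + (n + length v)))"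
    using comp_group[OF S(1,4)] by (simp add: comm_group_def)
  have "frag_extend (\<lambda>w. frag_of (u @ w @ v)) \<in> hom (wgrp n \<alpha> \<beta>)
     (wgrp (length u + (n + length v)) \<sigma> \<rho>)"
    unfolding word_group_def
    by (rule frag_extend_hom) (use u v in \<open>auto intro!: is_word_append\<close>)
  from hom_compose[OF this word_group_map_hom(1)[OF S(1,4)]]
  show "(\<lambda>x. wmap (length u + (n + length v)) \<sigma> \<rho> (frag_extend (\<lambda>w. frag_of (u @ w @ v)) x))
     \<in> hom (free_Abelian_group (words n \<alpha> \<beta>)) (cpt A \<sigma> \<rho> (length u + (n + length v)))"
    by (simp add: o_def word_group_def)
  from hom_compose[OF hom_compose[OF word_group_map_hom(1)[OF S(2,3)] mul_hom_left[OF S(2,3,4) uvc(2)]]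
      mul_hom_right[OF S(1,2,4) uvc(1)]]
  show "(\<lambda>x. mul A \<sigma> \<alpha> \<rho> (length u) (n + length v) (word_product A \<sigma> \<alpha> u)
      (mul A \<alpha> \<beta> \<rho> n (length v) (wmap n \<alpha> \<beta> x) (word_product A \<beta> \<rho> v)))
    \<in> hom (free_Abelian_group (words n \<alpha> \<beta>)) (cpt A \<sigma> \<rho> (length u + (n + length v)))"
    by (simp add: o_def word_group_def)
  fix w assume w: "w \<in> words n \<alpha> \<beta>"
  have wv: "is_word \<Sigma> A \<alpha> \<rho> (w @ v)" using w v is_word_append by auto
  have "u @ w @ v \<in> words (length u + (n + length v)) \<sigma> \<rho>"
    using w u wv is_word_append by auto
  then show "wmap (length u + (n + length v)) \<sigma> \<rho> (frag_extend (\<lambda>w. frag_of (u @ w @ v)) (frag_of w)) =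
    mul A \<sigma> \<alpha> \<rho> (length u) (n + length v) (word_product A \<sigma> \<alpha> u)
      (mul A \<alpha> \<beta> \<rho> n (length v) (wmap n \<alpha> \<beta> (frag_of w)) (word_product A \<beta> \<rho> v))"
    using word_product_append[OF S(1) u wv] word_product_append[OF S(2) _ v, of w] w
    by (simp add: word_group_map_hom(2)[OF S(1,4)] word_group_map_hom(2)[OF S(2,3)])
qed (use x in simp)


text \<open>The tensor \<open>a \<otimes> y\<close> with a first factor \<open>a\<close> in
  \<open>A\<^sub>1\<close>.\<close>

abbreviation cons_frag :: "'a \<Rightarrow> 's \<Rightarrow> (('a \<times> 's) list \<Rightarrow>\<^sub>0 int) \<Rightarrow> (('a \<times> 's) list \<Rightarrow>\<^sub>0 int)" where
  "cons_frag a \<tau> \<equiv> frag_extend (\<lambda>w. frag_of ((a, \<tau>) # w))"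

lemma cons_frag_closed:
  assumes "\<tau> \<in> \<Sigma>" "a \<in> carrier (cpt A \<sigma> \<tau> 1)" "y \<in> carrier (wgrp n \<tau> \<rho>)"
  shows "cons_frag a \<tau> y \<in> carrier (wgrp (Suc n) \<sigma> \<rho>)"
  using assms keys_frag_extend_of[of "\<lambda>w. (a, \<tau>) # w" y] by fastforce

lemma word_group_map_cons:
  assumes "\<sigma> \<in> \<Sigma>" "\<tau> \<in> \<Sigma>" "\<rho> \<in> \<Sigma>" "a \<in> carrier (cpt A \<sigma> \<tau> 1)"
    "y \<in> carrier (wgrp n \<tau> \<rho>)"
  shows "wmap (Suc n) \<sigma> \<rho> (cons_frag a \<tau> y) =
    mul A \<sigma> \<tau> \<rho> 1 n a (wmap n \<tau> \<rho> y)"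
proof -
  have "wmap n \<tau> \<rho> y \<in> carrier (cpt A \<tau> \<rho> n)"
    using word_group_map_hom(1)[OF assms(2,3)] assms(5) by (rule hom_in_carrier)
  then show ?thesis
    using word_group_map_append[of \<sigma> \<tau> \<rho> \<rho> "[(a, \<tau>)]" "[]" y n] assms
      unt_right[of \<sigma> \<tau> a 1] unt_right[of \<tau> \<rho>] by simp
qed

lemma finprod_word_group:
  "finite I \<Longrightarrow> (\<And>i. i \<in> I \<Longrightarrow> f i \<in> carrier (wgrp n \<sigma> \<rho>)) \<Longrightarrow>
    finprod (wgrp n \<sigma> \<rho>) f I = sum f I"
proof (induction I rule: finite_induct)
  case empty
  interpret comm_group "wgrp n \<sigma> \<rho>" by (rule word_group_group)
  show ?case by simp
next
  case (insert i I)
  interpret comm_group "wgrp n \<sigma> \<rho>" by (rule word_group_group)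
  have "f \<in> I \<rightarrow> carrier (wgrp n \<sigma> \<rho>)" "f i \<in> carrier (wgrp n \<sigma> \<rho>)"
    using insert.prems by blast+
  then show ?case
    using insert.hyps insert.IH insert.prems by (subst finprod_insert) auto
qed

lemma sum_word_group_closed:
  "(\<And>i. i \<in> I \<Longrightarrow> f i \<in> carrier (wgrp n \<sigma> \<rho>)) \<Longrightarrow>
    sum f I \<in> carrier (wgrp n \<sigma> \<rho>)"
  unfolding word_group_def by (rule sum_closed_free_Abelian_group)

lemma word_group_map_sum:
  assumes "\<sigma> \<in> \<Sigma>" "\<rho> \<in> \<Sigma>" "finite I" "\<And>i. i \<in> I \<Longrightarrow> f i \<in> carrier (wgrp n \<sigma> \<rho>)"
  shows "wmap n \<sigma> \<rho> (sum f I) =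
    finprod (cpt A \<sigma> \<rho> n) (\<lambda>i. wmap n \<sigma> \<rho> (f i)) I"
  using hom_finprod[OF word_group_group comp_group word_group_map_hom(1), of \<sigma> \<rho> I f n]
    finprod_word_group[OF assms(3), of f n \<sigma> \<rho>] assms by simp

lemma word_group_diff_closed:
  "x \<in> carrier (wgrp n \<sigma> \<rho>) \<Longrightarrow> y \<in> carrier (wgrp n \<sigma> \<rho>) \<Longrightarrow>
    x - y \<in> carrier (wgrp n \<sigma> \<rho>)"
  using keys_diff[of x y] by auto

lemma word_group_map_diff:
  assumes S: "\<sigma> \<in> \<Sigma>" "\<rho> \<in> \<Sigma>"
    and xy: "x \<in> carrier (wgrp n \<sigma> \<rho>)" "y \<in> carrier (wgrp n \<sigma> \<rho>)"
  shows "wmap n \<sigma> \<rho> (x - y) = wmap n \<sigma> \<rho> x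
    \<otimes>\<^bsub>cpt A \<sigma> \<rho> n\<^esub> inv\<^bsub>cpt A \<sigma> \<rho> n\<^esub> wmap n \<sigma> \<rho> y"
proof -
  interpret group_hom "wgrp n \<sigma> \<rho>" "cpt A \<sigma> \<rho> n" "wmap n \<sigma> \<rho>"
    using word_group_map_group_hom S .
  have "inv\<^bsub>wgrp n \<sigma> \<rho>\<^esub> y = - y"
    using xy by (simp add: word_group_def)
  then show ?thesis
    using hom_mult[of x "inv\<^bsub>wgrp n \<sigma> \<rho>\<^esub> y"] hom_inv[of y] xy by simp
qed

text \<open>Words are split after their first letter, and the integer coefficient of a word goes
  into its tail. A sum of tensors \<open>a k \<otimes> y k\<close> is the shape on which the
  induction on the number of factors works.\<close>

lemma word_group_decompose:
  assumes x: "x \<in> carrier (wgrp (Suc n) \<sigma> \<rho>)"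
  shows "\<exists>N \<tau> a y. (\<forall>k < (N::nat). \<tau> k \<in> \<Sigma> \<and> a k \<in> carrier (cpt A \<sigma> (\<tau> k) 1) \<and>
      y k \<in> carrier (wgrp n (\<tau> k) \<rho>)) \<and>
    x = (\<Sum>k<N. cons_frag (a k) (\<tau> k) (y k))"
proof -
  obtain ws where ws: "distinct ws" "set ws = Poly_Mapping.keys x"
    using finite_distinct_list[OF finite_keys[of x]] by metis
  define \<tau> where "\<tau> = (\<lambda>k. snd (hd (ws ! k)))"
  define a where "a = (\<lambda>k. fst (hd (ws ! k)))"
  define y where "y = (\<lambda>k. frag_cmul (Poly_Mapping.lookup x (ws ! k)) (frag_of (tl (ws ! k))))"
  have w: "\<tau> k \<in> \<Sigma> \<and> a k \<in> carrier (cpt A \<sigma> (\<tau> k) 1) \<and> tl (ws ! k) \<in> words n (\<tau> k) \<rho> \<and>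
      ws ! k = (a k, \<tau> k) # tl (ws ! k)" if "k < length ws" for k
  proof -
    have "ws ! k \<in> words (Suc n) \<sigma> \<rho>"
      using nth_mem[OF that] subsetD[OF x[unfolded word_group_simps]] unfolding ws(2) by simp
    then show ?thesis
      by (cases "ws ! k") (auto simp: a_def \<tau>_def)
  qed
  have "x = (\<Sum>w\<in>set ws. frag_cmul (Poly_Mapping.lookup x w) (frag_of w))"
    using frag_expansion[of x] ws by (simp add: frag_extend_def)
  also have "\<dots> = (\<Sum>k<length ws. frag_cmul (Poly_Mapping.lookup x (ws ! k)) (frag_of (ws ! k)))"
    using sum.reindex_bij_betw[OF bij_betw_nth[OF ws(1) refl refl],
        of "\<lambda>w. frag_cmul (Poly_Mapping.lookup x w) (frag_of w)"] by simp
  also have "\<dots> = (\<Sum>k<length ws. cons_frag (a k) (\<tau> k) (y k))"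
  proof (rule sum.cong)
    fix k assume "k \<in> {..<length ws}"
    then show "frag_cmul (Poly_Mapping.lookup x (ws ! k)) (frag_of (ws ! k)) = cons_frag (a k) (\<tau> k) (y k)"
      using w[of k] by (simp add: y_def frag_extend_cmul)
  qed simp
  finally have "x = (\<Sum>k<length ws. cons_frag (a k) (\<tau> k) (y k))" .
  moreover have "y k \<in> carrier (wgrp n (\<tau> k) \<rho>)" if "k < length ws" for k
  proof -
    have "Poly_Mapping.keys (y k) \<subseteq> {tl (ws ! k)}"
      unfolding y_def using keys_cmul[of _ "frag_of (tl (ws ! k))"] by simp
    then show ?thesis using w[OF that] by auto
  qed
  ultimately show ?thesis
    using w by blast
qed

text \<open>
  The relations of the tensor product over \<open>A\<^sub>0\<close> need not be added to the generators: those in two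
  neighbouring factors belong to the kernel.
\<close>

inductive quad_rel :: "nat \<Rightarrow> 's \<Rightarrow> 's \<Rightarrow> (('a \<times> 's) list \<Rightarrow>\<^sub>0 int) \<Rightarrow> bool" where
  zero: "quad_rel n \<sigma> \<rho> 0"
| diff: "quad_rel n \<sigma> \<rho> x \<Longrightarrow> quad_rel n \<sigma> \<rho> y \<Longrightarrow> quad_rel n \<sigma> \<rho> (x - y)"
| ker: "\<lbrakk>\<alpha> \<in> \<Sigma>; \<beta> \<in> \<Sigma>; is_word \<Sigma> A \<sigma> \<alpha> u; is_word \<Sigma> A \<beta> \<rho> v;
    x \<in> carrier (wgrp 2 \<alpha> \<beta>); wmap 2 \<alpha> \<beta> x = \<one>\<^bsub>cpt A \<alpha> \<beta> 2\<^esub>;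
    n = length u + 2 + length v\<rbrakk>
    \<Longrightarrow> quad_rel n \<sigma> \<rho> (frag_extend (\<lambda>w. frag_of (u @ w @ v)) x)"

lemma quad_rel_minus: "quad_rel n \<sigma> \<rho> x \<Longrightarrow> quad_rel n \<sigma> \<rho> (- x)"
  using quad_rel.diff[OF quad_rel.zero] by fastforce

lemma quad_rel_add: "quad_rel n \<sigma> \<rho> x \<Longrightarrow> quad_rel n \<sigma> \<rho> y \<Longrightarrow> quad_rel n \<sigma> \<rho> (x + y)"
  using quad_rel.diff[OF _ quad_rel_minus] by fastforce

lemma quad_rel_sum:
  "(\<And>i. i \<in> I \<Longrightarrow> quad_rel n \<sigma> \<rho> (f i)) \<Longrightarrow> quad_rel n \<sigma> \<rho> (sum f I)"
  by (induction I rule: infinite_finite_induct) (auto intro: quad_rel.zero quad_rel_add)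

lemma quad_rel_cmul: "quad_rel n \<sigma> \<rho> x \<Longrightarrow> quad_rel n \<sigma> \<rho> (frag_cmul c x)"
proof (induction c rule: int_induct[where k = 0])
  case (step1 i)
  then show ?case by (simp add: frag_cmul_distrib quad_rel_add)
next
  case (step2 i)
  then show ?case
    using quad_rel.diff[of n \<sigma> \<rho> "frag_cmul i x" x] by (simp add: frag_cmul_diff_distrib)
qed (simp add: quad_rel.zero)

text \<open>Prefixing a letter only lengthens the left word \<open>u\<close> of a generator. This
  carries the induction hypothesis for \<open>n\<close> factors over to
  \<open>n + 1\<close>.\<close>

lemma quad_rel_cons:
  assumes "quad_rel n \<tau> \<rho> y" "\<tau> \<in> \<Sigma>" "a \<in> carrier (cpt A \<sigma> \<tau> 1)"
  shows "quad_rel (Suc n) \<sigma> \<rho> (cons_frag a \<tau> y)"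
  using assms
proof (induction rule: quad_rel.induct)
  case (ker \<alpha> \<beta> \<tau> u \<rho> v x n)
  have "cons_frag a \<tau> (frag_extend (\<lambda>w. frag_of (u @ w @ v)) x) =
      frag_extend (\<lambda>w. frag_of (((a, \<tau>) # u) @ w @ v)) x"
    using frag_extend_compose[of "\<lambda>w. frag_of ((a, \<tau>) # w)" "\<lambda>w. u @ w @ v" x] by (simp add: o_def)
  then show ?case
    using quad_rel.ker[of \<alpha> \<beta> \<sigma> "(a, \<tau>) # u" \<rho> v x "Suc n"] ker by simp
qed (auto simp: frag_extend_diff intro: quad_rel.intros)

end

text \<open>The empty prefix gives the summands the shape of the generators of \<open>quad_rel\<close>.\<close>

definition frag_append :: "('b list \<Rightarrow>\<^sub>0 int) \<Rightarrow> ('b list \<Rightarrow>\<^sub>0 int) \<Rightarrow> ('b list \<Rightarrow>\<^sub>0 int)" where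
  "frag_append t z = frag_extend (\<lambda>v. frag_extend (\<lambda>w. frag_of ([] @ w @ v)) t) z"

text \<open>The outer \<open>frag_extend\<close> makes \<open>frag_append\<close> linear in
  \<open>z\<close> at once; additivity in \<open>t\<close> holds inside each summand.\<close>

lemma frag_append_add: "frag_append (t + s) z = frag_append t z + frag_append s z"
  by (simp add: frag_append_def frag_extend_def[of _ z] frag_extend_add frag_cmul_distrib2 sum.distrib)

lemma frag_append_diff: "frag_append (t - s) z = frag_append t z - frag_append s z"
  using frag_append_add[of "t - s" s z] by simp

lemma frag_append_sum: "frag_append (sum t I) z = (\<Sum>i\<in>I. frag_append (t i) z)"
proof -
  have "frag_append 0 z = 0" using frag_append_diff[of 0 0 z] by simp
  then show ?thesis
    by (induction I rule: infinite_finite_induct) (auto simp: frag_append_add)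
qed

lemma frag_append_of: "frag_append (frag_of w) z = frag_extend (\<lambda>v. frag_of (w @ v)) z"
  by (simp add: frag_append_def)

section \<open>Generation in degree one and quadratic relations, on representatives\<close>

context big_graded_ring
begin

lemma word_group_map_closed:
  "\<lbrakk>\<sigma> \<in> \<Sigma>; \<rho> \<in> \<Sigma>; x \<in> carrier (wgrp n \<sigma> \<rho>)\<rbrakk> \<Longrightarrow>
    wmap n \<sigma> \<rho> x \<in> carrier (cpt A \<sigma> \<rho> n)"
  using word_group_map_hom(1) by (rule hom_in_carrier)

text \<open>Expanding \<open>z\<close> into words \<open>v\<close> turns the tensor
  \<open>t \<otimes> z\<close> into an integer combination of generators of \<open>quad_rel\<close>
  with an empty word on the left.\<close>

lemma quad_rel_frag_append:
  assumes "\<sigma> \<in> \<Sigma>" "\<alpha> \<in> \<Sigma>" "t \<in> carrier (wgrp 2 \<sigma> \<alpha>)"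
    "wmap 2 \<sigma> \<alpha> t = \<one>\<^bsub>cpt A \<sigma> \<alpha> 2\<^esub>" "z \<in> carrier (wgrp n \<alpha> \<rho>)"
  shows "quad_rel (Suc (Suc n)) \<sigma> \<rho> (frag_append t z)"
  unfolding frag_append_def frag_extend_def[of _ z]
proof (intro quad_rel_sum quad_rel_cmul quad_rel.ker)
  show "is_word \<Sigma> A \<sigma> \<sigma> []" by simp
  fix v assume "v \<in> Poly_Mapping.keys z"
  then have "v \<in> words n \<alpha> \<rho>" using assms(5) by auto
  then show "is_word \<Sigma> A \<alpha> \<rho> v" "Suc (Suc n) = length ([] :: ('a \<times> 's) list) + 2 + length v"
    by auto
qed (use assms in auto)

text \<open>Surjectivity of \<open>A\<^sub>1 \<otimes> A\<^sub>n \<rightarrow>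
  A\<^sub>n\<^sub>+\<^sub>1\<close> for \<open>n \<ge> 1\<close>, stated on elements so that no
  tensor product with \<open>A\<^sub>n\<close> has to be formed.\<close>

definition linearly_generated :: bool where
  "linearly_generated \<longleftrightarrow> (\<forall>n \<ge> 1. \<forall>\<sigma> \<in> \<Sigma>. \<forall>\<rho> \<in> \<Sigma>. \<forall>f \<in> carrier (cpt A \<sigma> \<rho> (Suc n)).
     \<exists>(N :: nat) \<tau> a b.
       (\<forall>k<N. \<tau> k \<in> \<Sigma> \<and> a k \<in> carrier (cpt A \<sigma> (\<tau> k) 1) \<and> b k \<in> carrier (cpt A (\<tau> k) \<rho> n)) \<and>
       f = finprod (cpt A \<sigma> \<rho> (Suc n)) (\<lambda>k. mul A \<sigma> (\<tau> k) \<rho> 1 n (a k) (b k)) {..<N})"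

text \<open>In matrix notation, a row \<open>a\<close> and a column \<open>b\<close> with
  \<open>a b = 0\<close> admit \<open>b = e h\<close>, \<open>a e = a' e'\<close> and
  \<open>e' h = 0\<close>. This is an elementwise witness that the kernel of \<open>A\<^sub>1
  \<otimes> A\<^sub>n\<^sub>+\<^sub>1 \<rightarrow> A\<^sub>n\<^sub>+\<^sub>2\<close> comes from
  \<open>I \<otimes> A\<^sub>n\<close>. One column \<open>h\<close> serves both \<open>e\<close> and
  \<open>e'\<close>, so that the differences \<open>a e - a' e'\<close> can be tensored with
  it.\<close>

definition quadratically_related :: bool where
  "quadratically_related \<longleftrightarrow> (\<forall>n \<ge> 1. \<forall>\<sigma> \<in> \<Sigma>. \<forall>\<rho> \<in> \<Sigma>. \<forall>(N :: nat) \<tau> a b.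
     (\<forall>k<N. \<tau> k \<in> \<Sigma> \<and> a k \<in> carrier (cpt A \<sigma> (\<tau> k) 1) \<and> b k \<in> carrier (cpt A (\<tau> k) \<rho> (Suc n))) \<longrightarrow>
     finprod (cpt A \<sigma> \<rho> (Suc (Suc n))) (\<lambda>k. mul A \<sigma> (\<tau> k) \<rho> 1 (Suc n) (a k) (b k)) {..<N} =
       \<one>\<^bsub>cpt A \<sigma> \<rho> (Suc (Suc n))\<^esub> \<longrightarrow>
     (\<exists>(L :: nat) \<mu> h e (M :: nat) \<upsilon> a' e'.
       (\<forall>l<L. \<mu> l \<in> \<Sigma> \<and> h l \<in> carrier (cpt A (\<mu> l) \<rho> n)) \<and>
       (\<forall>k<N. \<forall>l<L. e k l \<in> carrier (cpt A (\<tau> k) (\<mu> l) 1)) \<and>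
       (\<forall>m<M. \<upsilon> m \<in> \<Sigma> \<and> a' m \<in> carrier (cpt A \<sigma> (\<upsilon> m) 1)) \<and>
       (\<forall>m<M. \<forall>l<L. e' m l \<in> carrier (cpt A (\<upsilon> m) (\<mu> l) 1)) \<and>
       (\<forall>k<N. finprod (cpt A (\<tau> k) \<rho> (Suc n)) (\<lambda>l. mul A (\<tau> k) (\<mu> l) \<rho> 1 n (e k l) (h l)) {..<L} = b k) \<and>
       (\<forall>l<L. finprod (cpt A \<sigma> (\<mu> l) 2) (\<lambda>k. mul A \<sigma> (\<tau> k) (\<mu> l) 1 1 (a k) (e k l)) {..<N} =
              finprod (cpt A \<sigma> (\<mu> l) 2) (\<lambda>m. mul A \<sigma> (\<upsilon> m) (\<mu> l) 1 1 (a' m) (e' m l)) {..<M}) \<and>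
       (\<forall>m<M. finprod (cpt A (\<upsilon> m) \<rho> (Suc n)) (\<lambda>l. mul A (\<upsilon> m) (\<mu> l) \<rho> 1 n (e' m l) (h l)) {..<L} =
              \<one>\<^bsub>cpt A (\<upsilon> m) \<rho> (Suc n)\<^esub>)))"

lemma sum_cons_frag:
  assumes "\<sigma> \<in> \<Sigma>" "\<rho> \<in> \<Sigma>"
    "\<And>k. k < (N::nat) \<Longrightarrow> \<tau> k \<in> \<Sigma> \<and> a k \<in> carrier (cpt A \<sigma> (\<tau> k) 1) \<and>
       y k \<in> carrier (wgrp n (\<tau> k) \<rho>)"
  shows "(\<Sum>k<N. cons_frag (a k) (\<tau> k) (y k)) \<in> carrier (wgrp (Suc n) \<sigma> \<rho>)"
    and "wmap (Suc n) \<sigma> \<rho> (\<Sum>k<N. cons_frag (a k) (\<tau> k) (y k)) =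
      finprod (cpt A \<sigma> \<rho> (Suc n))
        (\<lambda>k. mul A \<sigma> (\<tau> k) \<rho> 1 n (a k) (wmap n (\<tau> k) \<rho> (y k))) {..<N}"
proof -
  have c: "cons_frag (a k) (\<tau> k) (y k) \<in> carrier (wgrp (Suc n) \<sigma> \<rho>)" if "k < N" for k
    using cons_frag_closed assms(3)[OF that] by blast
  then show "(\<Sum>k<N. cons_frag (a k) (\<tau> k) (y k)) \<in> carrier (wgrp (Suc n) \<sigma> \<rho>)"
    by (intro sum_word_group_closed) auto
  interpret comm_group "cpt A \<sigma> \<rho> (Suc n)" using comp_group assms by blast
  have "mul A \<sigma> (\<tau> k) \<rho> 1 n (a k) (wmap n (\<tau> k) \<rho> (y k)) \<in> carrier (cpt A \<sigma> \<rho> (Suc n))"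
    if "k < N" for k
    using mul_closed[of \<sigma> "\<tau> k" \<rho> "a k" 1 _ n] assms(1,2) assms(3)[OF that]
      word_group_map_hom(1)[of "\<tau> k" \<rho> n] by (auto dest: hom_in_carrier)
  then show "wmap (Suc n) \<sigma> \<rho> (\<Sum>k<N. cons_frag (a k) (\<tau> k) (y k)) =
      finprod (cpt A \<sigma> \<rho> (Suc n))
        (\<lambda>k. mul A \<sigma> (\<tau> k) \<rho> 1 n (a k) (wmap n (\<tau> k) \<rho> (y k))) {..<N}"
    using assms c
    by (subst word_group_map_sum) (auto intro!: finprod_cong' simp: word_group_map_cons simp del: word_group_simps)
qed

lemma word_group_map_onto:
  assumes gen: linearly_generated and "\<sigma> \<in> \<Sigma>" "\<rho> \<in> \<Sigma>" "n \<ge> 1" "f \<in> carrier (cpt A \<sigma> \<rho> n)"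
  shows "\<exists>x \<in> carrier (wgrp n \<sigma> \<rho>). wmap n \<sigma> \<rho> x = f"
  using assms(4,2,5)
proof (induction n arbitrary: \<sigma> f rule: dec_induct)
  case base
  then have "[(f, \<rho>)] \<in> words 1 \<sigma> \<rho>" using \<open>\<rho> \<in> \<Sigma>\<close> by simp
  moreover have "word_product A \<sigma> \<rho> [(f, \<rho>)] = f"
    using unt_right[of \<sigma> \<rho> f 1] base \<open>\<rho> \<in> \<Sigma>\<close> by simp
  ultimately show ?case
    using word_group_map_hom(2)[of \<sigma> \<rho> "[(f, \<rho>)]" 1] base \<open>\<rho> \<in> \<Sigma>\<close>
    by (intro bexI[of _ "frag_of [(f, \<rho>)]"]) auto
next
  case (step n)
  obtain N \<tau> a b where
    ab: "\<forall>k<(N::nat). \<tau> k \<in> \<Sigma> \<and> a k \<in> carrier (cpt A \<sigma> (\<tau> k) 1) \<and> b k \<in> carrier (cpt A (\<tau> k) \<rho> n)"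
    and f: "f = finprod (cpt A \<sigma> \<rho> (Suc n)) (\<lambda>k. mul A \<sigma> (\<tau> k) \<rho> 1 n (a k) (b k)) {..<N}"
    using gen[unfolded linearly_generated_def, rule_format, OF step.hyps(1) step.prems(1) \<open>\<rho> \<in> \<Sigma>\<close> step.prems(2)] by blast
  have "\<forall>k. \<exists>y. k < N \<longrightarrow> y \<in> carrier (wgrp n (\<tau> k) \<rho>) \<and> wmap n (\<tau> k) \<rho> y = b k"
    using ab step.IH by blast
  then obtain y where
    y: "\<forall>k<N. y k \<in> carrier (wgrp n (\<tau> k) \<rho>) \<and> wmap n (\<tau> k) \<rho> (y k) = b k"
    by metis
  interpret comm_group "cpt A \<sigma> \<rho> (Suc n)" using comp_group step.prems \<open>\<rho> \<in> \<Sigma>\<close> by blast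
  have "mul A \<sigma> (\<tau> k) \<rho> 1 n (a k) (b k) \<in> carrier (cpt A \<sigma> \<rho> (Suc n))" if "k < N" for k
    using mul_closed[of \<sigma> "\<tau> k" \<rho> "a k" 1 "b k" n] ab that step.prems \<open>\<rho> \<in> \<Sigma>\<close> by auto
  then have "f = finprod (cpt A \<sigma> \<rho> (Suc n))
        (\<lambda>k. mul A \<sigma> (\<tau> k) \<rho> 1 n (a k) (wmap n (\<tau> k) \<rho> (y k))) {..<N}"
    unfolding f using y by (intro finprod_cong') auto
  moreover have *: "\<tau> k \<in> \<Sigma> \<and> a k \<in> carrier (cpt A \<sigma> (\<tau> k) 1) \<and>
      y k \<in> carrier (wgrp n (\<tau> k) \<rho>)" if "k < N" for k
    using ab y that by blast
  ultimately show ?case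
    using sum_cons_frag[OF step.prems(1) \<open>\<rho> \<in> \<Sigma>\<close> *]
    by (intro bexI[of _ "\<Sum>k<N. cons_frag (a k) (\<tau> k) (y k)"]) simp_all
qed

text \<open>Induction on the number of factors. Tails with equal products differ by a relation with
  one factor fewer, so the tails \<open>y k\<close> may be exchanged for tails built from the
  matrices of \<open>quadratically_related\<close>. With two factors, \<open>x\<close> itself
  represents an element of I.\<close>

lemma quad_rel_if_word_group_map_one:
  assumes gen: linearly_generated and rel: quadratically_related
    and "\<sigma> \<in> \<Sigma>" "\<rho> \<in> \<Sigma>" "n \<ge> 2"
    and "x \<in> carrier (wgrp n \<sigma> \<rho>)" "wmap n \<sigma> \<rho> x = \<one>\<^bsub>cpt A \<sigma> \<rho> n\<^esub>"
  shows "quad_rel n \<sigma> \<rho> x"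
  using assms(5,3,6,7)
proof (induction n arbitrary: \<sigma> x rule: dec_induct)
  case base
  have "frag_extend frag_of x = x" by (rule frag_expansion[symmetric])
  then show ?case
    using quad_rel.ker[of \<sigma> \<rho> \<sigma> "[]" \<rho> "[]" x 2] base \<open>\<rho> \<in> \<Sigma>\<close> by simp
next
  case (step n')
  then obtain n where n': "n' = Suc n" and n: "n \<ge> 1"
    by (cases n') auto
  note IH = step.IH[unfolded n']
  from word_group_decompose[OF step.prems(2)[unfolded n']] obtain N \<tau> a y where
    ay': "\<forall>k < (N::nat). \<tau> k \<in> \<Sigma> \<and> a k \<in> carrier (cpt A \<sigma> (\<tau> k) 1) \<and>
      y k \<in> carrier (wgrp (Suc n) (\<tau> k) \<rho>)"
    and x: "x = (\<Sum>k<N. cons_frag (a k) (\<tau> k) (y k))"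
    by (elim exE conjE)
  note ay = ay'[rule_format]
  define b where "b = (\<lambda>k. wmap (Suc n) (\<tau> k) \<rho> (y k))"
  have b: "b k \<in> carrier (cpt A (\<tau> k) \<rho> (Suc n))" if "k < N" for k
    unfolding b_def using ay[OF that] \<open>\<rho> \<in> \<Sigma>\<close> by (intro word_group_map_closed) auto
  have "finprod (cpt A \<sigma> \<rho> (Suc (Suc n))) (\<lambda>k. mul A \<sigma> (\<tau> k) \<rho> 1 (Suc n) (a k) (b k)) {..<N} =
       \<one>\<^bsub>cpt A \<sigma> \<rho> (Suc (Suc n))\<^esub>"
    using sum_cons_frag(2)[OF step.prems(1) \<open>\<rho> \<in> \<Sigma>\<close> ay] step.prems(3) unfolding x b_def n' by simp
  moreover have "\<tau> k \<in> \<Sigma> \<and> a k \<in> carrier (cpt A \<sigma> (\<tau> k) 1) \<and> b k \<in> carrier (cpt A (\<tau> k) \<rho> (Suc n))"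
    if "k < N" for k
    using ay[OF that] b[OF that] by blast
  ultimately obtain L \<mu> h e M \<upsilon> a' e' where
    h: "\<forall>l < (L::nat). \<mu> l \<in> \<Sigma> \<and> h l \<in> carrier (cpt A (\<mu> l) \<rho> n)" and
    e: "\<forall>k<N. \<forall>l<L. e k l \<in> carrier (cpt A (\<tau> k) (\<mu> l) 1)" and
    a': "\<forall>m < (M::nat). \<upsilon> m \<in> \<Sigma> \<and> a' m \<in> carrier (cpt A \<sigma> (\<upsilon> m) 1)" and
    e': "\<forall>m<M. \<forall>l<L. e' m l \<in> carrier (cpt A (\<upsilon> m) (\<mu> l) 1)" and
    eh: "\<forall>k<N.
      finprod (cpt A (\<tau> k) \<rho> (Suc n)) (\<lambda>l. mul A (\<tau> k) (\<mu> l) \<rho> 1 n (e k l) (h l)) {..<L} = b k" and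
    ae: "\<forall>l<L.
      finprod (cpt A \<sigma> (\<mu> l) 2) (\<lambda>k. mul A \<sigma> (\<tau> k) (\<mu> l) 1 1 (a k) (e k l)) {..<N} =
      finprod (cpt A \<sigma> (\<mu> l) 2) (\<lambda>m. mul A \<sigma> (\<upsilon> m) (\<mu> l) 1 1 (a' m) (e' m l)) {..<M}" and
    e'h: "\<forall>m<M.
      finprod (cpt A (\<upsilon> m) \<rho> (Suc n)) (\<lambda>l. mul A (\<upsilon> m) (\<mu> l) \<rho> 1 n (e' m l) (h l)) {..<L} =
      \<one>\<^bsub>cpt A (\<upsilon> m) \<rho> (Suc n)\<^esub>"
    by (elim rel[unfolded quadratically_related_def, rule_format, OF n step.prems(1) \<open>\<rho> \<in> \<Sigma>\<close>, of N \<tau> a b, elim_format]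
        exE conjE)
  note h = h[rule_format] and e = e[rule_format] and a' = a'[rule_format] and e' = e'[rule_format]
    and eh = eh[rule_format] and ae = ae[rule_format] and e'h = e'h[rule_format]
  \<comment> \<open>The column \<open>h\<close> lives in A only; generation in degree one lifts it
    to tensors.\<close>
  have "\<forall>l. \<exists>z. l < L \<longrightarrow> z \<in> carrier (wgrp n (\<mu> l) \<rho>) \<and> wmap n (\<mu> l) \<rho> z = h l"
    using h word_group_map_onto[OF gen _ \<open>\<rho> \<in> \<Sigma>\<close> n] by blast
  then obtain z where
    z: "\<And>l. l < L \<Longrightarrow> z l \<in> carrier (wgrp n (\<mu> l) \<rho>)"
      "\<And>l. l < L \<Longrightarrow> wmap n (\<mu> l) \<rho> (z l) = h l"
    by metis
  have hz: "finprod G (\<lambda>l. mul A \<alpha> (\<mu> l) \<rho> 1 n (c l) (wmap n (\<mu> l) \<rho> (z l))) {..<L} =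
      finprod G (\<lambda>l. mul A \<alpha> (\<mu> l) \<rho> 1 n (c l) (h l)) {..<L}"
    if "\<alpha> \<in> \<Sigma>" "\<And>l. l < L \<Longrightarrow> c l \<in> carrier (cpt A \<alpha> (\<mu> l) 1)" "G = cpt A \<alpha> \<rho> (Suc n)" for \<alpha> c G
  proof -
    interpret comm_group G unfolding that(3) by (rule comp_group[OF that(1) \<open>\<rho> \<in> \<Sigma>\<close>])
    show ?thesis
      using mul_closed[of \<alpha> _ \<rho> _ 1 _ n] that h \<open>\<rho> \<in> \<Sigma>\<close>
      by (intro finprod_cong') (auto simp: z(2))
  qed
  \<comment> \<open>A second tensor with the product \<open>b k\<close>, read off from
    \<open>b = e h\<close>.\<close>
  define p where "p = (\<lambda>k. \<Sum>l<L. cons_frag (e k l) (\<mu> l) (z l))"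
  have p: "p k \<in> carrier (wgrp (Suc n) (\<tau> k) \<rho>)"
    "wmap (Suc n) (\<tau> k) \<rho> (p k) = b k" if "k < N" for k
    using sum_cons_frag[of "\<tau> k" \<rho> L \<mu> "e k" z n] hz[of "\<tau> k" "e k"] ay[OF that] h e[OF that] z(1)
      eh[OF that] \<open>\<rho> \<in> \<Sigma>\<close> unfolding p_def by auto
  \<comment> \<open>A tensor with the product \<open>e' h\<close>, which is zero.\<close>
  define q where "q = (\<lambda>m. \<Sum>l<L. cons_frag (e' m l) (\<mu> l) (z l))"
  have q: "q m \<in> carrier (wgrp (Suc n) (\<upsilon> m) \<rho>)"
    "wmap (Suc n) (\<upsilon> m) \<rho> (q m) = \<one>\<^bsub>cpt A (\<upsilon> m) \<rho> (Suc n)\<^esub>" if "m < M" for m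
    using sum_cons_frag[of "\<upsilon> m" \<rho> L \<mu> "e' m" z n] hz[of "\<upsilon> m" "e' m"] a'[OF that] h e'[OF that] z(1)
      e'h[OF that] \<open>\<rho> \<in> \<Sigma>\<close> unfolding q_def by auto
  \<comment> \<open>The entry with index \<open>l\<close> of
    \<open>a \<otimes> e - a' \<otimes> e'\<close>; the equality \<open>a e = a' e'\<close> puts it
    in I.\<close>
  define t where "t = (\<lambda>l. (\<Sum>k<N. frag_of [(a k, \<tau> k), (e k l, \<mu> l)]) -
    (\<Sum>m<M. frag_of [(a' m, \<upsilon> m), (e' m l, \<mu> l)]))"
  have t: "t l \<in> carrier (wgrp 2 \<sigma> (\<mu> l))"
    "wmap 2 \<sigma> (\<mu> l) (t l) = \<one>\<^bsub>cpt A \<sigma> (\<mu> l) 2\<^esub>" if l: "l < L" for l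
  proof -
    have \<mu>: "\<mu> l \<in> \<Sigma>" using h l by blast
    have eq: "frag_of [(c, \<alpha>), (d, \<mu> l)] = cons_frag c \<alpha> (frag_of [(d, \<mu> l)])" for c \<alpha> d
      by simp
    have one: "frag_of [(d, \<mu> l)] \<in> carrier (wgrp 1 \<alpha> (\<mu> l)) \<and>
        wmap 1 \<alpha> (\<mu> l) (frag_of [(d, \<mu> l)]) = d"
      if "\<alpha> \<in> \<Sigma>" "d \<in> carrier (cpt A \<alpha> (\<mu> l) 1)" for \<alpha> d
      using word_group_map_hom(2)[of \<alpha> "\<mu> l" "[(d, \<mu> l)]" 1] unt_right[of \<alpha> "\<mu> l" d 1] that \<mu> by simp
    interpret comm_group "cpt A \<sigma> (\<mu> l) 2" using comp_group step.prems(1) \<mu> by blast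
    note s1 = sum_cons_frag[OF step.prems(1) \<mu>, of N \<tau> a "\<lambda>k. frag_of [(e k l, \<mu> l)]" 1]
    note s2 = sum_cons_frag[OF step.prems(1) \<mu>, of M \<upsilon> a' "\<lambda>k. frag_of [(e' k l, \<mu> l)]" 1]
    have c1: "(\<Sum>k<N. frag_of [(a k, \<tau> k), (e k l, \<mu> l)]) \<in> carrier (wgrp 2 \<sigma> (\<mu> l))"
      and c2: "(\<Sum>m<M. frag_of [(a' m, \<upsilon> m), (e' m l, \<mu> l)]) \<in> carrier (wgrp 2 \<sigma> (\<mu> l))"
      unfolding eq using s1(1) s2(1) one ay e a' e' l unfolding numeral_2_eq_2 One_nat_def by blast+
    then show "t l \<in> carrier (wgrp 2 \<sigma> (\<mu> l))"
      unfolding t_def by (rule word_group_diff_closed)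
    have "wmap 2 \<sigma> (\<mu> l) (\<Sum>k<N. frag_of [(a k, \<tau> k), (e k l, \<mu> l)]) =
        finprod (cpt A \<sigma> (\<mu> l) 2) (\<lambda>k. mul A \<sigma> (\<tau> k) (\<mu> l) 1 1 (a k)
          (wmap 1 (\<tau> k) (\<mu> l) (frag_of [(e k l, \<mu> l)]))) {..<N}"
      unfolding eq using s1(2) one ay e l unfolding numeral_2_eq_2 One_nat_def by blast
    also have "\<dots> = finprod (cpt A \<sigma> (\<mu> l) 2) (\<lambda>k. mul A \<sigma> (\<tau> k) (\<mu> l) 1 1 (a k) (e k l)) {..<N}"
      using one ay e l mul_closed[of \<sigma> _ "\<mu> l" _ 1 _ 1] step.prems(1) \<mu>
      by (intro finprod_cong') (auto simp: numeral_2_eq_2)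
    finally have 1: "wmap 2 \<sigma> (\<mu> l) (\<Sum>k<N. frag_of [(a k, \<tau> k), (e k l, \<mu> l)]) = \<dots>" .
    have "wmap 2 \<sigma> (\<mu> l) (\<Sum>m<M. frag_of [(a' m, \<upsilon> m), (e' m l, \<mu> l)]) =
        finprod (cpt A \<sigma> (\<mu> l) 2) (\<lambda>m. mul A \<sigma> (\<upsilon> m) (\<mu> l) 1 1 (a' m)
          (wmap 1 (\<upsilon> m) (\<mu> l) (frag_of [(e' m l, \<mu> l)]))) {..<M}"
      unfolding eq using s2(2) one a' e' l unfolding numeral_2_eq_2 One_nat_def by blast
    also have "\<dots> = finprod (cpt A \<sigma> (\<mu> l) 2) (\<lambda>m. mul A \<sigma> (\<upsilon> m) (\<mu> l) 1 1 (a' m) (e' m l)) {..<M}"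
      using one a' e' l mul_closed[of \<sigma> _ "\<mu> l" _ 1 _ 1] step.prems(1) \<mu>
      by (intro finprod_cong') (auto simp: numeral_2_eq_2)
    finally have "wmap 2 \<sigma> (\<mu> l) (\<Sum>m<M. frag_of [(a' m, \<upsilon> m), (e' m l, \<mu> l)]) =
        wmap 2 \<sigma> (\<mu> l) (\<Sum>k<N. frag_of [(a k, \<tau> k), (e k l, \<mu> l)])"
      using 1 ae[OF l] by simp
    moreover have "wmap 2 \<sigma> (\<mu> l) (\<Sum>k<N. frag_of [(a k, \<tau> k), (e k l, \<mu> l)])
        \<in> carrier (cpt A \<sigma> (\<mu> l) 2)"
      using word_group_map_hom(1)[OF step.prems(1) \<mu>] c1 by (rule hom_in_carrier)
    ultimately show "wmap 2 \<sigma> (\<mu> l) (t l) = \<one>\<^bsub>cpt A \<sigma> (\<mu> l) 2\<^esub>"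
      unfolding t_def word_group_map_diff[OF step.prems(1) \<mu> c1 c2] by simp
  qed
  have append_eq: "frag_append (frag_of [(c, \<alpha>), (d, \<beta>)]) w = cons_frag c \<alpha> (cons_frag d \<beta> w)" for c \<alpha> d \<beta> w
    using frag_extend_compose[of "\<lambda>w. frag_of ((c, \<alpha>) # w)" "\<lambda>w. (d, \<beta>) # w" w]
    by (simp add: frag_append_of o_def)
  \<comment> \<open>The tensor \<open>(a \<otimes> e - a' \<otimes> e') \<otimes> h\<close>,
    regrouped by its first letters.\<close>
  have "(\<Sum>l<L. frag_append (t l) (z l)) =
      (\<Sum>k<N. cons_frag (a k) (\<tau> k) (p k)) - (\<Sum>m<M. cons_frag (a' m) (\<upsilon> m) (q m))"
  proof -
    have "(\<Sum>l<L. frag_append (t l) (z l)) =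
      (\<Sum>l<L. \<Sum>k<N. cons_frag (a k) (\<tau> k) (cons_frag (e k l) (\<mu> l) (z l))) -
      (\<Sum>l<L. \<Sum>m<M. cons_frag (a' m) (\<upsilon> m) (cons_frag (e' m l) (\<mu> l) (z l)))"
      by (simp add: t_def frag_append_diff frag_append_sum append_eq sum_subtractf)
    also have "\<dots> = (\<Sum>k<N. \<Sum>l<L. cons_frag (a k) (\<tau> k) (cons_frag (e k l) (\<mu> l) (z l))) -
      (\<Sum>m<M. \<Sum>l<L. cons_frag (a' m) (\<upsilon> m) (cons_frag (e' m l) (\<mu> l) (z l)))"
      by (simp only: sum.swap[of _ "{..<L}"])
    finally show ?thesis
      by (simp add: p_def q_def frag_extend_sum o_def)
  qed
  \<comment> \<open>The first and the last sum are relations by the induction hypothesis on the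
    tails, the middle one because each \<open>t l\<close> lies in the kernel.\<close>
  then have "x = (\<Sum>k<N. cons_frag (a k) (\<tau> k) (y k - p k)) +
      ((\<Sum>l<L. frag_append (t l) (z l)) + (\<Sum>m<M. cons_frag (a' m) (\<upsilon> m) (q m)))"
    by (simp add: x frag_extend_diff sum_subtractf)
  moreover have "quad_rel (Suc (Suc n)) \<sigma> \<rho> (\<Sum>k<N. cons_frag (a k) (\<tau> k) (y k - p k))"
  proof (intro quad_rel_sum quad_rel_cons IH)
    fix k assume "k \<in> {..<N}"
    then have k: "k < N" by simp
    interpret comm_group "cpt A (\<tau> k) \<rho> (Suc n)" using comp_group ay[OF k] \<open>\<rho> \<in> \<Sigma>\<close> by blast
    show "wmap (Suc n) (\<tau> k) \<rho> (y k - p k) = \<one>\<^bsub>cpt A (\<tau> k) \<rho> (Suc n)\<^esub>"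
      using word_group_map_diff[of "\<tau> k" \<rho> "y k" "Suc n" "p k"] ay[OF k] p[OF k] b[OF k] \<open>\<rho> \<in> \<Sigma>\<close>
      by (simp add: b_def[symmetric] del: word_group_simps) (simp add: b_def)
    show "y k - p k \<in> carrier (wgrp (Suc n) (\<tau> k) \<rho>)"
      using ay[OF k] p[OF k] word_group_diff_closed by blast
  qed (use ay in auto)
  moreover have "quad_rel (Suc (Suc n)) \<sigma> \<rho> (\<Sum>l<L. frag_append (t l) (z l))"
  proof (intro quad_rel_sum)
    fix l assume "l \<in> {..<L}"
    then have l: "l < L" by simp
    show "quad_rel (Suc (Suc n)) \<sigma> \<rho> (frag_append (t l) (z l))"
      using quad_rel_frag_append[OF step.prems(1) _ t[OF l] z(1)[OF l]] h[OF l] by blast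
  qed
  moreover have "quad_rel (Suc (Suc n)) \<sigma> \<rho> (\<Sum>m<M. cons_frag (a' m) (\<upsilon> m) (q m))"
    using a' q by (intro quad_rel_sum quad_rel_cons IH) auto
  ultimately show ?case
    unfolding n' by (auto intro!: quad_rel_add)
qed

section \<open>Passage from representatives to cosets\<close>

lemma tensor_relations_subset_kernel:
  assumes S: "\<sigma> \<in> \<Sigma>" "\<rho> \<in> \<Sigma>"
  shows "trel n \<sigma> \<rho> \<subseteq>
    kernel (wgrp n \<sigma> \<rho>) (cpt A \<sigma> \<rho> n) (wmap n \<sigma> \<rho>)"
proof -
  interpret group_hom "wgrp n \<sigma> \<rho>" "cpt A \<sigma> \<rho> n" "wmap n \<sigma> \<rho>"
    using word_group_map_group_hom S .
  interpret H: comm_group "cpt A \<sigma> \<rho> n" using comp_group S .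
  have ker: "x \<in> kernel (wgrp n \<sigma> \<rho>) (cpt A \<sigma> \<rho> n) (wmap n \<sigma> \<rho>)"
    if "x \<in> carrier (wgrp n \<sigma> \<rho>)" "wmap n \<sigma> \<rho> x = \<one>\<^bsub>cpt A \<sigma> \<rho> n\<^esub>" for x
    using that unfolding kernel_def by blast
  have fr: "frag_of w \<in> carrier (wgrp n \<sigma> \<rho>)" "wmap n \<sigma> \<rho> (frag_of w) = word_product A \<sigma> \<rho> w"
    "word_product A \<sigma> \<rho> w \<in> carrier (cpt A \<sigma> \<rho> n)"
    if "is_word \<Sigma> A \<sigma> \<rho> w" "length w = n" for w
    using that word_group_map_hom(2)[OF S, of w n] word_product_closed[OF S(1) that(1)] by auto
  show ?thesis
    unfolding tensor_relations_def
  proof (rule G.generate_subgroup_incl[OF _ subgroup_kernel], rule subsetI, elim UnE CollectE exE conjE)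
    fix x u a b v \<alpha> \<beta>
    assume x: "x = frag_of (u @ [(a \<otimes>\<^bsub>cpt A \<alpha> \<beta> 1\<^esub> b, \<beta>)] @ v) - frag_of (u @ [(a, \<beta>)] @ v) - frag_of (u @ [(b, \<beta>)] @ v)"
      and T: "\<alpha> \<in> \<Sigma>" "\<beta> \<in> \<Sigma>" and u: "is_word \<Sigma> A \<sigma> \<alpha> u" and v: "is_word \<Sigma> A \<beta> \<rho> v"
      and n: "length u + 1 + length v = n"
      and a: "a \<in> carrier (cpt A \<alpha> \<beta> 1)" and b: "b \<in> carrier (cpt A \<alpha> \<beta> 1)"
    interpret K: comm_group "cpt A \<alpha> \<beta> 1" using comp_group T .
    have ab: "a \<otimes>\<^bsub>cpt A \<alpha> \<beta> 1\<^esub> b \<in> carrier (cpt A \<alpha> \<beta> 1)" using a b by (rule K.m_closed)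
    have w: "is_word \<Sigma> A \<sigma> \<rho> (u @ [(c, \<beta>)] @ v)" "length (u @ [(c, \<beta>)] @ v) = n"
      if "c \<in> carrier (cpt A \<alpha> \<beta> 1)" for c
      using that u v T n by (auto intro!: is_word_append)
    have p: "word_product A \<sigma> \<rho> (u @ [(c, \<beta>)] @ v) = mul A \<sigma> \<alpha> \<rho> (length u) (1 + length v)
        (word_product A \<sigma> \<alpha> u) (mul A \<alpha> \<beta> \<rho> 1 (length v) c (word_product A \<beta> \<rho> v))"
      if "c \<in> carrier (cpt A \<alpha> \<beta> 1)" for c
      using word_product_append[OF S(1) u, of \<rho> "[(c, \<beta>)] @ v"] that T v by simp
    have uv: "word_product A \<sigma> \<alpha> u \<in> carrier (cpt A \<sigma> \<alpha> (length u))"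
      "word_product A \<beta> \<rho> v \<in> carrier (cpt A \<beta> \<rho> (length v))"
      using word_product_closed S T u v by auto
    have m: "mul A \<alpha> \<beta> \<rho> 1 (length v) c (word_product A \<beta> \<rho> v) \<in> carrier (cpt A \<alpha> \<rho> (1 + length v))"
      if "c \<in> carrier (cpt A \<alpha> \<beta> 1)" for c
      using mul_closed[OF T S(2) that uv(2)] .
    \<comment> \<open>Biadditivity of the multiplication kills the first kind of relation.\<close>
    have add: "word_product A \<sigma> \<rho> (u @ [(a \<otimes>\<^bsub>cpt A \<alpha> \<beta> 1\<^esub> b, \<beta>)] @ v) =
        word_product A \<sigma> \<rho> (u @ [(a, \<beta>)] @ v) \<otimes>\<^bsub>cpt A \<sigma> \<rho> n\<^esub> word_product A \<sigma> \<rho> (u @ [(b, \<beta>)] @ v)"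
      unfolding p[OF ab] p[OF a] p[OF b] mul_add_left[OF T S(2) a b uv(2)]
        mul_add_right[OF S(1) T(1) S(2) uv(1) m[OF a] m[OF b]] n[symmetric] add.assoc ..
    note fa = fr[OF w[OF a]] and fb = fr[OF w[OF b]] and fab = fr[OF w[OF ab]]
    have d: "frag_of (u @ [(a \<otimes>\<^bsub>cpt A \<alpha> \<beta> 1\<^esub> b, \<beta>)] @ v) - frag_of (u @ [(a, \<beta>)] @ v) \<in> carrier (wgrp n \<sigma> \<rho>)"
      using fa(1) fab(1) by (rule word_group_diff_closed[rotated])
    show "x \<in> kernel (wgrp n \<sigma> \<rho>) (cpt A \<sigma> \<rho> n) (wmap n \<sigma> \<rho>)"
      unfolding x
    proof (rule ker)
      show "frag_of (u @ [(a \<otimes>\<^bsub>cpt A \<alpha> \<beta> 1\<^esub> b, \<beta>)] @ v) - frag_of (u @ [(a, \<beta>)] @ v) - frag_of (u @ [(b, \<beta>)] @ v)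
        \<in> carrier (wgrp n \<sigma> \<rho>)"
        using d fb(1) by (rule word_group_diff_closed)
      show "wmap n \<sigma> \<rho> (frag_of (u @ [(a \<otimes>\<^bsub>cpt A \<alpha> \<beta> 1\<^esub> b, \<beta>)] @ v) -
          frag_of (u @ [(a, \<beta>)] @ v) - frag_of (u @ [(b, \<beta>)] @ v)) = \<one>\<^bsub>cpt A \<sigma> \<rho> n\<^esub>"
        unfolding word_group_map_diff[OF S d fb(1)] word_group_map_diff[OF S fab(1) fa(1)] fa(2) fb(2) fab(2) add
          H.m_comm[OF fa(3) fb(3)]
        using fa(3) fb(3) by (simp add: H.m_assoc)
    qed
  next
    fix x u a c b v \<alpha> \<tau> \<tau>' \<beta>
    assume x: "x = frag_of (u @ [(mul A \<alpha> \<tau> \<tau>' 1 0 a c, \<tau>'), (b, \<beta>)] @ v) -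
        frag_of (u @ [(a, \<tau>), (mul A \<tau> \<tau>' \<beta> 0 1 c b, \<beta>)] @ v)"
      and T: "\<alpha> \<in> \<Sigma>" "\<tau> \<in> \<Sigma>" "\<tau>' \<in> \<Sigma>" "\<beta> \<in> \<Sigma>" and u: "is_word \<Sigma> A \<sigma> \<alpha> u" and v: "is_word \<Sigma> A \<beta> \<rho> v"
      and n: "length u + 2 + length v = n"
      and a: "a \<in> carrier (cpt A \<alpha> \<tau> 1)" and c: "c \<in> carrier (cpt A \<tau> \<tau>' 0)" and b: "b \<in> carrier (cpt A \<tau>' \<beta> 1)"
    have ac: "mul A \<alpha> \<tau> \<tau>' 1 0 a c \<in> carrier (cpt A \<alpha> \<tau>' 1)" using mul_closed[OF T(1-3) a c] by simp
    have cb: "mul A \<tau> \<tau>' \<beta> 0 1 c b \<in> carrier (cpt A \<tau> \<beta> 1)" using mul_closed[OF T(2-4) c b] by simp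
    have uv: "word_product A \<beta> \<rho> v \<in> carrier (cpt A \<beta> \<rho> (length v))"
      using word_product_closed S T v by auto
    have w1: "is_word \<Sigma> A \<sigma> \<rho> (u @ [(mul A \<alpha> \<tau> \<tau>' 1 0 a c, \<tau>'), (b, \<beta>)] @ v)"
      "length (u @ [(mul A \<alpha> \<tau> \<tau>' 1 0 a c, \<tau>'), (b, \<beta>)] @ v) = n"
      using u v T n ac b by (auto intro!: is_word_append)
    have w2: "is_word \<Sigma> A \<sigma> \<rho> (u @ [(a, \<tau>), (mul A \<tau> \<tau>' \<beta> 0 1 c b, \<beta>)] @ v)"
      "length (u @ [(a, \<tau>), (mul A \<tau> \<tau>' \<beta> 0 1 c b, \<beta>)] @ v) = n"
      using u v T n a cb by (auto intro!: is_word_append)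
    \<comment> \<open>Both sides are the product of \<open>a\<close>, \<open>c\<close>,
      \<open>b\<close> and the word \<open>v\<close>, bracketed in two ways; this kills the second
      kind of relation.\<close>
    have "mul A \<alpha> \<tau>' \<rho> 1 (1 + length v) (mul A \<alpha> \<tau> \<tau>' 1 0 a c) (mul A \<tau>' \<beta> \<rho> 1 (length v) b (word_product A \<beta> \<rho> v)) =
        mul A \<alpha> \<tau> \<rho> 1 (1 + length v) a (mul A \<tau> \<beta> \<rho> 1 (length v) (mul A \<tau> \<tau>' \<beta> 0 1 c b) (word_product A \<beta> \<rho> v))"
      using mul_assoc[OF T(1-3) S(2) a c mul_closed[OF T(3,4) S(2) b uv]] mul_assoc[OF T(2-4) S(2) c b uv] by simp
    then have eq: "word_product A \<sigma> \<rho> (u @ [(mul A \<alpha> \<tau> \<tau>' 1 0 a c, \<tau>'), (b, \<beta>)] @ v) =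
        word_product A \<sigma> \<rho> (u @ [(a, \<tau>), (mul A \<tau> \<tau>' \<beta> 0 1 c b, \<beta>)] @ v)"
      using word_product_append[OF S(1) u, of \<rho> "[(mul A \<alpha> \<tau> \<tau>' 1 0 a c, \<tau>'), (b, \<beta>)] @ v"]
        word_product_append[OF S(1) u, of \<rho> "[(a, \<tau>), (mul A \<tau> \<tau>' \<beta> 0 1 c b, \<beta>)] @ v"] ac b a cb T v by simp
    show "x \<in> kernel (wgrp n \<sigma> \<rho>) (cpt A \<sigma> \<rho> n) (wmap n \<sigma> \<rho>)"
      unfolding x
    proof (rule ker)
      show "frag_of (u @ [(mul A \<alpha> \<tau> \<tau>' 1 0 a c, \<tau>'), (b, \<beta>)] @ v) -
        frag_of (u @ [(a, \<tau>), (mul A \<tau> \<tau>' \<beta> 0 1 c b, \<beta>)] @ v) \<in> carrier (wgrp n \<sigma> \<rho>)"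
        using fr(1)[OF w1] fr(1)[OF w2] by (rule word_group_diff_closed)
      show "wmap n \<sigma> \<rho> (frag_of (u @ [(mul A \<alpha> \<tau> \<tau>' 1 0 a c, \<tau>'), (b, \<beta>)] @ v) -
        frag_of (u @ [(a, \<tau>), (mul A \<tau> \<tau>' \<beta> 0 1 c b, \<beta>)] @ v)) = \<one>\<^bsub>cpt A \<sigma> \<rho> n\<^esub>"
        unfolding word_group_map_diff[OF S fr(1)[OF w1] fr(1)[OF w2]] fr(2)[OF w1] fr(2)[OF w2] eq
        using fr(3)[OF w2] by simp
    qed
  qed
qed

text \<open>That the relations lie in the word group is read off from the kernel; commutativity does
  the rest.\<close>

lemma tensor_relations_normal: "trel n \<sigma> \<rho> \<lhd> wgrp n \<sigma> \<rho>"
  if S: "\<sigma> \<in> \<Sigma>" "\<rho> \<in> \<Sigma>"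
proof -
  interpret comm_group "wgrp n \<sigma> \<rho>" by (rule word_group_group)
  have "generate (wgrp n \<sigma> \<rho>) X \<subseteq> carrier (wgrp n \<sigma> \<rho>) \<Longrightarrow>
      generate (wgrp n \<sigma> \<rho>) X \<lhd> wgrp n \<sigma> \<rho>" for X
    using generate_is_subgroup[of X] generate.incl[of _ X "wgrp n \<sigma> \<rho>"]
      subgroup_imp_normal by blast
  then show ?thesis
    using tensor_relations_subset_kernel[OF S, of n]
    unfolding tensor_relations_def kernel_def by blast
qed

text \<open>The value of \<open>the_elem\<close> is well defined because
  \<open>word_group_map\<close> is constant on each coset. Facts about tensor powers are reduced to
  representatives by this equation.\<close>

lemma tensor_power_map_coset:
  assumes S: "\<sigma> \<in> \<Sigma>" "\<rho> \<in> \<Sigma>" and x: "x \<in> carrier (wgrp n \<sigma> \<rho>)"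
  shows "tmap n \<sigma> \<rho> (trel n \<sigma> \<rho> #>\<^bsub>wgrp n \<sigma> \<rho>\<^esub> x) =
    wmap n \<sigma> \<rho> x"
  unfolding tensor_power_map_def
proof (rule the_elem_image_unique)
  interpret group_hom "wgrp n \<sigma> \<rho>" "cpt A \<sigma> \<rho> n" "wmap n \<sigma> \<rho>"
    using word_group_map_group_hom S .
  interpret N: normal "trel n \<sigma> \<rho>" "wgrp n \<sigma> \<rho>"
    using tensor_relations_normal S .
  show "trel n \<sigma> \<rho> #>\<^bsub>wgrp n \<sigma> \<rho>\<^esub> x \<noteq> {}"
    using G.rcos_self[OF x N.subgroup_axioms] by blast
  fix y assume "y \<in> trel n \<sigma> \<rho> #>\<^bsub>wgrp n \<sigma> \<rho>\<^esub> x"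
  then obtain r where r: "r \<in> trel n \<sigma> \<rho>" "y = r \<otimes>\<^bsub>wgrp n \<sigma> \<rho>\<^esub> x"
    unfolding r_coset_def by blast
  then have "r \<in> carrier (wgrp n \<sigma> \<rho>)" "wmap n \<sigma> \<rho> r = \<one>\<^bsub>cpt A \<sigma> \<rho> n\<^esub>"
    using tensor_relations_subset_kernel[OF S, of n] unfolding kernel_def by blast+
  then show "wmap n \<sigma> \<rho> y = wmap n \<sigma> \<rho> x"
    unfolding r(2) using hom_mult[of r x] hom_closed[OF x] x by (simp del: word_group_simps)
qed

lemma tensor_power_map_group_hom:
  assumes S: "\<sigma> \<in> \<Sigma>" "\<rho> \<in> \<Sigma>"
  shows "group_hom (tpow n \<sigma> \<rho>) (cpt A \<sigma> \<rho> n) (tmap n \<sigma> \<rho>)"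
proof -
  interpret group_hom "wgrp n \<sigma> \<rho>" "cpt A \<sigma> \<rho> n" "wmap n \<sigma> \<rho>"
    using word_group_map_group_hom S .
  interpret N: normal "trel n \<sigma> \<rho>" "wgrp n \<sigma> \<rho>"
    using tensor_relations_normal S .
  have "tmap n \<sigma> \<rho> \<in> hom (tpow n \<sigma> \<rho>) (cpt A \<sigma> \<rho> n)"
  proof (rule homI)
    fix X assume "X \<in> carrier (tpow n \<sigma> \<rho>)"
    then show "tmap n \<sigma> \<rho> X \<in> carrier (cpt A \<sigma> \<rho> n)"
      unfolding tensor_power_def carrier_FactGroup using tensor_power_map_coset[OF S] hom_closed by fastforce
  next
    fix X Y assume "X \<in> carrier (tpow n \<sigma> \<rho>)" "Y \<in> carrier (tpow n \<sigma> \<rho>)"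
    then obtain x y where x: "x \<in> carrier (wgrp n \<sigma> \<rho>)" and y: "y \<in> carrier (wgrp n \<sigma> \<rho>)"
      and XY: "X = trel n \<sigma> \<rho> #>\<^bsub>wgrp n \<sigma> \<rho>\<^esub> x"
        "Y = trel n \<sigma> \<rho> #>\<^bsub>wgrp n \<sigma> \<rho>\<^esub> y"
      unfolding tensor_power_def carrier_FactGroup by blast
    have "X \<otimes>\<^bsub>tpow n \<sigma> \<rho>\<^esub> Y =
        trel n \<sigma> \<rho> #>\<^bsub>wgrp n \<sigma> \<rho>\<^esub> (x \<otimes>\<^bsub>wgrp n \<sigma> \<rho>\<^esub> y)"
      unfolding tensor_power_def mult_FactGroup XY using x y by (rule N.rcos_sum)
    then show "tmap n \<sigma> \<rho> (X \<otimes>\<^bsub>tpow n \<sigma> \<rho>\<^esub> Y) =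
        tmap n \<sigma> \<rho> X \<otimes>\<^bsub>cpt A \<sigma> \<rho> n\<^esub> tmap n \<sigma> \<rho> Y"
      using tensor_power_map_coset[OF S x] tensor_power_map_coset[OF S y]
        tensor_power_map_coset[OF S G.m_closed[OF x y]] hom_mult[OF x y] unfolding XY by simp
  qed
  then show ?thesis
    unfolding tensor_power_def group_hom_def group_hom_axioms_def
    using N.factorgroup_is_group H.is_group by (simp add: tensor_power_def)
qed

lemma mem_quadratic_kernel_iff:
  assumes S: "\<sigma> \<in> \<Sigma>" "\<rho> \<in> \<Sigma>" and x: "x \<in> carrier (wgrp 2 \<sigma> \<rho>)"
  shows "trel 2 \<sigma> \<rho> #>\<^bsub>wgrp 2 \<sigma> \<rho>\<^esub> x \<in> quadratic_kernel \<Sigma> A \<sigma> \<rho> \<longleftrightarrow>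
    wmap 2 \<sigma> \<rho> x = \<one>\<^bsub>cpt A \<sigma> \<rho> 2\<^esub>"
  using x tensor_power_map_coset[OF S x]
  unfolding quadratic_kernel_def kernel_def tensor_power_def carrier_FactGroup by auto

definition quadratic_generators :: "nat \<Rightarrow> 's \<Rightarrow> 's \<Rightarrow> (('a \<times> 's) list \<Rightarrow>\<^sub>0 int) set set" where
  "quadratic_generators n \<sigma> \<rho> = (\<Union>j \<in> {1..n - 1}.
      {trel n \<sigma> \<rho> #>\<^bsub>wgrp n \<sigma> \<rho>\<^esub> frag_extend (\<lambda>w. frag_of (u @ w @ v)) x
        | u t x v \<alpha> \<beta>. \<alpha> \<in> \<Sigma> \<and> \<beta> \<in> \<Sigma> \<and> is_word \<Sigma> A \<sigma> \<alpha> u \<and> length u = j - 1 \<and>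
            t \<in> quadratic_kernel \<Sigma> A \<alpha> \<beta> \<and> x \<in> t \<and> is_word \<Sigma> A \<beta> \<rho> v \<and> length v = n - j - 1})"

lemma quadratic_relations_eq:
  "quadratic_relations \<Sigma> A n \<sigma> \<rho> = generate (tpow n \<sigma> \<rho>) (quadratic_generators n \<sigma> \<rho>)"
  unfolding quadratic_relations_def quadratic_generators_def ..

lemma frag_extend_append_closed:
  assumes "is_word \<Sigma> A \<sigma> \<alpha> u" "is_word \<Sigma> A \<beta> \<rho> v" "x \<in> carrier (wgrp n \<alpha> \<beta>)"
  shows "frag_extend (\<lambda>w. frag_of (u @ w @ v)) x \<in> carrier (wgrp (length u + (n + length v)) \<sigma> \<rho>)"
  using keys_frag_extend_of[of "\<lambda>w. u @ w @ v" x] assms by (fastforce intro!: is_word_append)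

text \<open>By \<open>word_group_map_append\<close> the product of
  \<open>u \<otimes> x \<otimes> v\<close> contains the product of \<open>x\<close> as a factor, and
  that is zero.\<close>

lemma quadratic_generators_subset_kernel:
  assumes S: "\<sigma> \<in> \<Sigma>" "\<rho> \<in> \<Sigma>"
  shows "quadratic_generators n \<sigma> \<rho> \<subseteq>
    kernel (tpow n \<sigma> \<rho>) (cpt A \<sigma> \<rho> n) (tmap n \<sigma> \<rho>)"
proof (rule subsetI)
  fix X assume "X \<in> quadratic_generators n \<sigma> \<rho>"
  then obtain j u t x v \<alpha> \<beta> where j: "j \<in> {1..n - 1}"
    and X: "X = trel n \<sigma> \<rho> #>\<^bsub>wgrp n \<sigma> \<rho>\<^esub> frag_extend (\<lambda>w. frag_of (u @ w @ v)) x"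
    and T: "\<alpha> \<in> \<Sigma>" "\<beta> \<in> \<Sigma>" and u: "is_word \<Sigma> A \<sigma> \<alpha> u" "length u = j - 1"
    and t: "t \<in> quadratic_kernel \<Sigma> A \<alpha> \<beta>" "x \<in> t" and v: "is_word \<Sigma> A \<beta> \<rho> v" "length v = n - j - 1"
    unfolding quadratic_generators_def by blast
  \<comment> \<open>The range of \<open>j\<close> keeps the natural subtractions exact:
    \<open>j - 1\<close> letters, then two, then \<open>n - j - 1\<close>.\<close>
  have n: "n = length u + (2 + length v)" using j u v by auto
  from t(1) obtain x' where x': "x' \<in> carrier (wgrp 2 \<alpha> \<beta>)"
    "t = trel 2 \<alpha> \<beta> #>\<^bsub>wgrp 2 \<alpha> \<beta>\<^esub> x'"
    unfolding quadratic_kernel_def kernel_def tensor_power_def carrier_FactGroup by blast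
  interpret N: normal "trel 2 \<alpha> \<beta>" "wgrp 2 \<alpha> \<beta>"
    using tensor_relations_normal T .
  have x: "x \<in> carrier (wgrp 2 \<alpha> \<beta>)"
    using t(2) x' N.r_coset_subset_G[OF N.subset x'(1)] by blast
  \<comment> \<open>\<open>x\<close> is an arbitrary representative of \<open>t\<close>, possibly
    different from the one by which the coset was obtained.\<close>
  have "t = trel 2 \<alpha> \<beta> #>\<^bsub>wgrp 2 \<alpha> \<beta>\<^esub> x"
    using N.repr_independence[OF _ x'(1) N.subgroup_axioms, of x] t(2) x'(2) by simp
  then have x1: "wmap 2 \<alpha> \<beta> x = \<one>\<^bsub>cpt A \<alpha> \<beta> 2\<^esub>"
    using mem_quadratic_kernel_iff[OF T x] t(1) by simp
  have wu: "word_product A \<sigma> \<alpha> u \<in> carrier (cpt A \<sigma> \<alpha> (length u))"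
    and wv: "word_product A \<beta> \<rho> v \<in> carrier (cpt A \<beta> \<rho> (length v))"
    using word_product_closed[OF S(1) u(1)] word_product_closed[OF T(2) v(1)] by auto
  have g1: "group (cpt A \<alpha> \<beta> 2)" and g2: "group (cpt A \<alpha> \<rho> (2 + length v))" and g3: "group (cpt A \<sigma> \<rho> n)"
    using comp_group S T by (auto simp: comm_group_def)
  have "wmap n \<sigma> \<rho> (frag_extend (\<lambda>w. frag_of (u @ w @ v)) x) = \<one>\<^bsub>cpt A \<sigma> \<rho> n\<^esub>"
    using word_group_map_append[OF S(1) T S(2) u(1) v(1) x]
      hom_one[OF mul_hom_left[OF T S(2) wv] g1 g2] hom_one[OF mul_hom_right[OF S(1) T(1) S(2) wu] g2 g3[unfolded n]]
    unfolding x1 n by simp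
  moreover have y: "frag_extend (\<lambda>w. frag_of (u @ w @ v)) x \<in> carrier (wgrp n \<sigma> \<rho>)"
    unfolding n by (rule frag_extend_append_closed[OF u(1) v(1) x])
  ultimately show "X \<in> kernel (tpow n \<sigma> \<rho>) (cpt A \<sigma> \<rho> n) (tmap n \<sigma> \<rho>)"
    using tensor_power_map_coset[OF S y] y
    unfolding X kernel_def tensor_power_def carrier_FactGroup
    by (intro CollectI conjI imageI) simp_all
qed

text \<open>The three rules of \<open>quad_rel\<close> become the unit, the quotients and the
  generators of the subgroup of cosets.\<close>

lemma quad_rel_imp_mem_quadratic_relations:
  assumes "quad_rel n \<sigma> \<rho> x" "\<sigma> \<in> \<Sigma>" "\<rho> \<in> \<Sigma>"
  shows "x \<in> carrier (wgrp n \<sigma> \<rho>) \<and>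
    trel n \<sigma> \<rho> #>\<^bsub>wgrp n \<sigma> \<rho>\<^esub> x \<in> quadratic_relations \<Sigma> A n \<sigma> \<rho>"
  using assms
proof (induction rule: quad_rel.induct)
  case (zero n \<sigma> \<rho>)
  interpret N: normal "trel n \<sigma> \<rho>" "wgrp n \<sigma> \<rho>"
    using tensor_relations_normal zero .
  have "trel n \<sigma> \<rho> #>\<^bsub>wgrp n \<sigma> \<rho>\<^esub> \<one>\<^bsub>wgrp n \<sigma> \<rho>\<^esub> =
      \<one>\<^bsub>tpow n \<sigma> \<rho>\<^esub>"
    unfolding tensor_power_def by (simp add: N.coset_mult_one[OF N.subset] del: word_group_simps)
  then show ?case
    unfolding quadratic_relations_eq using generate.one by (metis N.one_closed word_group_simps(3))
next
  case (diff n \<sigma> \<rho> x y)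
  interpret N: normal "trel n \<sigma> \<rho>" "wgrp n \<sigma> \<rho>"
    using tensor_relations_normal diff.prems .
  interpret TP: group_hom "tpow n \<sigma> \<rho>" "cpt A \<sigma> \<rho> n" "tmap n \<sigma> \<rho>"
    using tensor_power_map_group_hom diff.prems .
  have sub: "subgroup (quadratic_relations \<Sigma> A n \<sigma> \<rho>) (tpow n \<sigma> \<rho>)"
    unfolding quadratic_relations_eq
    using quadratic_generators_subset_kernel[OF diff.prems, of n]
    by (intro TP.G.generate_is_subgroup) (auto simp: kernel_def)
  have xy: "x \<in> carrier (wgrp n \<sigma> \<rho>)" "y \<in> carrier (wgrp n \<sigma> \<rho>)"
    using diff by blast+
  have eq: "x - y = x \<otimes>\<^bsub>wgrp n \<sigma> \<rho>\<^esub> inv\<^bsub>wgrp n \<sigma> \<rho>\<^esub> y"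
    using xy by (simp add: word_group_def)
  have "trel n \<sigma> \<rho> #>\<^bsub>wgrp n \<sigma> \<rho>\<^esub> (x - y) =
    (trel n \<sigma> \<rho> #>\<^bsub>wgrp n \<sigma> \<rho>\<^esub> x) \<otimes>\<^bsub>tpow n \<sigma> \<rho>\<^esub>
    inv\<^bsub>tpow n \<sigma> \<rho>\<^esub> (trel n \<sigma> \<rho> #>\<^bsub>wgrp n \<sigma> \<rho>\<^esub> y)"
  proof -
    have "trel n \<sigma> \<rho> #>\<^bsub>wgrp n \<sigma> \<rho>\<^esub> y \<in> carrier (wgrp n \<sigma> \<rho> Mod trel n \<sigma> \<rho>)"
      unfolding carrier_FactGroup using xy by blast
    then show ?thesis
      unfolding tensor_power_def eq
      by (simp add: N.inv_FactGroup N.rcos_inv[OF xy(2)] N.rcos_sum[OF xy(1) N.inv_closed[OF xy(2)]]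
          del: word_group_simps)
  qed
  then show ?case
    using word_group_diff_closed[OF xy] diff subgroup.m_closed[OF sub] subgroup.m_inv_closed[OF sub] by simp
next
  case (ker \<alpha> \<beta> \<sigma> u \<rho> v x n)
  interpret N: normal "trel 2 \<alpha> \<beta>" "wgrp 2 \<alpha> \<beta>"
    using tensor_relations_normal ker.hyps(1,2) .
  let ?t = "trel 2 \<alpha> \<beta> #>\<^bsub>wgrp 2 \<alpha> \<beta>\<^esub> x"
  have t: "?t \<in> quadratic_kernel \<Sigma> A \<alpha> \<beta>"
    using mem_quadratic_kernel_iff[OF ker.hyps(1,2,5)] ker.hyps(6) by blast
  have x: "x \<in> ?t"
    using N.rcos_self[OF ker.hyps(5) N.subgroup_axioms] .
  \<comment> \<open>The kernel element occupies the places \<open>j\<close> and \<open>j + 1\<close>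
    with \<open>j = length u + 1\<close>.\<close>
  have j: "length u + 1 \<in> {1..n - 1}" "length u = length u + 1 - 1" "length v = n - (length u + 1) - 1"
    using ker.hyps(7) by auto
  have "trel n \<sigma> \<rho> #>\<^bsub>wgrp n \<sigma> \<rho>\<^esub> frag_extend (\<lambda>w. frag_of (u @ w @ v)) x
      \<in> quadratic_generators n \<sigma> \<rho>"
    unfolding quadratic_generators_def
    by (rule UN_I[OF j(1)], rule CollectI,
        rule exI[of _ u], rule exI[of _ ?t], rule exI[of _ x], rule exI[of _ v], rule exI[of _ \<alpha>],
        rule exI[of _ \<beta>], intro conjI) (fact refl ker.hyps t x j)+
  then show ?case
    using frag_extend_append_closed[OF ker.hyps(3-5)] ker.hyps(7)
    unfolding quadratic_relations_eq by (auto intro: generate.incl simp: add.assoc simp del: word_group_simps)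
qed

text \<open>The multiplication map is onto by the first hypothesis, and its kernel is the subgroup
  of quadratic relations by both, so that the first isomorphism theorem applies.\<close>

theorem quadratic_if_linearly_generated_and_quadratically_related:
  assumes gen: linearly_generated and rel: quadratically_related
  shows "quadratic \<Sigma> A"
  unfolding quadratic_def
proof (intro conjI allI impI ballI)
  fix n :: nat and \<sigma> \<rho> assume n: "n \<ge> 2" and S: "\<sigma> \<in> \<Sigma>" "\<rho> \<in> \<Sigma>"
  interpret TP: group_hom "tpow n \<sigma> \<rho>" "cpt A \<sigma> \<rho> n" "tmap n \<sigma> \<rho>"
    using tensor_power_map_group_hom S .
  have "quadratic_relations \<Sigma> A n \<sigma> \<rho> =
      kernel (tpow n \<sigma> \<rho>) (cpt A \<sigma> \<rho> n) (tmap n \<sigma> \<rho>)"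
  proof (rule equalityI)
    show "quadratic_relations \<Sigma> A n \<sigma> \<rho> \<subseteq>
      kernel (tpow n \<sigma> \<rho>) (cpt A \<sigma> \<rho> n) (tmap n \<sigma> \<rho>)"
      unfolding quadratic_relations_eq
      by (rule TP.G.generate_subgroup_incl[OF quadratic_generators_subset_kernel[OF S] TP.subgroup_kernel])
    show "kernel (tpow n \<sigma> \<rho>) (cpt A \<sigma> \<rho> n) (tmap n \<sigma> \<rho>) \<subseteq>
      quadratic_relations \<Sigma> A n \<sigma> \<rho>"
    proof (rule subsetI)
      fix X assume X: "X \<in> kernel (tpow n \<sigma> \<rho>) (cpt A \<sigma> \<rho> n) (tmap n \<sigma> \<rho>)"
      then obtain x where x: "x \<in> carrier (wgrp n \<sigma> \<rho>)"
        "X = trel n \<sigma> \<rho> #>\<^bsub>wgrp n \<sigma> \<rho>\<^esub> x"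
        unfolding kernel_def tensor_power_def carrier_FactGroup by blast
      have "wmap n \<sigma> \<rho> x = \<one>\<^bsub>cpt A \<sigma> \<rho> n\<^esub>"
        using X tensor_power_map_coset[OF S x(1)] unfolding x(2) kernel_def by simp
      then show "X \<in> quadratic_relations \<Sigma> A n \<sigma> \<rho>"
        using quad_rel_imp_mem_quadratic_relations[OF quad_rel_if_word_group_map_one[OF gen rel S n x(1)] S]
        unfolding x(2) by blast
    qed
  qed
  moreover have "tmap n \<sigma> \<rho> ` carrier (tpow n \<sigma> \<rho>) = carrier (cpt A \<sigma> \<rho> n)"
  proof (rule equalityI)
    show "carrier (cpt A \<sigma> \<rho> n) \<subseteq> tmap n \<sigma> \<rho> ` carrier (tpow n \<sigma> \<rho>)"
    proof (rule subsetI)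
      fix f assume "f \<in> carrier (cpt A \<sigma> \<rho> n)"
      moreover have "n \<ge> 1" using n by simp
      ultimately obtain x where x: "x \<in> carrier (wgrp n \<sigma> \<rho>)" and f: "f = wmap n \<sigma> \<rho> x"
        using word_group_map_onto[OF gen S, of n f] by blast
      show "f \<in> tmap n \<sigma> \<rho> ` carrier (tpow n \<sigma> \<rho>)"
        unfolding f tensor_power_map_coset[OF S x, symmetric] tensor_power_def carrier_FactGroup
        using x by (intro imageI)
    qed
  qed (use TP.hom_closed in blast)
  ultimately show "(\<lambda>X. the_elem (tmap n \<sigma> \<rho> ` X))
      \<in> iso (tpow n \<sigma> \<rho> Mod quadratic_relations \<Sigma> A n \<sigma> \<rho>) (cpt A \<sigma> \<rho> n)"
    using TP.FactGroup_iso_set by simp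
qed (rule big_graded_ring_axioms)

end

section \<open>Twists and shifts\<close>

context preadditive_category
begin

text \<open>Arrows do not know their source and target, and hom-sets may overlap. Bundling the three
  memberships lets the type of a composite be obtained by chaining facts.\<close>

definition arr :: "'m \<Rightarrow> 'o \<Rightarrow> 'o \<Rightarrow> bool" where
  "arr f X Y \<longleftrightarrow> X \<in> Obj C \<and> Y \<in> Obj C \<and> f \<in> carrier (Hom C X Y)"

abbreviation zero_arr :: "'o \<Rightarrow> 'o \<Rightarrow> 'm" where
  "zero_arr X Y \<equiv> \<one>\<^bsub>Hom C X Y\<^esub>"

lemma arrI: "\<lbrakk>X \<in> Obj C; Y \<in> Obj C; f \<in> carrier (Hom C X Y)\<rbrakk> \<Longrightarrow> arr f X Y"
  by (simp add: arr_def)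

lemma arr_obj: "arr f X Y \<Longrightarrow> X \<in> Obj C" "arr f X Y \<Longrightarrow> Y \<in> Obj C"
  and arr_hom: "arr f X Y \<Longrightarrow> f \<in> carrier (Hom C X Y)"
  by (simp_all add: arr_def)

lemma arr_id: "X \<in> Obj C \<Longrightarrow> arr (idm C X) X X"
  by (simp add: arr_def id_closed)

lemma arr_comp: "\<lbrakk>arr f X Y; arr g Y Z\<rbrakk> \<Longrightarrow> arr (g \<cdot> f) X Z"
  by (auto simp: arr_def cmp_closed)

lemma comp_assoc: "\<lbrakk>arr f W X; arr g X Y; arr h Y Z\<rbrakk> \<Longrightarrow> (h \<cdot> g) \<cdot> f = h \<cdot> (g \<cdot> f)"
  using cmp_assoc by (auto simp: arr_def)

lemma comp_id_left: "arr f X Y \<Longrightarrow> idm C Y \<cdot> f = f"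
  and comp_id_right: "arr f X Y \<Longrightarrow> f \<cdot> idm C X = f"
  using id_left id_right by (auto simp: arr_def)

lemma comp_hom_left: "\<lbrakk>arr g Y Z; X \<in> Obj C\<rbrakk> \<Longrightarrow> (\<lambda>f. g \<cdot> f) \<in> hom (Hom C X Y) (Hom C X Z)"
  by (rule homI) (auto simp: arr_def cmp_closed cmp_add_right)

lemma comp_hom_right: "\<lbrakk>arr f X Y; Z \<in> Obj C\<rbrakk> \<Longrightarrow> (\<lambda>g. g \<cdot> f) \<in> hom (Hom C Y Z) (Hom C X Z)"
  by (rule homI) (auto simp: arr_def cmp_closed cmp_add_left)

lemma hom_is_group: "\<lbrakk>X \<in> Obj C; Y \<in> Obj C\<rbrakk> \<Longrightarrow> group (Hom C X Y)"
  using hom_group by (simp add: comm_group_def)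

lemma comp_group_hom_left:
  "\<lbrakk>arr g Y Z; X \<in> Obj C\<rbrakk> \<Longrightarrow> group_hom (Hom C X Y) (Hom C X Z) (\<lambda>f. g \<cdot> f)"
  using comp_hom_left hom_is_group by (auto simp: group_hom_def group_hom_axioms_def arr_def)

lemma comp_group_hom_right:
  "\<lbrakk>arr f X Y; Z \<in> Obj C\<rbrakk> \<Longrightarrow> group_hom (Hom C Y Z) (Hom C X Z) (\<lambda>g. g \<cdot> f)"
  using comp_hom_right hom_is_group by (auto simp: group_hom_def group_hom_axioms_def arr_def)

lemma arr_zero: "\<lbrakk>X \<in> Obj C; Y \<in> Obj C\<rbrakk> \<Longrightarrow> arr (zero_arr X Y) X Y"
  using hom_is_group by (simp add: arr_def group.is_monoid)

lemma arr_inv: "arr f X Y \<Longrightarrow> arr (inv\<^bsub>Hom C X Y\<^esub> f) X Y"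
  using hom_is_group by (simp add: arr_def group.inv_closed)

lemma comp_zero_right: "\<lbrakk>arr g Y Z; X \<in> Obj C\<rbrakk> \<Longrightarrow> g \<cdot> zero_arr X Y = zero_arr X Z"
  using group_hom.hom_one[OF comp_group_hom_left] by simp

lemma comp_zero_left: "\<lbrakk>arr f X Y; Z \<in> Obj C\<rbrakk> \<Longrightarrow> zero_arr Y Z \<cdot> f = zero_arr X Z"
  using group_hom.hom_one[OF comp_group_hom_right] by simp

lemma comp_inv_right: "\<lbrakk>arr f X Y; arr g Y Z\<rbrakk> \<Longrightarrow> g \<cdot> inv\<^bsub>Hom C X Y\<^esub> f = inv\<^bsub>Hom C X Z\<^esub> (g \<cdot> f)"
  using group_hom.hom_inv[OF comp_group_hom_left[of g Y Z X]] by (simp add: arr_def)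

lemma comp_inv_left: "\<lbrakk>arr f X Y; arr g Y Z\<rbrakk> \<Longrightarrow> inv\<^bsub>Hom C Y Z\<^esub> g \<cdot> f = inv\<^bsub>Hom C X Z\<^esub> (g \<cdot> f)"
  using group_hom.hom_inv[OF comp_group_hom_right[of f X Y Z]] by (simp add: arr_def)

lemma arr_sum:
  "\<lbrakk>X \<in> Obj C; Y \<in> Obj C; \<And>i. i \<in> I \<Longrightarrow> arr (f i) X Y\<rbrakk> \<Longrightarrow> arr (finprod (Hom C X Y) f I) X Y"
  using hom_group by (auto simp: arr_def comm_group_def intro!: comm_monoid.finprod_closed)

lemma comp_sum_right:
  assumes "arr g Y Z" "X \<in> Obj C" "\<And>i. i \<in> I \<Longrightarrow> arr (f i) X Y"
  shows "g \<cdot> finprod (Hom C X Y) f I = finprod (Hom C X Z) (\<lambda>i. g \<cdot> f i) I"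
  using hom_finprod[OF hom_group hom_group comp_hom_left[OF assms(1,2)]] assms by (auto simp: arr_def)

lemma comp_sum_left:
  assumes "arr f X Y" "Z \<in> Obj C" "\<And>i. i \<in> I \<Longrightarrow> arr (g i) Y Z"
  shows "finprod (Hom C Y Z) g I \<cdot> f = finprod (Hom C X Z) (\<lambda>i. g i \<cdot> f) I"
  using hom_finprod[OF hom_group hom_group comp_hom_right[OF assms(1,2)]] assms by (auto simp: arr_def)

lemma sum_cong:
  assumes "X \<in> Obj C" "Y \<in> Obj C" "\<And>i. i \<in> I \<Longrightarrow> arr (g i) X Y" "\<And>i. i \<in> I \<Longrightarrow> f i = g i"
  shows "finprod (Hom C X Y) f I = finprod (Hom C X Y) g I"
proof -
  interpret comm_group "Hom C X Y" using hom_group assms by blast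
  show ?thesis by (rule finprod_cong') (use assms in \<open>auto simp: arr_def\<close>)
qed

lemma is_iso_iff:
  "X \<in> Obj C \<Longrightarrow> Y \<in> Obj C \<Longrightarrow> is_iso C X Y f \<longleftrightarrow>
    arr f X Y \<and> (\<exists>g. arr g Y X \<and> g \<cdot> f = idm C X \<and> f \<cdot> g = idm C Y)"
  by (auto simp: is_iso_def arr_def)

lemma is_isoI: "\<lbrakk>arr f X Y; arr g Y X; g \<cdot> f = idm C X; f \<cdot> g = idm C Y\<rbrakk> \<Longrightarrow> is_iso C X Y f"
  by (auto simp: is_iso_def arr_def)

lemma is_iso_id: "X \<in> Obj C \<Longrightarrow> is_iso C X X (idm C X)"
  using is_isoI arr_id comp_id_left by blast

lemma is_iso_comp:
  assumes "X \<in> Obj C" "Y \<in> Obj C" "Z \<in> Obj C" "is_iso C X Y f" "is_iso C Y Z g"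
  shows "is_iso C X Z (g \<cdot> f)"
proof -
  obtain f' where f: "arr f X Y" "arr f' Y X" "f' \<cdot> f = idm C X" "f \<cdot> f' = idm C Y"
    using is_iso_iff[of X Y f] assms by blast
  obtain g' where g: "arr g Y Z" "arr g' Z Y" "g' \<cdot> g = idm C Y" "g \<cdot> g' = idm C Z"
    using is_iso_iff[of Y Z g] assms by blast
  have 1: "(f' \<cdot> g') \<cdot> (g \<cdot> f) = idm C X"
    using comp_assoc[OF arr_comp[OF f(1) g(1)] g(2) f(2)] comp_assoc[OF f(1) g(1,2)] g(3) comp_id_left[OF f(1)] f(3)
    by simp
  have 2: "(g \<cdot> f) \<cdot> (f' \<cdot> g') = idm C Z"
    using comp_assoc[OF arr_comp[OF g(2) f(2)] f(1) g(1)] comp_assoc[OF g(2) f(2,1)] f(4) comp_id_left[OF g(2)] g(4)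
    by simp
  show ?thesis
    using is_isoI[OF arr_comp[OF f(1) g(1)] arr_comp[OF g(2) f(2)] 1 2] .
qed

lemma isomorphic_trans:
  "\<lbrakk>X \<in> Obj C; Y \<in> Obj C; Z \<in> Obj C; isomorphic C X Y; isomorphic C Y Z\<rbrakk> \<Longrightarrow> isomorphic C X Z"
  unfolding isomorphic_def using is_iso_comp by blast

lemma isomorphic_sym: "\<lbrakk>X \<in> Obj C; Y \<in> Obj C; isomorphic C X Y\<rbrakk> \<Longrightarrow> isomorphic C Y X"
  unfolding isomorphic_def is_iso_def by blast

lemma isomorphic_refl: "X \<in> Obj C \<Longrightarrow> isomorphic C X X"
  unfolding isomorphic_def using is_iso_id by blast

end

section \<open>Additive autoequivalences and their powers\<close>

context additive_autoequivalence
begin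

lemma functor_arr: "arr f X Y \<Longrightarrow> arr (F1 f) (F0 X) (F0 Y)"
  using functor_obj functor_hom hom_in_carrier by (fastforce simp: arr_def)

lemma functor_comp: "arr f X Y \<Longrightarrow> arr g Y Z \<Longrightarrow> F1 (g \<cdot> f) = F1 g \<cdot> F1 f"
  using functor_cmp by (auto simp: arr_def)

lemma functor_group_hom:
  "\<lbrakk>X \<in> Obj C; Y \<in> Obj C\<rbrakk> \<Longrightarrow> group_hom (Hom C X Y) (Hom C (F0 X) (F0 Y)) F1"
  using functor_hom hom_is_group functor_obj by (simp add: group_hom_def group_hom_axioms_def)

lemma functor_zero: "\<lbrakk>X \<in> Obj C; Y \<in> Obj C\<rbrakk> \<Longrightarrow> F1 (zero_arr X Y) = zero_arr (F0 X) (F0 Y)"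
  using group_hom.hom_one[OF functor_group_hom] .

lemma functor_inv: "arr f X Y \<Longrightarrow> F1 (inv\<^bsub>Hom C X Y\<^esub> f) = inv\<^bsub>Hom C (F0 X) (F0 Y)\<^esub> (F1 f)"
  using group_hom.hom_inv[OF functor_group_hom] by (simp add: arr_def)

lemma functor_sum:
  assumes "X \<in> Obj C" "Y \<in> Obj C" "\<And>i. i \<in> I \<Longrightarrow> arr (f i) X Y"
  shows "F1 (finprod (Hom C X Y) f I) = finprod (Hom C (F0 X) (F0 Y)) (\<lambda>i. F1 (f i)) I"
  using hom_finprod[OF hom_group hom_group functor_hom] functor_obj assms by (auto simp: arr_def)

lemma functor_faithful: "\<lbrakk>arr f X Y; arr g X Y; F1 f = F1 g\<rbrakk> \<Longrightarrow> f = g"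
  using fully_faithful[of X Y] by (auto simp: arr_def bij_betw_def inj_on_def)

lemma functor_full:
  assumes "X \<in> Obj C" "Y \<in> Obj C" "arr g (F0 X) (F0 Y)"
  obtains f where "arr f X Y" "F1 f = g"
  using fully_faithful[of X Y] assms unfolding arr_def bij_betw_def by (metis imageE)

lemma functor_iso: "\<lbrakk>X \<in> Obj C; Y \<in> Obj C; is_iso C X Y f\<rbrakk> \<Longrightarrow> is_iso C (F0 X) (F0 Y) (F1 f)"
proof -
  assume XY: "X \<in> Obj C" "Y \<in> Obj C" and "is_iso C X Y f"
  then obtain g where g: "arr f X Y" "arr g Y X" "g \<cdot> f = idm C X" "f \<cdot> g = idm C Y"
    using is_iso_iff by blast
  show "is_iso C (F0 X) (F0 Y) (F1 f)"
    using is_isoI[OF functor_arr[OF g(1)] functor_arr[OF g(2)]]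
      functor_comp[OF g(1,2)] functor_comp[OF g(2,1)] g(3,4) functor_id XY by simp
qed

lemma functor_isomorphic: "\<lbrakk>X \<in> Obj C; Y \<in> Obj C; isomorphic C X Y\<rbrakk> \<Longrightarrow> isomorphic C (F0 X) (F0 Y)"
  unfolding isomorphic_def using functor_iso by blast

text \<open>One proof serves the powers of both the shift and the twist.\<close>

lemma additive_autoequivalence_funpow: "additive_autoequivalence C (F0 ^^ n) (F1 ^^ n)"
proof (induction n)
  case 0
  show ?case
    by unfold_locales
      (auto simp: hom_def bij_betw_def id_def intro: isomorphic_refl)
next
  case (Suc n)
  interpret N: additive_autoequivalence C "F0 ^^ n" "F1 ^^ n" by fact
  show ?case
  proof unfold_locales
    fix X Y assume XY: "X \<in> Obj C" "Y \<in> Obj C"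
    show "(F1 ^^ Suc n) \<in> hom (Hom C X Y) (Hom C ((F0 ^^ Suc n) X) ((F0 ^^ Suc n) Y))"
      using hom_compose[OF N.functor_hom[OF XY] functor_hom[OF N.functor_obj[OF XY(1)] N.functor_obj[OF XY(2)]]]
      by simp
    show "bij_betw (F1 ^^ Suc n) (carrier (Hom C X Y)) (carrier (Hom C ((F0 ^^ Suc n) X) ((F0 ^^ Suc n) Y)))"
      using bij_betw_trans[OF N.fully_faithful[OF XY] fully_faithful[OF N.functor_obj[OF XY(1)] N.functor_obj[OF XY(2)]]]
      by simp
  next
    fix X Y Z f g
    assume XYZ: "X \<in> Obj C" "Y \<in> Obj C" "Z \<in> Obj C" "f \<in> carrier (Hom C X Y)" "g \<in> carrier (Hom C Y Z)"
    then have fg: "arr f X Y" "arr g Y Z" by (simp_all add: arr_def)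
    show "(F1 ^^ Suc n) (g \<cdot> f) = (F1 ^^ Suc n) g \<cdot> (F1 ^^ Suc n) f"
      using N.functor_comp[OF fg] functor_comp[OF N.functor_arr[OF fg(1)] N.functor_arr[OF fg(2)]] by simp
  next
    fix Y assume Y: "Y \<in> Obj C"
    obtain X where X: "X \<in> Obj C" "isomorphic C (F0 X) Y" using essentially_surjective Y by blast
    obtain W where W: "W \<in> Obj C" "isomorphic C ((F0 ^^ n) W) X" using N.essentially_surjective X by blast
    have "isomorphic C (F0 ((F0 ^^ n) W)) (F0 X)"
      using functor_isomorphic W X N.functor_obj by blast
    then show "\<exists>X\<in>Obj C. isomorphic C ((F0 ^^ Suc n) X) Y"
      using isomorphic_trans[OF _ _ Y _ X(2)] functor_obj N.functor_obj W X by auto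
  qed (simp_all add: functor_obj N.functor_obj functor_id N.functor_id)
qed

end

context triangulated_category
begin

text \<open>Interpreted for all powers at once; facts about the shift itself are the instances with
  \<open>n = 1\<close>.\<close>

sublocale shift: additive_autoequivalence D "sh0 D ^^ n" "sh1 D ^^ n" for n
  using additive_autoequivalence.additive_autoequivalence_funpow[OF shift] .

abbreviation Sh where "Sh n X \<equiv> (sh0 D ^^ n) X"
abbreviation Shm where "Shm n f \<equiv> (sh1 D ^^ n) f"

end

section \<open>Coherence of twist and shift\<close>

context triangulated_autoequivalence
begin

abbreviation ts where "ts \<equiv> twist_shift D T0 \<phi>"
abbreviation tss where "tss \<equiv> twists_shift D T0 T1 \<phi>"
abbreviation diag where "diag \<equiv> diagonal_cohomology D T0 T1 \<phi>"

sublocale twist: additive_autoequivalence D "T0 ^^ n" "T1 ^^ n" for n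
  by (rule additive_autoequivalence_funpow)

lemma twist_shift_iso: "X \<in> Obj D \<Longrightarrow>
    is_iso D (T0 (Sh n X)) (Sh n (T0 X)) (ts n X)"
proof (induction n)
  case 0
  then show ?case using is_iso_id functor_obj by simp
next
  case (Suc n)
  have o: "T0 (Sh n X) \<in> Obj D" "Sh n (T0 X) \<in> Obj D" "Sh n X \<in> Obj D"
    using Suc functor_obj shift.functor_obj by auto
  show ?case
    using is_iso_comp[OF _ _ _ phi_iso[OF o(3)] shift.functor_iso[OF o(1,2) Suc.IH[OF Suc.prems], of 1, simplified]]
      o functor_obj shift.functor_obj[of _ 1] by simp
qed

lemma twist_shift_arr: "X \<in> Obj D \<Longrightarrow>
    arr (ts n X) (T0 (Sh n X)) (Sh n (T0 X))"
  using twist_shift_iso is_iso_iff functor_obj shift.functor_obj by blast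

lemma phi_arr: "X \<in> Obj D \<Longrightarrow> arr (\<phi> X) (T0 (sh0 D X)) (sh0 D (T0 X))"
  using twist_shift_arr[of X 1] phi_iso is_iso_iff functor_obj shift.functor_obj[of _ 1] by simp

lemma twist_shift_natural:
  assumes f: "arr f X Y"
  shows "ts n Y \<cdot> T1 (Shm n f) = Shm n (T1 f) \<cdot> ts n X"
proof (induction n)
  case 0
  show ?case using comp_id_left comp_id_right functor_arr[OF f] by simp
next
  case (Suc n)
  note XY = arr_obj[OF f]
  have fn: "arr (Shm n f) (Sh n X) (Sh n Y)" using shift.functor_arr[OF f] .
  note s = shift.functor_arr[of _ _ _ 1, simplified] and sc = shift.functor_comp[of _ _ _ _ _ 1, simplified]
  have p: "arr (\<phi> (Sh n Z)) (T0 (sh0 D (Sh n Z))) (sh0 D (T0 (Sh n Z)))" if "Z \<in> Obj D" for Z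
    using phi_arr shift.functor_obj that by blast
  have "ts (Suc n) Y \<cdot> T1 (Shm (Suc n) f) =
      sh1 D (ts n Y) \<cdot> \<phi> (Sh n Y) \<cdot> T1 (sh1 D (Shm n f))"
    using comp_assoc[OF functor_arr[OF s[OF fn]] p[OF XY(2)] s[OF twist_shift_arr[OF XY(2)]]] by simp
  also have "\<dots> = sh1 D (ts n Y) \<cdot> sh1 D (T1 (Shm n f)) \<cdot> \<phi> (Sh n X)"
    using phi_natural[OF arr_obj[OF fn] arr_hom[OF fn]] by simp
  also have "\<dots> = sh1 D (ts n Y \<cdot> T1 (Shm n f)) \<cdot> \<phi> (Sh n X)"
    using comp_assoc[OF p[OF XY(1)] s[OF functor_arr[OF fn]] s[OF twist_shift_arr[OF XY(2)]]]
      sc[OF functor_arr[OF fn] twist_shift_arr[OF XY(2)]] by simp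
  also have "\<dots> = Shm (Suc n) (T1 f) \<cdot> ts (Suc n) X"
    unfolding Suc using comp_assoc[OF p[OF XY(1)] s[OF twist_shift_arr[OF XY(1)]] s[OF shift.functor_arr[OF functor_arr[OF f]]]]
      sc[OF twist_shift_arr[OF XY(1)] shift.functor_arr[OF functor_arr[OF f]]] by simp
  finally show ?case .
qed

lemma twist_shift_add:
  assumes X: "X \<in> Obj D"
  shows "ts (n + m) X = Shm m (ts n X) \<cdot> ts m (Sh n X)"
proof (induction m)
  case 0
  show ?case using comp_id_right[OF twist_shift_arr[OF X]] by simp
next
  case (Suc m)
  have Xn: "Sh n X \<in> Obj D" using shift.functor_obj X .
  note s = shift.functor_arr[of _ _ _ 1, simplified] and sc = shift.functor_comp[of _ _ _ _ _ 1, simplified]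
  have e: "Sh (n + m) X = Sh m (Sh n X)"
    by (simp add: funpow_add add.commute)
  have p: "arr (\<phi> (Sh m (Sh n X))) (T0 (sh0 D (Sh m (Sh n X))))
      (sh0 D (T0 (Sh m (Sh n X))))"
    using phi_arr shift.functor_obj Xn by blast
  note a = twist_shift_arr[OF Xn, of m] and b = shift.functor_arr[OF twist_shift_arr[OF X, of n], of m]
  show ?case
    using Suc sc[OF a b] comp_assoc[OF p s[OF a] s[OF b]] by (simp add: e)
qed

lemma twists_shift_iso: "X \<in> Obj D \<Longrightarrow>
    is_iso D ((T0 ^^ m) (Sh n X)) (Sh n ((T0 ^^ m) X)) (tss m n X)"
proof (induction m)
  case 0
  then show ?case using is_iso_id shift.functor_obj by simp
next
  case (Suc m)
  have o: "(T0 ^^ m) X \<in> Obj D" "(T0 ^^ m) (Sh n X) \<in> Obj D" "Sh n ((T0 ^^ m) X) \<in> Obj D"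
    using Suc twist.functor_obj shift.functor_obj by auto
  show ?case
    using is_iso_comp[OF _ _ _ functor_iso[OF o(2,3) Suc.IH[OF Suc.prems]] twist_shift_iso[OF o(1)]]
      o functor_obj shift.functor_obj by simp
qed

lemma twists_shift_arr: "X \<in> Obj D \<Longrightarrow>
    arr (tss m n X) ((T0 ^^ m) (Sh n X)) (Sh n ((T0 ^^ m) X))"
  using twists_shift_iso is_iso_iff twist.functor_obj shift.functor_obj by blast

lemma twists_shift_natural:
  assumes f: "arr f X Y"
  shows "tss m n Y \<cdot> (T1 ^^ m) (Shm n f) =
    Shm n ((T1 ^^ m) f) \<cdot> tss m n X"
proof (induction m)
  case 0
  show ?case
    using comp_id_left[OF shift.functor_arr[OF f, of n]] comp_id_right[OF shift.functor_arr[OF f, of n]] by simp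
next
  case (Suc m)
  note XY = arr_obj[OF f]
  note fm = twist.functor_arr[OF f, of m]
  note fn = shift.functor_arr[OF f, of n]
  note Tfn = functor_arr[OF twist.functor_arr[OF fn, of m]]
  have t: "arr (ts n ((T0 ^^ m) Z)) (T0 (Sh n ((T0 ^^ m) Z))) (Sh n (T0 ((T0 ^^ m) Z)))"
    if "Z \<in> Obj D" for Z
    using twist_shift_arr twist.functor_obj that by blast
  note ts = twists_shift_arr[of _ m n]
  have "tss (Suc m) n Y \<cdot> (T1 ^^ Suc m) (Shm n f) =
      ts n ((T0 ^^ m) Y) \<cdot> T1 (tss m n Y \<cdot> (T1 ^^ m) (Shm n f))"
    using comp_assoc[OF Tfn functor_arr[OF ts[OF XY(2)]] t[OF XY(2)]]
      functor_comp[OF twist.functor_arr[OF fn] ts[OF XY(2)]] by simp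
  also have "\<dots> = (ts n ((T0 ^^ m) Y) \<cdot> T1 (Shm n ((T1 ^^ m) f))) \<cdot> T1 (tss m n X)"
    unfolding Suc using functor_comp[OF ts[OF XY(1)] shift.functor_arr[OF fm]]
      comp_assoc[OF functor_arr[OF ts[OF XY(1)]] functor_arr[OF shift.functor_arr[OF fm]] t[OF XY(2)]] by simp
  also have "\<dots> = Shm n ((T1 ^^ Suc m) f) \<cdot> tss (Suc m) n X"
    unfolding twist_shift_natural[OF fm]
    using comp_assoc[OF functor_arr[OF ts[OF XY(1)]] t[OF XY(1)] shift.functor_arr[OF functor_arr[OF fm]]] by simp
  finally show ?case .
qed

text \<open>Cocycle identity in the number of shifts. In the step from \<open>k\<close> to
  \<open>k + 1\<close>, naturality of \<open>twist_shift\<close> exchanges the two middle factors,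
  after which the four factors regroup.\<close>

lemma twists_shift_add_shift:
  assumes X: "X \<in> Obj D"
  shows "tss k (n + m) X =
    Shm m (tss k n X) \<cdot> tss k m (Sh n X)"
proof (induction k)
  case 0
  have e: "Sh (n + m) X = Sh m (Sh n X)"
    by (simp add: funpow_add add.commute)
  show ?case
    using X comp_id_left[OF arr_id] shift.functor_obj shift.functor_id by (simp add: e)
next
  case (Suc k)
  have Xn: "Sh n X \<in> Obj D" using shift.functor_obj X .
  have TX: "(T0 ^^ k) X \<in> Obj D" using twist.functor_obj X .
  have TXn: "(T0 ^^ k) (Sh n X) \<in> Obj D" using twist.functor_obj Xn .
  note a = twists_shift_arr[OF X, of k n]
  note b = twists_shift_arr[OF Xn, of k m]
  note Ta = shift.functor_arr[OF functor_arr[OF a], of m]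
  note c = twist_shift_arr[OF TX, of n]
  note sc = shift.functor_arr[OF c, of m]
  note d = twist_shift_arr[OF shift.functor_obj[OF TX], of m n]
  note d' = twist_shift_arr[OF TXn, of m]
  have "tss (Suc k) (n + m) X =
      (Shm m (ts n ((T0 ^^ k) X)) \<cdot> ts m (Sh n ((T0 ^^ k) X))) \<cdot>
      T1 (Shm m (tss k n X)) \<cdot> T1 (tss k m (Sh n X))"
    using Suc functor_comp[OF b shift.functor_arr[OF a]] twist_shift_add[OF TX] by simp
  also have "\<dots> = Shm m (ts n ((T0 ^^ k) X)) \<cdot>
      (ts m (Sh n ((T0 ^^ k) X)) \<cdot> T1 (Shm m (tss k n X))) \<cdot>
      T1 (tss k m (Sh n X))"
    using comp_assoc[OF arr_comp[OF functor_arr[OF b] functor_arr[OF shift.functor_arr[OF a]]] d sc]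
      comp_assoc[OF functor_arr[OF b] functor_arr[OF shift.functor_arr[OF a]] d] by simp
  also have "\<dots> = Shm m (ts n ((T0 ^^ k) X)) \<cdot>
      (Shm m (T1 (tss k n X)) \<cdot> ts m ((T0 ^^ k) (Sh n X))) \<cdot>
      T1 (tss k m (Sh n X))"
    unfolding twist_shift_natural[OF a] ..
  also have "\<dots> = (Shm m (ts n ((T0 ^^ k) X)) \<cdot> Shm m (T1 (tss k n X))) \<cdot>
      (ts m ((T0 ^^ k) (Sh n X)) \<cdot> T1 (tss k m (Sh n X)))"
    using comp_assoc[OF functor_arr[OF b] d' Ta] comp_assoc[OF arr_comp[OF functor_arr[OF b] d'] Ta sc] by simp
  also have "\<dots> = Shm m (tss (Suc k) n X) \<cdot> tss (Suc k) m (Sh n X)"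
    using shift.functor_comp[OF functor_arr[OF a] c, of m] by simp
  finally show ?case .
qed

text \<open>Cocycle identity in the number of twists. Together with
  \<open>twists_shift_add_shift\<close> it carries the associativity of diagonal cohomology.\<close>

lemma twists_shift_add_twist:
  assumes X: "X \<in> Obj D"
  shows "tss (m + k) n X =
    tss k n ((T0 ^^ m) X) \<cdot> (T1 ^^ k) (tss m n X)"
proof (induction k)
  case 0
  show ?case using comp_id_left[OF twists_shift_arr[OF X]] by simp
next
  case (Suc k)
  have e: "(T0 ^^ (m + k)) X = (T0 ^^ k) ((T0 ^^ m) X)"
    by (simp add: funpow_add add.commute)
  have TX: "(T0 ^^ m) X \<in> Obj D" using twist.functor_obj X .
  note a = twist.functor_arr[OF twists_shift_arr[OF X, of m n], of k]
  note b = twists_shift_arr[OF TX, of k n]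
  note c = twist_shift_arr[OF twist.functor_obj[OF TX], of n k]
  show ?case
    using Suc functor_comp[OF a b] comp_assoc[OF functor_arr[OF a] functor_arr[OF b] c] by (simp add: e)
qed

text \<open>For \<open>g : Y \<rightarrow> Z(n)[n]\<close> this is the twist \<open>g(m)\<close>,
  with its target \<open>Z(n)[n](m)\<close> identified with \<open>Z(n + m)[n]\<close>.\<close>

definition twist_arr where
  "twist_arr m n Z g = tss m n ((T0 ^^ n) Z) \<cdot> (T1 ^^ m) g"

lemma funpow_add_apply: "(F ^^ m) ((F ^^ n) x) = (F ^^ (n + m)) x"
  by (simp add: funpow_add add.commute)

lemma twist_arr_arr:
  assumes "Z \<in> Obj D" "arr g Y (Sh n ((T0 ^^ n) Z))"
  shows "arr (twist_arr m n Z g) ((T0 ^^ m) Y) (Sh n ((T0 ^^ (n + m)) Z))"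
  using arr_comp[OF twist.functor_arr[OF assms(2), of m] twists_shift_arr[OF twist.functor_obj[OF assms(1)], of m n n]]
  by (simp add: twist_arr_def funpow_add_apply)

lemma twist_arr_hom:
  assumes "Z \<in> Obj D" "Y \<in> Obj D"
  shows "twist_arr m n Z \<in> hom (Hom D Y (Sh n ((T0 ^^ n) Z)))
    (Hom D ((T0 ^^ m) Y) (Sh n ((T0 ^^ (n + m)) Z)))"
proof -
  have o: "Sh n ((T0 ^^ n) Z) \<in> Obj D" "(T0 ^^ n) Z \<in> Obj D" "(T0 ^^ m) Y \<in> Obj D"
    using shift.functor_obj twist.functor_obj assms by auto
  show ?thesis
    using hom_compose[OF twist.functor_hom[OF assms(2) o(1)] comp_hom_left[OF twists_shift_arr[OF o(2)] o(3)]]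
    by (simp add: twist_arr_def[abs_def] o_def funpow_add_apply)
qed

text \<open>The twist is fully faithful and \<open>twists_shift\<close> is an isomorphism. Arrows
  between twisted objects thus correspond to elements of diagonal cohomology, which is how
  factorizations in the category are turned into products in the ring.\<close>

lemma twist_arr_bij:
  assumes "Z \<in> Obj D" "Y \<in> Obj D"
  shows "bij_betw (twist_arr m n Z) (carrier (Hom D Y (Sh n ((T0 ^^ n) Z))))
    (carrier (Hom D ((T0 ^^ m) Y) (Sh n ((T0 ^^ (n + m)) Z))))"
proof -
  let ?Z = "(T0 ^^ n) Z" let ?t = "tss m n ?Z"
  have o: "Sh n ?Z \<in> Obj D" "?Z \<in> Obj D" "(T0 ^^ m) Y \<in> Obj D"
    "(T0 ^^ m) (Sh n ?Z) \<in> Obj D" "Sh n ((T0 ^^ m) ?Z) \<in> Obj D"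
    using shift.functor_obj twist.functor_obj assms by auto
  obtain t' where t': "arr t' (Sh n ((T0 ^^ m) ?Z)) ((T0 ^^ m) (Sh n ?Z))"
    "t' \<cdot> ?t = idm D ((T0 ^^ m) (Sh n ?Z))" "?t \<cdot> t' = idm D (Sh n ((T0 ^^ m) ?Z))"
    using twists_shift_iso[OF o(2), of m n] is_iso_iff[OF o(4,5)] by blast
  note t = twists_shift_arr[OF o(2), of m n]
  have "bij_betw (\<lambda>f. ?t \<cdot> f) (carrier (Hom D ((T0 ^^ m) Y) ((T0 ^^ m) (Sh n ?Z))))
      (carrier (Hom D ((T0 ^^ m) Y) (Sh n ((T0 ^^ m) ?Z))))"
  proof (rule bij_betw_byWitness[where f' = "\<lambda>f. t' \<cdot> f"])
    show "\<forall>f\<in>carrier (Hom D ((T0 ^^ m) Y) ((T0 ^^ m) (Sh n ?Z))). t' \<cdot> ?t \<cdot> f = f"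
      using comp_assoc[OF arrI[OF o(3,4)] t t'(1)] comp_id_left[OF arrI[OF o(3,4)]] t'(2) by simp
    show "\<forall>f\<in>carrier (Hom D ((T0 ^^ m) Y) (Sh n ((T0 ^^ m) ?Z))). ?t \<cdot> t' \<cdot> f = f"
      using comp_assoc[OF arrI[OF o(3,5)] t'(1) t] comp_id_left[OF arrI[OF o(3,5)]] t'(3) by simp
  qed (use arr_comp[OF arrI[OF o(3,4)] t] arr_comp[OF arrI[OF o(3,5)] t'(1)] in \<open>auto simp: arr_def\<close>)
  from bij_betw_trans[OF twist.fully_faithful[OF assms(2) o(1), of m] this]
  show ?thesis
    by (simp add: twist_arr_def[abs_def] o_def funpow_add_apply)
qed

text \<open>Twisting is multiplicative, \<open>(a b)(k) = a(k) b(k)\<close>. Both cocycle identities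
  and naturality enter, since \<open>k\<close> twists have to pass first \<open>m\<close> and then
  \<open>n\<close> shifts.\<close>

lemma twist_arr_comp:
  assumes "Z \<in> Obj D" "Y \<in> Obj D"
    and a: "arr a Y (Sh n ((T0 ^^ n) Z))" and b: "arr b X (Sh m ((T0 ^^ m) Y))"
  shows "twist_arr k (n + m) Z (Shm m (twist_arr m n Z a) \<cdot> b) =
    Shm m (twist_arr (m + k) n Z a) \<cdot> twist_arr k m Y b"
proof -
  define Q where "Q = (T0 ^^ (n + m)) Z"
  have Q: "Q \<in> Obj D" "Sh n Q \<in> Obj D" and TZ: "(T0 ^^ n) Z \<in> Obj D" and TY: "(T0 ^^ m) Y \<in> Obj D"
    using shift.functor_obj twist.functor_obj assms by (auto simp: Q_def)
  define u where "u = twist_arr m n Z a"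
  have u: "arr u ((T0 ^^ m) Y) (Sh n Q)"
    unfolding u_def Q_def using assms twist_arr_arr by blast
  have QZ: "Q = (T0 ^^ m) ((T0 ^^ n) Z)" by (simp add: Q_def funpow_add_apply)
  note su = shift.functor_arr[OF u, of m]
  note Tsu = twist.functor_arr[OF su, of k] and Tb = twist.functor_arr[OF b, of k] and Tu = twist.functor_arr[OF u, of k]
  note t1 = twists_shift_arr[OF Q(1), of k n] and t2 = twists_shift_arr[OF Q(2), of k m]
    and t3 = twists_shift_arr[OF TY, of k m]
  note st1 = shift.functor_arr[OF t1, of m]
  have "twist_arr k (n + m) Z (Shm m u \<cdot> b) =
      (Shm m (tss k n Q) \<cdot> tss k m (Sh n Q)) \<cdot>
      ((T1 ^^ k) (Shm m u) \<cdot> (T1 ^^ k) b)"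
    unfolding twist_arr_def Q_def[symmetric] twists_shift_add_shift[OF Q(1)] using twist.functor_comp[OF b su] by simp
  also have "\<dots> = Shm m (tss k n Q) \<cdot>
      (tss k m (Sh n Q) \<cdot> (T1 ^^ k) (Shm m u)) \<cdot> (T1 ^^ k) b"
    using comp_assoc[OF arr_comp[OF Tb Tsu] t2 st1] comp_assoc[OF Tb Tsu t2] by simp
  also have "\<dots> = Shm m (tss k n Q) \<cdot>
      (Shm m ((T1 ^^ k) u) \<cdot> tss k m ((T0 ^^ m) Y)) \<cdot> (T1 ^^ k) b"
    unfolding twists_shift_natural[OF u] ..
  also have "\<dots> = (Shm m (tss k n Q) \<cdot> Shm m ((T1 ^^ k) u)) \<cdot> twist_arr k m Y b"
    using comp_assoc[OF Tb t3 shift.functor_arr[OF Tu]]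
      comp_assoc[OF arr_comp[OF Tb t3] shift.functor_arr[OF Tu] st1] by (simp add: twist_arr_def)
  also have "Shm m (tss k n Q) \<cdot> Shm m ((T1 ^^ k) u) =
      Shm m (tss k n Q \<cdot> (T1 ^^ k) u)"
    using shift.functor_comp[OF Tu t1] by simp
  also have "tss k n Q \<cdot> (T1 ^^ k) u = twist_arr (m + k) n Z a"
    using twist.functor_comp[OF twist.functor_arr[OF a, of m] twists_shift_arr[OF TZ, of m n], of k]
      comp_assoc[OF twist.functor_arr[OF twist.functor_arr[OF a, of m], of k]
        twist.functor_arr[OF twists_shift_arr[OF TZ, of m n], of k] t1[unfolded QZ]]
      twists_shift_add_twist[OF TZ, of m k n]
    by (simp add: u_def twist_arr_def QZ funpow_add_apply)
  finally show ?thesis unfolding u_def .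
qed

section \<open>The ring structure of diagonal cohomology\<close>

lemma cpt_diagonal_cohomology [simp]:
  "cpt diag Y X n = Hom D X (Sh n ((T0 ^^ n) Y))"
  by (simp add: diagonal_cohomology_def)

lemma mul_diagonal_cohomology [simp]:
  "mul diag Z Y X n m g f = Shm m (twist_arr m n Z g) \<cdot> f"
  by (simp add: diagonal_cohomology_def twist_arr_def)

lemma unt_diagonal_cohomology [simp]: "unt diag X = idm D X"
  by (simp add: diagonal_cohomology_def)

lemma arr_shift_twist:
  "\<lbrakk>X \<in> Obj D; Y \<in> Obj D; f \<in> carrier (Hom D X (Sh n ((T0 ^^ m) Y)))\<rbrakk> \<Longrightarrow>
    arr f X (Sh n ((T0 ^^ m) Y))"
  by (simp add: arr_def shift.functor_obj twist.functor_obj)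

text \<open>Associativity rests on \<open>twist_arr_comp\<close>, biadditivity on the additivity of
  twist, shift and composition.\<close>

lemma big_graded_ring_diagonal_cohomology:
  assumes "J \<subseteq> Obj D"
  shows "big_graded_ring J diag"
proof -
  have obj: "X \<in> Obj D" if "X \<in> J" for X using that assms by blast
  have stw: "arr (Shm m (twist_arr m n Z a)) (Sh m ((T0 ^^ m) Y)) (Sh (n + m) ((T0 ^^ (n + m)) Z))"
    if "Z \<in> Obj D" "arr a Y (Sh n ((T0 ^^ n) Z))" for m n Y Z a
    using shift.functor_arr[OF twist_arr_arr[OF that], of m] by (simp add: funpow_add_apply)
  have sthom: "(\<lambda>a. Shm m (twist_arr m n Z a)) \<in>
      hom (Hom D Y (Sh n ((T0 ^^ n) Z))) (Hom D (Sh m ((T0 ^^ m) Y)) (Sh (n + m) ((T0 ^^ (n + m)) Z)))"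
    if "Z \<in> Obj D" "Y \<in> Obj D" for m n Y Z
    using hom_compose[OF twist_arr_hom[OF that] shift.functor_hom[of "(T0 ^^ m) Y" "Sh n ((T0 ^^ (n + m)) Z)" m]]
      that shift.functor_obj twist.functor_obj by (simp add: o_def funpow_add_apply)
  show ?thesis
  proof (rule big_graded_ring.intro)
    fix \<sigma> \<tau> \<rho> n m a a' b
    assume *: "\<sigma> \<in> J" "\<tau> \<in> J" "\<rho> \<in> J" "a \<in> carrier (cpt diag \<sigma> \<tau> n)"
      "a' \<in> carrier (cpt diag \<sigma> \<tau> n)" "b \<in> carrier (cpt diag \<tau> \<rho> m)"
    then have "(\<lambda>a. Shm m (twist_arr m n \<sigma> a) \<cdot> b) \<in> hom (Hom D \<tau> (Sh n ((T0 ^^ n) \<sigma>)))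
      (Hom D \<rho> (Sh (n + m) ((T0 ^^ (n + m)) \<sigma>)))"
      using hom_compose[OF sthom[of \<sigma> \<tau> m n] comp_hom_right[of b \<rho> "Sh m ((T0 ^^ m) \<tau>)" "Sh (n + m) ((T0 ^^ (n + m)) \<sigma>)"]]
        arr_shift_twist obj shift.functor_obj twist.functor_obj by (simp add: o_def)
    from hom_mult[OF this] show "mul diag \<sigma> \<tau> \<rho> n m (a \<otimes>\<^bsub>cpt diag \<sigma> \<tau> n\<^esub> a') b =
        mul diag \<sigma> \<tau> \<rho> n m a b \<otimes>\<^bsub>cpt diag \<sigma> \<rho> (n + m)\<^esub>
        mul diag \<sigma> \<tau> \<rho> n m a' b"
      using * by simp
  next
    fix \<sigma> \<tau> \<rho> n m a b b'
    assume *: "\<sigma> \<in> J" "\<tau> \<in> J" "\<rho> \<in> J" "a \<in> carrier (cpt diag \<sigma> \<tau> n)"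
      "b \<in> carrier (cpt diag \<tau> \<rho> m)" "b' \<in> carrier (cpt diag \<tau> \<rho> m)"
    then show "mul diag \<sigma> \<tau> \<rho> n m a (b \<otimes>\<^bsub>cpt diag \<tau> \<rho> m\<^esub> b') =
        mul diag \<sigma> \<tau> \<rho> n m a b \<otimes>\<^bsub>cpt diag \<sigma> \<rho> (n + m)\<^esub>
        mul diag \<sigma> \<tau> \<rho> n m a b'"
      using hom_mult[OF comp_hom_left[OF stw[of \<sigma> a \<tau> n m]], of \<rho> b b'] arr_shift_twist obj by simp
  next
    fix \<sigma> \<tau> \<rho> \<upsilon> n m k a b c
    assume *: "\<sigma> \<in> J" "\<tau> \<in> J" "\<rho> \<in> J" "\<upsilon> \<in> J" "a \<in> carrier (cpt diag \<sigma> \<tau> n)"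
      "b \<in> carrier (cpt diag \<tau> \<rho> m)" "c \<in> carrier (cpt diag \<rho> \<upsilon> k)"
    have a: "arr a \<tau> (Sh n ((T0 ^^ n) \<sigma>))" and b: "arr b \<rho> (Sh m ((T0 ^^ m) \<tau>))"
      and c: "arr c \<upsilon> (Sh k ((T0 ^^ k) \<rho>))"
      using * arr_shift_twist obj by auto
    have sa: "arr (Shm (m + k) (twist_arr (m + k) n \<sigma> a)) (Sh k (Sh m ((T0 ^^ (m + k)) \<tau>)))
        (Sh (n + (m + k)) ((T0 ^^ (n + (m + k))) \<sigma>))"
      using stw[OF obj[OF *(1)] a, of "m + k"] by (simp add: funpow_add_apply)
    have sa': "arr (Shm m (twist_arr (m + k) n \<sigma> a)) (Sh m ((T0 ^^ (m + k)) \<tau>))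
        (Sh (n + m) ((T0 ^^ (n + (m + k))) \<sigma>))"
      using shift.functor_arr[OF twist_arr_arr[OF obj[OF *(1)] a, of "m + k"], of m] by (simp add: funpow_add_apply)
    note tb = twist_arr_arr[OF obj[OF *(2)] b, of k]
    show "mul diag \<sigma> \<rho> \<upsilon> (n + m) k (mul diag \<sigma> \<tau> \<rho> n m a b) c =
        mul diag \<sigma> \<tau> \<upsilon> n (m + k) a (mul diag \<tau> \<rho> \<upsilon> m k b c)"
      using twist_arr_comp[OF obj[OF *(1)] obj[OF *(2)] a b, of k] shift.functor_comp[OF tb sa', of k]
        comp_assoc[OF c shift.functor_arr[OF tb, of k] sa]
      by (simp add: funpow_add_apply)
  next
    fix \<sigma> \<tau> n a assume *: "\<sigma> \<in> J" "\<tau> \<in> J" "a \<in> carrier (cpt diag \<sigma> \<tau> n)"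
    have a: "arr a \<tau> (Sh n ((T0 ^^ n) \<sigma>))" using * arr_shift_twist obj by auto
    have Z: "(T0 ^^ n) \<sigma> \<in> Obj D" using obj * twist.functor_obj by blast
    have "twist_arr n 0 \<sigma> (idm D \<sigma>) = idm D ((T0 ^^ n) \<sigma>)"
    proof -
      \<comment> \<open>With no shifts to pass, the comparison isomorphism is an identity; this
        gives the left unit law.\<close>
      have "tss n 0 \<sigma> = idm D ((T0 ^^ n) \<sigma>)"
      proof (induction n)
        case (Suc n)
        have "(T0 ^^ n) \<sigma> \<in> Obj D" using obj * twist.functor_obj by blast
        then show ?case using Suc functor_id functor_obj comp_id_left[OF arr_id] by simp
      qed simp
      then show ?thesis
        using twist.functor_id[OF obj[OF *(1)]] comp_id_left[OF arr_id[OF Z]] by (simp add: twist_arr_def)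
    qed
    then show "mul diag \<sigma> \<sigma> \<tau> 0 n (unt diag \<sigma>) a = a"
      using shift.functor_id[OF Z, of n] comp_id_left[OF a] by simp
    show "mul diag \<sigma> \<tau> \<tau> n 0 a (unt diag \<tau>) = a"
      using comp_id_left[OF a] comp_id_right[OF a] by (simp add: twist_arr_def)
  next
    fix \<sigma> \<tau> \<rho> n m a b
    assume *: "\<sigma> \<in> J" "\<tau> \<in> J" "\<rho> \<in> J" "a \<in> carrier (cpt diag \<sigma> \<tau> n)"
      "b \<in> carrier (cpt diag \<tau> \<rho> m)"
    then show "mul diag \<sigma> \<tau> \<rho> n m a b \<in> carrier (cpt diag \<sigma> \<rho> (n + m))"
      using arr_hom[OF arr_comp[OF _ stw[of \<sigma> a \<tau> n m]], of b \<rho>] arr_shift_twist obj by simp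
  qed (use obj hom_group shift.functor_obj twist.functor_obj id_closed in auto)
qed

end

section \<open>Extensions in triangulated categories\<close>

text \<open>The operation usually written \<open>P * Q\<close>, with the subobject taken from
  \<open>P\<close> and the quotient from \<open>Q\<close>.\<close>

definition extensions ::
    "('o, 'm, 'r) triangulated_data_scheme \<Rightarrow> 'o set \<Rightarrow> 'o set \<Rightarrow> 'o set" where
  "extensions D P Q = {Y. \<exists>X \<in> P. \<exists>Z \<in> Q. \<exists>f g h. (X, Y, Z, f, g, h) \<in> dist D}"

lemma extensionsI: "\<lbrakk>(X, Y, Z, f, g, h) \<in> dist D; X \<in> P; Z \<in> Q\<rbrakk> \<Longrightarrow> Y \<in> extensions D P Q"
  unfolding extensions_def by blast

lemma extensions_mono: "P \<subseteq> P' \<Longrightarrow> Q \<subseteq> Q' \<Longrightarrow> extensions D P Q \<subseteq> extensions D P' Q'"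
  unfolding extensions_def by blast

lemma closed_under_extensions_iff:
  "closed_under_extensions D S \<longleftrightarrow> S \<subseteq> Obj D \<and> extensions D S S \<subseteq> S"
  unfolding closed_under_extensions_def extensions_def by blast

section \<open>Exactness, rotation and shifts of triangles\<close>

context triangulated_category
begin

lemmas shift_obj = shift.functor_obj[of _ 1, simplified]
  and shift_arr = shift.functor_arr[of _ _ _ 1, simplified]
  and shift_comp = shift.functor_comp[of _ _ _ _ _ 1, simplified]
  and shift_id = shift.functor_id[of _ 1, simplified]
  and shift_zero = shift.functor_zero[of _ _ 1, simplified]
  and shift_inv = shift.functor_inv[of _ _ _ 1, simplified]
  and shift_faithful = shift.functor_faithful[of _ _ _ _ 1, simplified]

lemma shift_full:
  assumes "X \<in> Obj D" "Y \<in> Obj D" "arr g (sh0 D X) (sh0 D Y)"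
  obtains f where "arr f X Y" "sh1 D f = g"
  using shift.functor_full[of X Y g 1] assms by auto

text \<open>Rotation puts the negative of a shifted map at the end of a triangle. This recovers a
  map from such an end, so that \<open>rotate_back\<close> applies.\<close>

lemma shift_full_inv:
  assumes "X \<in> Obj D" "Y \<in> Obj D" "arr g (sh0 D X) (sh0 D Y)"
  obtains f where "arr f X Y" "inv\<^bsub>Hom D (sh0 D X) (sh0 D Y)\<^esub> (sh1 D f) = g"
proof -
  obtain f where "arr f X Y" "sh1 D f = inv\<^bsub>Hom D (sh0 D X) (sh0 D Y)\<^esub> g"
    using shift_full[OF assms(1,2) arr_inv[OF assms(3)]] .
  then show ?thesis
    using that[of f] group.inv_inv[OF hom_is_group[OF arr_obj[OF assms(3)]]] arr_hom[OF assms(3)] by simp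
qed

lemma dist_arr:
  assumes "(X, Y, Z, f, g, h) \<in> dist D"
  shows "X \<in> Obj D" "Y \<in> Obj D" "Z \<in> Obj D" "arr f X Y" "arr g Y Z" "arr h Z (sh0 D X)"
  using dist_typed[OF assms] shift_obj by (auto simp: arr_def)

lemma rotate:
  assumes "(X, Y, Z, f, g, h) \<in> dist D"
  shows "(Y, Z, sh0 D X, g, h, inv\<^bsub>Hom D (sh0 D X) (sh0 D Y)\<^esub> (sh1 D f)) \<in> dist D"
  using TR2[of X Y Z f g h] dist_arr[OF assms] assms by (simp add: arr_def)

lemma rotate_back:
  assumes "arr f X Y" "arr g Y Z" "arr h Z (sh0 D X)"
    "(Y, Z, sh0 D X, g, h, inv\<^bsub>Hom D (sh0 D X) (sh0 D Y)\<^esub> (sh1 D f)) \<in> dist D"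
  shows "(X, Y, Z, f, g, h) \<in> dist D"
  using TR2[of X Y Z f g h] assms by (simp add: arr_def)

lemma is_zero_object_iff: "is_zero_object D N \<longleftrightarrow> N \<in> Obj D \<and> idm D N = zero_arr N N"
proof
  assume "is_zero_object D N"
  then show "N \<in> Obj D \<and> idm D N = zero_arr N N"
    using id_closed unfolding is_zero_object_def by blast
next
  assume N: "N \<in> Obj D \<and> idm D N = zero_arr N N"
  show "is_zero_object D N"
    unfolding is_zero_object_def
  proof (intro conjI ballI equalityI subsetI)
    fix Y f assume Y: "Y \<in> Obj D"
    show "f \<in> {zero_arr N Y}" if "f \<in> carrier (Hom D N Y)"
      using comp_id_right[OF arrI[OF _ Y that]] comp_zero_right[OF arrI[OF _ Y that], of N] N by simp
    show "f \<in> {zero_arr Y N}" if "f \<in> carrier (Hom D Y N)"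
      using comp_id_left[OF arrI[OF Y _ that]] comp_zero_left[OF arrI[OF Y _ that], of N] N by simp
  qed (use N arr_hom[OF arr_zero] in auto)
qed

lemma zero_object_obj: "is_zero_object D N \<Longrightarrow> N \<in> Obj D"
  by (simp add: is_zero_object_def)

lemma arr_from_zero: "is_zero_object D N \<Longrightarrow> arr f N Y \<Longrightarrow> f = zero_arr N Y"
  and arr_to_zero: "is_zero_object D N \<Longrightarrow> arr f Y N \<Longrightarrow> f = zero_arr Y N"
  unfolding is_zero_object_def arr_def by blast+

lemma direct_sum_Nil:
  assumes "is_direct_sum D N []"
  shows "is_zero_object D N"
proof -
  have N: "N \<in> Obj D" using assms unfolding is_direct_sum_def by blast
  interpret comm_group "Hom D N N" using hom_group N by blast
  have "idm D N = zero_arr N N"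
    using assms unfolding is_direct_sum_def by (elim conjE exE) simp
  then show ?thesis using is_zero_object_iff N by blast
qed

lemma ex_zero_object: "\<exists>N. is_zero_object D N"
  using ex_direct_sum[of "[]"] direct_sum_Nil by auto

lemma shift_zero_object: "is_zero_object D N \<Longrightarrow> is_zero_object D (sh0 D N)"
  unfolding is_zero_object_iff using shift_id shift_zero shift_obj by metis

text \<open>\<open>TR3\<close> for the pair \<open>idm D X\<close>, \<open>f\<close> maps the
  trivial triangle on \<open>X\<close> to the given one, and so factors \<open>g f\<close> through a
  zero object.\<close>

lemma dist_comp_zero:
  assumes d: "(X, Y, Z, f, g, h) \<in> dist D"
  shows "g \<cdot> f = zero_arr X Z"
proof -
  note a = dist_arr[OF d]
  obtain N where N: "is_zero_object D N" using ex_zero_object by blast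
  obtain c where c: "c \<in> carrier (Hom D N Z)" "c \<cdot> zero_arr X N = g \<cdot> f"
    using TR3[OF TR1_id[OF a(1) N] d id_closed[OF a(1)] arr_hom[OF a(4)]] by blast
  then show ?thesis
    using comp_zero_right[OF arrI[OF zero_object_obj[OF N] a(3) c(1)] a(1)] by simp
qed

lemma dist_zero_first:
  assumes "is_zero_object D N" "X \<in> Obj D"
  shows "(N, X, X, zero_arr N X, idm D X, zero_arr X (sh0 D N)) \<in> dist D"
proof (rule rotate_back)
  note N = zero_object_obj[OF assms(1)] and sN = zero_object_obj[OF shift_zero_object[OF assms(1)]]
  show "arr (zero_arr N X) N X" "arr (zero_arr X (sh0 D N)) X (sh0 D N)" "arr (idm D X) X X"
    using arr_zero arr_id N sN assms(2) by auto
  have "inv\<^bsub>Hom D (sh0 D N) (sh0 D X)\<^esub> sh1 D (zero_arr N X) = zero_arr (sh0 D N) (sh0 D X)"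
    using arr_from_zero[OF shift_zero_object[OF assms(1)] arr_inv[OF shift_arr[OF arr_zero[OF N assms(2)]]]] .
  then show "(X, X, sh0 D N, idm D X, zero_arr X (sh0 D N),
      inv\<^bsub>Hom D (sh0 D N) (sh0 D X)\<^esub> sh1 D (zero_arr N X)) \<in> dist D"
    using TR1_id[OF assms(2) shift_zero_object[OF assms(1)]] by simp
qed

text \<open>Exactness of \<open>Hom(-, U)\<close> at \<open>Y\<close>: \<open>TR3\<close> completes
  a map from the given triangle to the one with \<open>U\<close> as second and third vertex and a
  zero object in front.\<close>

lemma dist_extend:
  assumes d: "(X, Y, Z, f, g, h) \<in> dist D" and u: "arr u Y U" "u \<cdot> f = zero_arr X U"
  obtains v where "arr v Z U" "v \<cdot> g = u"
proof -
  note a = dist_arr[OF d] and U = arr_obj(2)[OF u(1)]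
  obtain N where N: "is_zero_object D N" using ex_zero_object by blast
  note N' = zero_object_obj[OF N]
  have "u \<cdot> f = zero_arr N U \<cdot> zero_arr X N"
    using u(2) comp_zero_right[OF arr_zero[OF N' U] a(1)] by simp
  then obtain c where c: "c \<in> carrier (Hom D Z U)" "c \<cdot> g = idm D U \<cdot> u"
    using TR3[OF d dist_zero_first[OF N U] arr_hom[OF arr_zero[OF a(1) N']] arr_hom[OF u(1)]] by blast
  then show ?thesis
    using that[OF arrI[OF a(3) U]] comp_id_left[OF u(1)] by simp
qed

text \<open>Exactness of \<open>Hom(U, -)\<close> at \<open>Y\<close>. \<open>TR3\<close> completes
  third maps only, so both triangles are rotated first; this produces \<open>v\<close> in shifted
  form, and the two signs cancel.\<close>

lemma dist_lift:
  assumes d: "(X, Y, Z, f, g, h) \<in> dist D" and u: "arr u U Y" "g \<cdot> u = zero_arr U Z"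
  obtains v where "arr v U X" "f \<cdot> v = u"
proof -
  note a = dist_arr[OF d] and U = arr_obj(1)[OF u(1)]
  obtain N where N: "is_zero_object D N" using ex_zero_object by blast
  note N' = zero_object_obj[OF N]
  have "zero_arr N Z \<cdot> zero_arr U N = g \<cdot> u"
    using u(2) comp_zero_right[OF arr_zero[OF N' a(3)] U] by simp
  then obtain c where c: "c \<in> carrier (Hom D (sh0 D U) (sh0 D X))"
    "sh1 D u \<cdot> inv\<^bsub>Hom D (sh0 D U) (sh0 D U)\<^esub> (sh1 D (idm D U)) =
      inv\<^bsub>Hom D (sh0 D X) (sh0 D Y)\<^esub> (sh1 D f) \<cdot> c"
    using TR3[OF rotate[OF TR1_id[OF U N]] rotate[OF d] arr_hom[OF u(1)] arr_hom[OF arr_zero[OF N' a(3)]]] by blast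
  obtain v where v: "arr v U X" "sh1 D v = c"
    using shift_full[OF U a(1) arrI[OF shift_obj[OF U] shift_obj[OF a(1)] c(1)]] .
  have "inv\<^bsub>Hom D (sh0 D U) (sh0 D Y)\<^esub> (sh1 D u) = inv\<^bsub>Hom D (sh0 D U) (sh0 D Y)\<^esub> (sh1 D (f \<cdot> v))"
    using c(2) comp_inv_right[OF shift_arr[OF arr_id[OF U]] shift_arr[OF u(1)]]
      comp_inv_left[OF shift_arr[OF v(1)] shift_arr[OF a(4)]] shift_comp[OF arr_id[OF U] u(1)]
      comp_id_right[OF u(1)] shift_comp[OF v(1) a(4)] v(2) by simp
  then have "sh1 D u = sh1 D (f \<cdot> v)"
    using group.inv_inj[OF hom_is_group[OF shift_obj[OF U] shift_obj[OF a(2)]]]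
      arr_hom[OF shift_arr[OF u(1)]] arr_hom[OF shift_arr[OF arr_comp[OF v(1) a(4)]]]
    by (auto simp: inj_on_def)
  then show ?thesis
    using that[OF v(1)] shift_faithful[OF u(1) arr_comp[OF v(1) a(4)]] by simp
qed

text \<open>Rotating three times shifts a triangle and changes the signs of its maps. The
  disjunction covers both parities of \<open>n\<close> without tracking them, and the third map is
  left open.\<close>

lemma shift_dist:
  assumes d: "(X, Y, Z, f, g, h) \<in> dist D"
  shows "\<exists>h'. (Sh n X, Sh n Y, Sh n Z, Shm n f, Shm n g, h') \<in> dist D \<or>
    (Sh n X, Sh n Y, Sh n Z,
      inv\<^bsub>Hom D (Sh n X) (Sh n Y)\<^esub> Shm n f,
      inv\<^bsub>Hom D (Sh n Y) (Sh n Z)\<^esub> Shm n g, h') \<in> dist D"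
proof (induction n)
  case 0
  then show ?case using d by auto
next
  case (Suc n)
  note a = dist_arr[OF d]
  note f = shift.functor_arr[OF a(4), of n] and g = shift.functor_arr[OF a(5), of n]
  have ii: "inv\<^bsub>Hom D (sh0 D U) (sh0 D V)\<^esub> sh1 D (inv\<^bsub>Hom D U V\<^esub> k) = sh1 D k" if "arr k U V" for k U V
    using shift_inv[OF that] group.inv_inv[OF hom_is_group[OF arr_obj[OF shift_arr[OF that]]] arr_hom[OF shift_arr[OF that]]] by simp
  from Suc obtain h' where "(Sh n X, Sh n Y, Sh n Z, Shm n f, Shm n g, h') \<in> dist D \<or>
    (Sh n X, Sh n Y, Sh n Z,
      inv\<^bsub>Hom D (Sh n X) (Sh n Y)\<^esub> Shm n f,
      inv\<^bsub>Hom D (Sh n Y) (Sh n Z)\<^esub> Shm n g, h') \<in> dist D" by blast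
  then show ?case
  proof
    assume "(Sh n X, Sh n Y, Sh n Z, Shm n f, Shm n g, h') \<in> dist D"
    from rotate[OF rotate[OF rotate[OF this]]] show ?thesis by auto
  next
    assume "(Sh n X, Sh n Y, Sh n Z,
      inv\<^bsub>Hom D (Sh n X) (Sh n Y)\<^esub> Shm n f,
      inv\<^bsub>Hom D (Sh n Y) (Sh n Z)\<^esub> Shm n g, h') \<in> dist D"
    from rotate[OF rotate[OF rotate[OF this]]] show ?thesis using ii[OF f] ii[OF g] by auto
  qed
qed

text \<open>If the shifted triangle carries negative signs, the sign of \<open>f\<close> is moved
  onto the lift \<open>v\<close>.\<close>

lemma dist_lift_shift:
  assumes d: "(X, Y, Z, f, g, h) \<in> dist D"
    and u: "arr u U (Sh n Y)" "Shm n g \<cdot> u = zero_arr U (Sh n Z)"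
  obtains v where "arr v U (Sh n X)" "Shm n f \<cdot> v = u"
proof -
  note a = dist_arr[OF d]
  note f = shift.functor_arr[OF a(4), of n] and g = shift.functor_arr[OF a(5), of n]
  obtain h' where "(Sh n X, Sh n Y, Sh n Z, Shm n f, Shm n g, h') \<in> dist D \<or>
    (Sh n X, Sh n Y, Sh n Z,
      inv\<^bsub>Hom D (Sh n X) (Sh n Y)\<^esub> Shm n f,
      inv\<^bsub>Hom D (Sh n Y) (Sh n Z)\<^esub> Shm n g, h') \<in> dist D"
    using shift_dist[OF d] by blast
  then show ?thesis
  proof
    assume "(Sh n X, Sh n Y, Sh n Z, Shm n f, Shm n g, h') \<in> dist D"
    from dist_lift[OF this u] show ?thesis using that .
  next
    assume *: "(Sh n X, Sh n Y, Sh n Z,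
      inv\<^bsub>Hom D (Sh n X) (Sh n Y)\<^esub> Shm n f,
      inv\<^bsub>Hom D (Sh n Y) (Sh n Z)\<^esub> Shm n g, h') \<in> dist D"
    have "inv\<^bsub>Hom D (Sh n Y) (Sh n Z)\<^esub> Shm n g \<cdot> u = zero_arr U (Sh n Z)"
      using comp_inv_left[OF u(1) g] u(2) group.is_monoid[OF hom_is_group[OF arr_obj(1)[OF u(1)] arr_obj(2)[OF g]]]
      by (simp add: monoid.inv_one)
    from dist_lift[OF * u(1) this] obtain v where v: "arr v U (Sh n X)"
      "inv\<^bsub>Hom D (Sh n X) (Sh n Y)\<^esub> Shm n f \<cdot> v = u" .
    then have "Shm n f \<cdot> inv\<^bsub>Hom D U (Sh n X)\<^esub> v = u"
      using comp_inv_left[OF v(1) f] comp_inv_right[OF v(1) f] by simp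
    then show ?thesis using that[OF arr_inv[OF v(1)]] by blast
  qed
qed

lemma dist_iso_first:
  assumes "X \<in> Obj D" "Y \<in> Obj D" "is_iso D X Y f" "is_zero_object D N"
  shows "(X, Y, N, f, zero_arr Y N, zero_arr N (sh0 D X)) \<in> dist D"
proof -
  note N = zero_object_obj[OF assms(4)]
  have f: "arr f X Y" using is_iso_iff assms by blast
  show ?thesis
  proof (rule TR1_iso[OF TR1_id[OF assms(1,4)] assms(1,2) N, of _ _ _ "idm D X" f "idm D N"])
    show "idm D N \<cdot> zero_arr X N = zero_arr Y N \<cdot> f"
      using comp_zero_left[OF f N] comp_id_left[OF arr_zero[OF assms(1) N]] by simp
    show "sh1 D (idm D X) \<cdot> zero_arr N (sh0 D X) = zero_arr N (sh0 D X) \<cdot> idm D N"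
      using comp_id_right[OF arr_zero[OF N shift_obj[OF assms(1)]]] comp_id_left[OF arr_zero[OF N shift_obj[OF assms(1)]]]
        shift_id[OF assms(1)] by simp
  qed (use f N assms arr_zero shift_obj is_iso_id in \<open>auto simp: arr_def\<close>)
qed

text \<open>The shift is an autoequivalence, so the cone of \<open>g\<close> is a shift only up to
  isomorphism; the triangle is transported along one before it is rotated back.\<close>

lemma complete_second:
  assumes g: "arr g Y Z"
  shows "\<exists>X f h. (X, Y, Z, f, g, h) \<in> dist D"
proof -
  note o = arr_obj[OF g]
  obtain E b c where d: "(Y, Z, E, g, b, c) \<in> dist D" using TR1_complete[OF o arr_hom[OF g]] by blast
  note a = dist_arr[OF d]
  obtain X where X: "X \<in> Obj D" "isomorphic D (sh0 D X) E"
    using shift.essentially_surjective[OF a(3), of 1] by auto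
  note sX = shift_obj[OF X(1)]
  obtain s where s: "is_iso D E (sh0 D X) s"
    using isomorphic_sym[OF sX a(3) X(2)] unfolding isomorphic_def by blast
  obtain t where t: "arr s E (sh0 D X)" "arr t (sh0 D X) E" "t \<cdot> s = idm D E"
    using s is_iso_iff[OF a(3) sX] by blast
  have d': "(Y, Z, sh0 D X, g, s \<cdot> b, c \<cdot> t) \<in> dist D"
  proof (rule TR1_iso[OF d o sX, of _ _ _ "idm D Y" "idm D Z" s])
    show "idm D Z \<cdot> g = g \<cdot> idm D Y" using comp_id_left[OF g] comp_id_right[OF g] by simp
    show "s \<cdot> b = (s \<cdot> b) \<cdot> idm D Z" using comp_id_right[OF arr_comp[OF a(5) t(1)]] by simp
    show "sh1 D (idm D Y) \<cdot> c = (c \<cdot> t) \<cdot> s"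
      using comp_assoc[OF t(1,2) a(6)] t(3) comp_id_right[OF a(6)] shift_id[OF o(1)] comp_id_left[OF a(6)] by simp
  qed (use g s o is_iso_id arr_comp[OF a(5) t(1)] arr_comp[OF t(2) a(6)] in \<open>auto simp: arr_def\<close>)
  obtain f where f: "arr f X Y" "inv\<^bsub>Hom D (sh0 D X) (sh0 D Y)\<^esub> (sh1 D f) = c \<cdot> t"
    using shift_full_inv[OF X(1) o(1) arr_comp[OF t(2) a(6)]] .
  show ?thesis
    using rotate_back[OF f(1) g arr_comp[OF a(5) t(1)]] d' f(2) by auto
qed

lemma complete_third:
  assumes h: "arr h Z (sh0 D X)" and X: "X \<in> Obj D"
  shows "\<exists>Y f g. (X, Y, Z, f, g, h) \<in> dist D"
proof -
  obtain Y g k where d: "(Y, Z, sh0 D X, g, h, k) \<in> dist D" using complete_second[OF h] by blast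
  note a = dist_arr[OF d]
  obtain f where f: "arr f X Y" "inv\<^bsub>Hom D (sh0 D X) (sh0 D Y)\<^esub> (sh1 D f) = k"
    using shift_full_inv[OF X a(1) a(6)] .
  show ?thesis
    using rotate_back[OF f(1) a(4) h] d f(2) by auto
qed

text \<open>Undoes three rotations, each map being written as the negative of a shifted one.\<close>

lemma unshift_dist:
  assumes XYZ: "X \<in> Obj D" "Y \<in> Obj D" "Z \<in> Obj D"
    and d: "(sh0 D X, sh0 D Y, sh0 D Z, u, v, w) \<in> dist D"
  shows "\<exists>f g h. (X, Y, Z, f, g, h) \<in> dist D"
proof -
  note a = dist_arr[OF d]
  obtain f where f: "arr f X Y" "inv\<^bsub>Hom D (sh0 D X) (sh0 D Y)\<^esub> (sh1 D f) = u"
    using shift_full_inv[OF XYZ(1,2) a(4)] .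
  obtain g where g: "arr g Y Z" "inv\<^bsub>Hom D (sh0 D Y) (sh0 D Z)\<^esub> (sh1 D g) = v"
    using shift_full_inv[OF XYZ(2,3) a(5)] .
  obtain h where h: "arr h Z (sh0 D X)" "inv\<^bsub>Hom D (sh0 D Z) (sh0 D (sh0 D X))\<^esub> (sh1 D h) = w"
    using shift_full_inv[OF XYZ(3) shift_obj[OF XYZ(1)] a(6)] .
  have "(Z, sh0 D X, sh0 D Y, h, u, v) \<in> dist D"
    using rotate_back[OF h(1) a(4,5)] d h(2) by simp
  then have "(Y, Z, sh0 D X, g, h, u) \<in> dist D"
    using rotate_back[OF g(1) h(1) a(4)] g(2) by simp
  then have "(X, Y, Z, f, g, h) \<in> dist D"
    using rotate_back[OF f(1) g(1) h(1)] f(2) by simp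
  then show ?thesis by blast
qed

section \<open>Extension products of classes of objects\<close>

lemma extensions_obj: "extensions D P Q \<subseteq> Obj D"
  unfolding extensions_def using dist_arr by blast

text \<open>The octahedral axiom for \<open>g f\<close>: the cone of
  \<open>A \<rightarrow> X\<close> is an extension of \<open>C\<close> by \<open>B\<close>.\<close>

lemma extensions_assoc_subset:
  "extensions D (extensions D P Q) R \<subseteq> extensions D P (extensions D Q R)"
proof
  fix X assume "X \<in> extensions D (extensions D P Q) R"
  then obtain A K B C f a b g c d where ABC: "A \<in> P" "B \<in> Q" "C \<in> R"
    and 1: "(A, K, B, f, a, b) \<in> dist D" and 2: "(K, X, C, g, c, d) \<in> dist D"
    unfolding extensions_def by blast
  have gf: "arr (g \<cdot> f) A X" using arr_comp dist_arr(4)[OF 1] dist_arr(4)[OF 2] by blast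
  obtain Y p q where 3: "(A, X, Y, g \<cdot> f, p, q) \<in> dist D"
    using TR1_complete[OF arr_obj[OF gf] arr_hom[OF gf]] by blast
  obtain u v where "(B, Y, C, u, v, sh1 D a \<cdot> d) \<in> dist D" using TR4[OF 1 2 3] by blast
  then show "X \<in> extensions D P (extensions D Q R)" using ABC 3 by (meson extensionsI)
qed

text \<open>The octahedral axiom for \<open>q p\<close>. Here fibres are compared instead of cones,
  so the triangles are rotated first and the triangle on \<open>A\<close>, \<open>K\<close>,
  \<open>B\<close> comes out shifted by one.\<close>

lemma extensions_assoc_supset:
  "extensions D P (extensions D Q R) \<subseteq> extensions D (extensions D P Q) R"
proof
  fix X assume "X \<in> extensions D P (extensions D Q R)"
  then obtain A Y B C f p h i q d where ABC: "A \<in> P" "B \<in> Q" "C \<in> R"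
    and 1: "(A, X, Y, f, p, h) \<in> dist D" and 2: "(B, Y, C, i, q, d) \<in> dist D"
    unfolding extensions_def by blast
  have qp: "arr (q \<cdot> p) X C" using arr_comp dist_arr(5)[OF 1] dist_arr(5)[OF 2] by blast
  obtain K k r where 3: "(K, X, C, k, q \<cdot> p, r) \<in> dist D"
    using complete_second[OF qp] by blast
  obtain u v w where "(sh0 D A, sh0 D K, sh0 D B, u, v, w) \<in> dist D"
    using TR4[OF rotate[OF 1] rotate[OF 2] rotate[OF 3]] by blast
  then obtain f' g' h' where "(A, K, B, f', g', h') \<in> dist D"
    using unshift_dist dist_arr(1)[OF 1] dist_arr(1)[OF 2] dist_arr(1)[OF 3] by blast
  then show "X \<in> extensions D (extensions D P Q) R" using ABC 3 by (meson extensionsI)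
qed

definition orth where
  "orth X Y \<longleftrightarrow> (\<forall>f. arr f X Y \<longrightarrow> f = zero_arr X Y)"

lemma orth_extension_left:
  assumes d: "(X, Y, Z, f, g, h) \<in> dist D" and "orth X U" "orth Z U" and U: "U \<in> Obj D"
  shows "orth Y U"
  unfolding orth_def
proof (intro allI impI)
  note a = dist_arr[OF d]
  fix u assume u: "arr u Y U"
  have "u \<cdot> f = zero_arr X U" using arr_comp[OF a(4) u] assms(2) unfolding orth_def by blast
  then obtain v where v: "arr v Z U" "v \<cdot> g = u" using dist_extend[OF d u] by blast
  then have "v = zero_arr Z U" using assms(3) unfolding orth_def by blast
  then show "u = zero_arr Y U" using v(2) comp_zero_left[OF a(5) U] by simp
qed

lemma orth_extension_right:
  assumes d: "(X, Y, Z, f, g, h) \<in> dist D" and "orth U (Sh n X)" "orth U (Sh n Z)"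
  shows "orth U (Sh n Y)"
  unfolding orth_def
proof (intro allI impI)
  note a = dist_arr[OF d]
  fix u assume u: "arr u U (Sh n Y)"
  have "Shm n g \<cdot> u = zero_arr U (Sh n Z)"
    using arr_comp[OF u shift.functor_arr[OF a(5)]] assms(3) unfolding orth_def by blast
  then obtain v where v: "arr v U (Sh n X)" "Shm n f \<cdot> v = u" using dist_lift_shift[OF d u] by blast
  then have "v = zero_arr U (Sh n X)" using assms(2) unfolding orth_def by blast
  then show "u = zero_arr U (Sh n Y)"
    using v(2) comp_zero_right[OF shift.functor_arr[OF a(4)] arr_obj(1)[OF u]] by simp
qed

text \<open>Once it contains the zero objects, a class closed under extensions is also closed under
  isomorphisms, and \<open>P\<close> and \<open>Q\<close> both embed into
  \<open>extensions D P Q\<close>.\<close>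

definition ext_closed_with_zero where
  "ext_closed_with_zero P \<longleftrightarrow> closed_under_extensions D P \<and> (\<forall>N. is_zero_object D N \<longrightarrow> N \<in> P)"

lemma ext_closed_iso:
  assumes "ext_closed_with_zero P" "X \<in> P" "Y \<in> Obj D" "isomorphic D X Y"
  shows "Y \<in> P"
proof -
  obtain f where f: "is_iso D X Y f" using assms(4) unfolding isomorphic_def by blast
  obtain N where N: "is_zero_object D N" using ex_zero_object by blast
  have "X \<in> Obj D" using assms(1,2) unfolding ext_closed_with_zero_def closed_under_extensions_def by blast
  from dist_iso_first[OF this assms(3) f N] show ?thesis
    using assms(1,2) N unfolding ext_closed_with_zero_def closed_under_extensions_def by blast
qed

text \<open>The extension splits, so that its two ends can be interchanged.\<close>

lemma extensions_swap:
  assumes Q: "ext_closed_with_zero Q"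
    and PQ: "\<And>X Y. X \<in> P \<Longrightarrow> Y \<in> Q \<Longrightarrow> orth X (sh0 D Y)"
  shows "extensions D Q P \<subseteq> extensions D P Q"
proof
  fix X assume "X \<in> extensions D Q P"
  then obtain B A f g h where AB: "A \<in> P" "B \<in> Q" and d: "(B, X, A, f, g, h) \<in> dist D"
    unfolding extensions_def by blast
  note a = dist_arr[OF d]
  have "h = zero_arr A (sh0 D B)" using PQ[OF AB] a(6) unfolding orth_def by blast
  then have "h \<cdot> idm D A = zero_arr A (sh0 D B)" using comp_id_right[OF a(6)] by simp
  then obtain s where s: "arr s A X" "g \<cdot> s = idm D A"
    using dist_lift[OF rotate[OF d] arr_id[OF a(3)]] by blast
  obtain C b c where ds: "(A, X, C, s, b, c) \<in> dist D" using TR1_complete[OF arr_obj[OF s(1)] arr_hom[OF s(1)]] by blast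
  obtain N where N: "is_zero_object D N" using ex_zero_object by blast
  \<comment> \<open>Octahedral axiom for \<open>g s = idm D A\<close>: the cone \<open>C\<close> of
    the section \<open>s\<close> is an extension of a zero object by \<open>B\<close>, hence lies in
    \<open>Q\<close>.\<close>
  obtain u v w where d2: "(C, N, sh0 D B, u, v, w) \<in> dist D"
    using TR4[OF ds rotate[OF d] TR1_id[OF a(3) N, folded s(2)]] by blast
  note a2 = dist_arr[OF d2]
  obtain w' where w': "arr w' B C" "inv\<^bsub>Hom D (sh0 D B) (sh0 D C)\<^esub> (sh1 D w') = w"
    using shift_full_inv[OF a(1) a2(1) a2(6)] .
  have "(B, C, N, w', u, v) \<in> dist D"
    using rotate_back[OF w'(1) a2(4,5)] d2 w'(2) by simp
  then have "C \<in> Q"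
    using Q AB(2) N unfolding ext_closed_with_zero_def closed_under_extensions_def by blast
  then show "X \<in> extensions D P Q" using extensionsI[OF ds AB(1)] by blast
qed

text \<open>Rebracketing turns \<open>(P * Q) * (P * Q)\<close> into \<open>P * (Q * P) * Q\<close>.
  The inner product is swapped, after which equal neighbours merge.\<close>

lemma extensions_closed:
  assumes P: "ext_closed_with_zero P" and Q: "ext_closed_with_zero Q"
    and PQ: "\<And>X Y. X \<in> P \<Longrightarrow> Y \<in> Q \<Longrightarrow> orth X (sh0 D Y)"
  shows "closed_under_extensions D (extensions D P Q)" "P \<union> Q \<subseteq> extensions D P Q"
proof -
  have PP: "extensions D P P \<subseteq> P" and QQ: "extensions D Q Q \<subseteq> Q" and o: "P \<subseteq> Obj D" "Q \<subseteq> Obj D"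
    using P Q unfolding ext_closed_with_zero_def closed_under_extensions_iff by auto
  let ?E = "extensions D"
  have "?E Q (?E P Q) \<subseteq> ?E (?E Q P) Q" by (rule extensions_assoc_supset)
  also have "\<dots> \<subseteq> ?E (?E P Q) Q" by (rule extensions_mono[OF extensions_swap[OF Q PQ] order_refl])
  also have "\<dots> \<subseteq> ?E P (?E Q Q)" by (rule extensions_assoc_subset)
  also have "\<dots> \<subseteq> ?E P Q" by (rule extensions_mono[OF order_refl QQ])
  finally have 1: "?E Q (?E P Q) \<subseteq> ?E P Q" .
  have "?E (?E P Q) (?E P Q) \<subseteq> ?E P (?E Q (?E P Q))" by (rule extensions_assoc_subset)
  also have "\<dots> \<subseteq> ?E P (?E P Q)" by (rule extensions_mono[OF order_refl 1])
  also have "\<dots> \<subseteq> ?E (?E P P) Q" by (rule extensions_assoc_supset)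
  also have "\<dots> \<subseteq> ?E P Q" by (rule extensions_mono[OF PP order_refl])
  finally show "closed_under_extensions D (?E P Q)"
    unfolding closed_under_extensions_iff using extensions_obj by blast
  obtain N where N: "is_zero_object D N" using ex_zero_object by blast
  then have NPQ: "N \<in> P" "N \<in> Q" using P Q unfolding ext_closed_with_zero_def by blast+
  show "P \<union> Q \<subseteq> ?E P Q"
  proof (intro Un_least subsetI)
    show "X \<in> ?E P Q" if "X \<in> P" for X
      using extensionsI[OF TR1_id[OF _ N] that NPQ(2)] o that by blast
    show "X \<in> ?E P Q" if "X \<in> Q" for X
      using extensionsI[OF dist_zero_first[OF N] NPQ(1) that] o that by blast
  qed
qed

text \<open>An intersection of closed classes is closed provided that it consists of objects. For
  this there has to be one closed class above \<open>S\<close>, namely that of all objects.\<close>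

lemma hull_closed_under_extensions:
  assumes "S \<subseteq> Obj D"
  shows "closed_under_extensions D (closed_under_extensions D hull S)"
proof -
  have "closed_under_extensions D (Obj D)"
    unfolding closed_under_extensions_def using dist_arr by blast
  then have "closed_under_extensions D hull S \<subseteq> Obj D" by (rule hull_minimal[OF assms])
  then show ?thesis
    unfolding closed_under_extensions_def hull_def by blast
qed

end

section \<open>The filtration by the subcategories\<close>

text \<open>The hypotheses as they hold after zero objects and isomorphic copies have been added to
  each class. In \<open>M_factor\<close> all steps of the chain but the last are composed. The name
  recalls the silly filtration of a complex, the one by its terms.\<close>

locale silly_filtration = triangulated_autoequivalence D T0 T1 \<phi>
  for D :: "('o, 'm, 'r) triangulated_data_scheme" (structure)
    and T0 :: "'o \<Rightarrow> 'o" and T1 :: "'m \<Rightarrow> 'm" and \<phi> :: "'o \<Rightarrow> 'm" +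
  fixes E :: "int \<Rightarrow> 'o set" and M :: "'o set"
  assumes E_closed: "ext_closed_with_zero (E i)"
    and E_orth: "\<lbrakk>X \<in> E i; Y \<in> E j; i \<ge> j\<rbrakk> \<Longrightarrow> orth X (sh0 D Y)"
    and twist_E: "X \<in> E i \<Longrightarrow> T0 X \<in> E (i + 1)"
    and E_twist: "Y \<in> E (i + 1) \<Longrightarrow> \<exists>X \<in> E i. isomorphic D (T0 X) Y"
    and M_closed: "ext_closed_with_zero M"
    and E_subset_M: "E i \<subseteq> M"
    and M_minimal: "closed_under_extensions D S \<Longrightarrow> (\<And>i. E i \<subseteq> S) \<Longrightarrow> M \<subseteq> S"
    and M_factor: "\<lbrakk>X \<in> M; Y \<in> M; n \<ge> 1; arr f X (Sh (Suc n) Y)\<rbrakk> \<Longrightarrow>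
      \<exists>V \<in> M. \<exists>g z. arr g X (Sh n V) \<and> arr z V (sh0 D Y) \<and> f = Shm n z \<cdot> g"
begin

lemma E_obj: "X \<in> E i \<Longrightarrow> X \<in> Obj D"
  using E_closed[of i] unfolding ext_closed_with_zero_def closed_under_extensions_def by blast

section \<open>Objects built from the slices above or below a given index\<close>

definition upper :: "int \<Rightarrow> 'o set" where
  "upper j = closed_under_extensions D hull (\<Union>k\<in>{j..}. E k)"

definition lower :: "int \<Rightarrow> 'o set" where
  "lower j = closed_under_extensions D hull (\<Union>k\<in>{..j}. E k)"

lemma upper_subset: "k \<ge> j \<Longrightarrow> E k \<subseteq> upper j"
  unfolding upper_def by (rule order_trans[OF _ hull_subset]) auto

lemma lower_subset: "k \<le> j \<Longrightarrow> E k \<subseteq> lower j"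
  unfolding lower_def by (rule order_trans[OF _ hull_subset]) auto

lemma upper_minimal: "closed_under_extensions D S \<Longrightarrow> (\<And>k. k \<ge> j \<Longrightarrow> E k \<subseteq> S) \<Longrightarrow> upper j \<subseteq> S"
  unfolding upper_def by (rule hull_minimal) auto

lemma lower_minimal: "closed_under_extensions D S \<Longrightarrow> (\<And>k. k \<le> j \<Longrightarrow> E k \<subseteq> S) \<Longrightarrow> lower j \<subseteq> S"
  unfolding lower_def by (rule hull_minimal) auto

lemma upper_closed: "ext_closed_with_zero (upper j)"
  using hull_closed_under_extensions[of "\<Union>k\<in>{j..}. E k"] E_obj upper_subset[of j j] E_closed[of j]
  unfolding ext_closed_with_zero_def upper_def by blast

lemma lower_closed: "ext_closed_with_zero (lower j)"
  using hull_closed_under_extensions[of "\<Union>k\<in>{..j}. E k"] E_obj lower_subset[of j j] E_closed[of j]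
  unfolding ext_closed_with_zero_def lower_def by blast

lemma closed_orth_left: "U \<in> Obj D \<Longrightarrow> closed_under_extensions D {V \<in> Obj D. orth V U}"
  unfolding closed_under_extensions_def using orth_extension_left dist_arr(2) by blast

lemma closed_orth_right: "closed_under_extensions D {V \<in> Obj D. orth U (Sh n V)}"
  unfolding closed_under_extensions_def using orth_extension_right dist_arr(2) by blast

text \<open>The objects without nonzero maps to \<open>Y[1]\<close> are closed under extensions and
  contain the generating slices.\<close>

lemma orth_upper:
  assumes "X \<in> upper j" "Y \<in> E k" "k \<le> j"
  shows "orth X (sh0 D Y)"
proof -
  have "upper j \<subseteq> {V \<in> Obj D. orth V (sh0 D Y)}"
    using assms E_obj E_orth shift_obj by (intro upper_minimal closed_orth_left) force+
  then show ?thesis using assms by blast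
qed

lemma orth_lower:
  assumes "V \<in> lower k" "\<And>l Y. l \<le> k \<Longrightarrow> Y \<in> E l \<Longrightarrow> orth X (Sh n Y)"
  shows "orth X (Sh n V)"
proof -
  have "lower k \<subseteq> {V \<in> Obj D. orth X (Sh n V)}"
    using assms(2) E_obj by (intro lower_minimal closed_orth_right) force
  then show ?thesis using assms by blast
qed

lemma orth_upper_lower: "\<lbrakk>X \<in> upper j; Y \<in> lower k; k \<le> j\<rbrakk> \<Longrightarrow> orth X (sh0 D Y)"
  using orth_lower[of Y k X 1] orth_upper by force

text \<open>The right side is closed under extensions by \<open>extensions_closed\<close> and
  contains every \<open>E i\<close>, so the minimality of \<open>M\<close> gives the
  inclusion.\<close>

lemma M_decompose: "M \<subseteq> extensions D (upper (j + 1)) (lower j)"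
proof (rule M_minimal)
  have "\<And>X Y. X \<in> upper (j + 1) \<Longrightarrow> Y \<in> lower j \<Longrightarrow> orth X (sh0 D Y)"
    using orth_upper_lower by force
  note * = extensions_closed[OF upper_closed[of "j + 1"] lower_closed[of j] this]
  show "closed_under_extensions D (extensions D (upper (j + 1)) (lower j))" by (rule *(1))
  fix i show "E i \<subseteq> extensions D (upper (j + 1)) (lower j)"
    using *(2) upper_subset[of "j + 1" i] lower_subset[of i j] by (cases "i \<le> j") auto
qed

text \<open>As for \<open>M_decompose\<close>, with the top slice split off as the
  subobject.\<close>

lemma lower_decompose: "lower j \<subseteq> extensions D (E j) (lower (j - 1))"
proof (rule lower_minimal)
  have "\<And>X Y. X \<in> E j \<Longrightarrow> Y \<in> lower (j - 1) \<Longrightarrow> orth X (sh0 D Y)"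
    using orth_upper_lower[of _ j _ "j - 1"] upper_subset[of j j] by auto
  note * = extensions_closed[OF E_closed[of j] lower_closed[of "j - 1"] this]
  show "closed_under_extensions D (extensions D (E j) (lower (j - 1)))" by (rule *(1))
  fix i assume "i \<le> j"
  then show "E i \<subseteq> extensions D (E j) (lower (j - 1))"
    using *(2) lower_subset[of i "j - 1"] by (cases "i = j") auto
qed

text \<open>Here the bottom slice is split off as the quotient.\<close>

lemma upper_decompose: "upper j \<subseteq> extensions D (upper (j + 1)) (E j)"
proof (rule upper_minimal)
  have "\<And>X Y. X \<in> upper (j + 1) \<Longrightarrow> Y \<in> E j \<Longrightarrow> orth X (sh0 D Y)"
    using orth_upper by force
  note * = extensions_closed[OF upper_closed[of "j + 1"] E_closed[of j] this]
  show "closed_under_extensions D (extensions D (upper (j + 1)) (E j))" by (rule *(1))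
  fix i assume "i \<ge> j"
  then show "E i \<subseteq> extensions D (upper (j + 1)) (E j)"
    using *(2) upper_subset[of "j + 1" i] by (cases "i = j") auto
qed

lemma factor_through_lower:
  assumes "V \<in> M" "Y \<in> E (j + 1)" "arr z V (sh0 D Y)"
  obtains U p z' where "U \<in> lower j" "arr p V U" "arr z' U (sh0 D Y)" "z = z' \<cdot> p"
proof -
  obtain V' U s p d where V': "V' \<in> upper (j + 1)" and U: "U \<in> lower j" and dist: "(V', V, U, s, p, d) \<in> dist D"
    using M_decompose[of j] assms(1) unfolding extensions_def by blast
  note a = dist_arr[OF dist]
  have "z \<cdot> s = zero_arr V' (sh0 D Y)"
    using arr_comp[OF a(4) assms(3)] orth_upper[OF V' assms(2)] unfolding orth_def by simp
  then obtain z' where "arr z' U (sh0 D Y)" "z' \<cdot> p = z" using dist_extend[OF dist assms(3)] by blast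
  then show ?thesis using that U a(5) by blast
qed

theorem orth_shift:
  assumes "n \<ge> 1" "X \<in> E i" "Y \<in> E j" "int n > j - i"
  shows "orth X (Sh n Y)"
  using assms
proof (induction n arbitrary: Y j rule: dec_induct)
  case base
  then show ?case using E_orth[of X i Y j] by simp
next
  case (step n)
  show ?case
    unfolding orth_def
  proof (intro allI impI)
    fix f assume f: "arr f X (Sh (Suc n) Y)"
    obtain V g z where V: "V \<in> M" and g: "arr g X (Sh n V)" and z: "arr z V (sh0 D Y)"
      and fz: "f = Shm n z \<cdot> g"
      using M_factor[OF _ _ step.hyps(1) f] E_subset_M step.prems(1,2) by blast
    have "Y \<in> E ((j - 1) + 1)" using step.prems by simp
    from factor_through_lower[OF V this z] obtain U p z' where
      U: "U \<in> lower (j - 1)" and p: "arr p V U" and z': "arr z' U (sh0 D Y)" and zp: "z = z' \<cdot> p" .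
    have "orth X (Sh n U)"
    proof (rule orth_lower[OF U])
      \<comment> \<open>The degree drops by one and the index by at least one, so the inequality
        passes to the induction hypothesis.\<close>
      fix l Y' assume "l \<le> j - 1" "Y' \<in> E l"
      then show "orth X (Sh n Y')"
        using step.IH[OF step.prems(1), of Y' l] step.prems(3) by simp
    qed
    then have pg: "Shm n p \<cdot> g = zero_arr X (Sh n U)"
      using arr_comp[OF g shift.functor_arr[OF p]] unfolding orth_def by blast
    have "f = Shm n z' \<cdot> Shm n p \<cdot> g"
      unfolding fz zp using shift.functor_comp[OF p z', of n]
        comp_assoc[OF g shift.functor_arr[OF p, of n] shift.functor_arr[OF z', of n]] by simp
    then show "f = zero_arr X (Sh (Suc n) Y)"
      unfolding pg using comp_zero_right[OF shift.functor_arr[OF z', of n] arr_obj(1)[OF g]]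
      by (simp add: funpow_swap1)
  qed
qed

text \<open>Modulo its slice in \<open>E k\<close>, the object \<open>U\<close> lies in
  \<open>lower (k - 1)\<close>, to which \<open>X\<close> has no maps of degree \<open>n\<close> by
  \<open>orth_shift\<close>, as \<open>n > (k - 1) - i\<close>. Hence \<open>g\<close> lifts to the
  slice.\<close>

lemma lift_to_E:
  assumes U: "U \<in> lower k" and X: "X \<in> E i" and n: "n \<ge> 1" "int n \<ge> k - i" and g: "arr g X (Sh n U)"
  obtains W s g' where "W \<in> E k" "arr s W U" "arr g' X (Sh n W)" "g = Shm n s \<cdot> g'"
proof -
  obtain W U' s p d where W: "W \<in> E k" and U': "U' \<in> lower (k - 1)" and dist: "(W, U, U', s, p, d) \<in> dist D"
    using lower_decompose[of k] U unfolding extensions_def by blast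
  note a = dist_arr[OF dist]
  have "orth X (Sh n U')"
    using orth_lower[OF U'] orth_shift[OF n(1) X] n(2) by force
  then have "Shm n p \<cdot> g = zero_arr X (Sh n U')"
    using arr_comp[OF g shift.functor_arr[OF a(5)]] unfolding orth_def by blast
  then obtain g' where "arr g' X (Sh n W)" "Shm n s \<cdot> g' = g"
    using dist_lift_shift[OF dist g] by blast
  then show ?thesis using that W a(4) by metis
qed

text \<open>\<open>factor_through_lower\<close> bounds the index of the middle object from above and
  \<open>lift_to_E\<close> from below, so that only \<open>E (int n)\<close> remains.\<close>

lemma diagonal_factor:
  assumes n: "n \<ge> 1" and X: "X \<in> E 0" and Y: "Y \<in> E (int n + 1)" and f: "arr f X (Sh (Suc n) Y)"
  obtains W z g where "W \<in> E (int n)" "arr z W (sh0 D Y)" "arr g X (Sh n W)" "f = Shm n z \<cdot> g"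
proof -
  obtain V g z where V: "V \<in> M" and g: "arr g X (Sh n V)" and z: "arr z V (sh0 D Y)"
    and fz: "f = Shm n z \<cdot> g"
    using M_factor[OF _ _ n f] E_subset_M X Y by blast
  from factor_through_lower[OF V Y z] obtain U p z' where
    U: "U \<in> lower (int n)" and p: "arr p V U" and z': "arr z' U (sh0 D Y)" and zp: "z = z' \<cdot> p" .
  note pg = arr_comp[OF g shift.functor_arr[OF p]]
  from lift_to_E[OF U X n _ pg] obtain W s g' where
    W: "W \<in> E (int n)" and s: "arr s W U" and g': "arr g' X (Sh n W)" and sg: "Shm n p \<cdot> g = Shm n s \<cdot> g'"
    by auto
  have "f = Shm n z' \<cdot> Shm n p \<cdot> g"
    unfolding fz zp using shift.functor_comp[OF p z', of n]
      comp_assoc[OF g shift.functor_arr[OF p, of n] shift.functor_arr[OF z', of n]] by simp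
  also have "\<dots> = Shm n (z' \<cdot> s) \<cdot> g'"
    unfolding sg using shift.functor_comp[OF s z', of n]
      comp_assoc[OF g' shift.functor_arr[OF s, of n] shift.functor_arr[OF z', of n]] by simp
  finally show ?thesis using that[OF W arr_comp[OF s z'] g'] by blast
qed

text \<open>\<open>W\<close> and \<open>Y\<close> stand for \<open>\<tau>(n + 1)\<close> and
  \<open>\<sigma>(n + 2)\<close> in a product of degree \<open>n + 2\<close>, with direct sums of
  the \<open>\<tau>\<close> allowed. The witnesses are \<open>e = y t\<close> and
  \<open>e' = c[1] d' t\<close> in the notation of the proof.\<close>

lemma diagonal_relation:
  assumes n: "n \<ge> 1" and X: "X \<in> E 0" and W: "W \<in> E (int n + 1)" and Y: "Y \<in> E (int n + 2)"
    and a: "arr a W (sh0 D Y)" and b: "arr b X (Sh (Suc n) W)"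
    and ab: "Shm (Suc n) a \<cdot> b = zero_arr X (Sh (Suc n) (sh0 D Y))"
  obtains V1 V2 h e a' e' where
    "V2 \<in> E (int n)" "V1 \<in> E (int n + 1)"
    "arr h X (Sh n V2)" "arr e V2 (sh0 D W)" "arr a' V1 (sh0 D Y)" "arr e' V2 (sh0 D V1)"
    "b = Shm n e \<cdot> h" "sh1 D a \<cdot> e = sh1 D a' \<cdot> e'"
    "Shm n e' \<cdot> h = zero_arr X (Sh n (sh0 D V1))"
proof -
  obtain Z i p where d: "(Y, Z, W, i, p, a) \<in> dist D"
    using complete_third[OF a E_obj[OF Y]] by blast
  note da = dist_arr[OF d]
  have Z: "Z \<in> M"
    using M_closed E_subset_M W Y d unfolding ext_closed_with_zero_def closed_under_extensions_def by blast
  obtain b' where b': "arr b' X (Sh (Suc n) Z)" "Shm (Suc n) p \<cdot> b' = b"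
    using dist_lift_shift[OF rotate[OF d] b ab] .
  obtain V g z where V: "V \<in> M" and g: "arr g X (Sh n V)" and z: "arr z V (sh0 D Z)"
    and bz: "b' = Shm n z \<cdot> g"
    using M_factor[OF _ Z n b'(1)] E_subset_M X by blast
  obtain V' U s q d' where V': "V' \<in> upper (int n + 1)" and U: "U \<in> lower (int n)" and dV: "(V', V, U, s, q, d') \<in> dist D"
    using M_decompose[of "int n"] V unfolding extensions_def by blast
  note va = dist_arr[OF dV]
  note sp = shift_arr[OF da(5)] and sa = shift_arr[OF a]
  note pz = arr_comp[OF z sp]
  \<comment> \<open>The index of \<open>W\<close> does not exceed those of the slices of
    \<open>V'\<close>, so \<open>V'\<close> is killed after projecting to \<open>W[1]\<close>. The
    map \<open>z\<close> itself need not kill it, since \<open>Y\<close> of index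
    \<open>n + 2\<close> is a part of \<open>Z\<close>.\<close>
  have "(sh1 D p \<cdot> z) \<cdot> s = zero_arr V' (sh0 D W)"
    using arr_comp[OF va(4) pz] orth_upper[OF V' W] unfolding orth_def by simp
  then obtain y where y: "arr y U (sh0 D W)" "y \<cdot> q = sh1 D p \<cdot> z"
    using dist_extend[OF dV pz] by blast
  note qn = shift.functor_arr[OF va(5), of n]
  note qg = arr_comp[OF g qn]
  from lift_to_E[OF U X n _ qg] obtain V2 t h where
    V2: "V2 \<in> E (int n)" and t: "arr t V2 U" and h: "arr h X (Sh n V2)"
    and th: "Shm n q \<cdot> g = Shm n t \<cdot> h"
    by auto
  note tn = shift.functor_arr[OF t, of n]
  have b_eq: "b = Shm n (y \<cdot> t) \<cdot> h"
  proof -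
    have "b = Shm n (sh1 D p) \<cdot> (Shm n z \<cdot> g)"
      unfolding b'(2)[symmetric] bz by (simp add: funpow_swap1)
    also have "\<dots> = Shm n (y \<cdot> q) \<cdot> g"
      unfolding y(2) using shift.functor_comp[OF z sp, of n]
        comp_assoc[OF g shift.functor_arr[OF z, of n] shift.functor_arr[OF sp, of n]] by simp
    also have "\<dots> = Shm n y \<cdot> (Shm n q \<cdot> g)"
      using shift.functor_comp[OF va(5) y(1), of n] comp_assoc[OF g qn shift.functor_arr[OF y(1), of n]] by simp
    also have "\<dots> = Shm n (y \<cdot> t) \<cdot> h"
      unfolding th using shift.functor_comp[OF t y(1), of n] comp_assoc[OF h tn shift.functor_arr[OF y(1), of n]] by simp
    finally show ?thesis .
  qed
  note ay = arr_comp[OF y(1) sa]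
  \<comment> \<open>Since \<open>a p = 0\<close>, the map \<open>a[1] y\<close> vanishes after
    \<open>q\<close> and so factors through the connecting map \<open>d'\<close> of the cut.\<close>
  have "(sh1 D a \<cdot> y) \<cdot> q = sh1 D (a \<cdot> p) \<cdot> z"
    using comp_assoc[OF va(5) y(1) sa] y(2) comp_assoc[OF z sp sa] shift_comp[OF da(5) a] by simp
  also have "\<dots> = zero_arr V (sh0 D (sh0 D Y))"
    unfolding dist_comp_zero[OF rotate[OF d]]
    using shift_zero[OF da(2) shift_obj[OF da(1)]] comp_zero_left[OF z shift_obj[OF shift_obj[OF da(1)]]] by simp
  finally obtain v where v: "arr v (sh0 D V') (sh0 D (sh0 D Y))" "v \<cdot> d' = sh1 D a \<cdot> y"
    using dist_extend[OF rotate[OF dV] ay] by blast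
  obtain v' where v': "arr v' V' (sh0 D Y)" "sh1 D v' = v"
    using shift_full[OF va(1) shift_obj[OF da(1)] v(1)] .
  obtain V3 V1 r c d3 where V3: "V3 \<in> upper (int n + 1 + 1)" and V1: "V1 \<in> E (int n + 1)"
    and d3: "(V3, V', V1, r, c, d3) \<in> dist D"
    using upper_decompose[of "int n + 1"] V' unfolding extensions_def by blast
  note ra = dist_arr[OF d3]
  \<comment> \<open>The index of \<open>Y\<close> is \<open>n + 2\<close>, so \<open>v'\<close>
    kills the slices of index at least \<open>n + 2\<close> and factors through the bottom slice
    \<open>V1\<close> of \<open>V'\<close>.\<close>
  have "v' \<cdot> r = zero_arr V3 (sh0 D Y)"
    using arr_comp[OF ra(4) v'(1)] orth_upper[OF V3 Y] unfolding orth_def by simp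
  then obtain a' where a': "arr a' V1 (sh0 D Y)" "a' \<cdot> c = v'"
    using dist_extend[OF d3 v'(1)] by blast
  note sc = shift_arr[OF ra(5)] and sa' = shift_arr[OF a'(1)]
  note dt = arr_comp[OF t va(6)]
  have e': "arr (sh1 D c \<cdot> d' \<cdot> t) V2 (sh0 D V1)" using arr_comp[OF dt sc] .
  have "sh1 D a' \<cdot> (sh1 D c \<cdot> d' \<cdot> t) = v \<cdot> d' \<cdot> t"
    using comp_assoc[OF dt sc sa'] shift_comp[OF ra(5) a'(1)] a'(2) v'(2) by simp
  also have "\<dots> = sh1 D a \<cdot> (y \<cdot> t)"
    using comp_assoc[OF t va(6) v(1)] v(2) comp_assoc[OF t y(1) sa] by simp
  finally have eq: "sh1 D a \<cdot> (y \<cdot> t) = sh1 D a' \<cdot> (sh1 D c \<cdot> d' \<cdot> t)" ..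
  note cd = arr_comp[OF va(6) sc]
  \<comment> \<open>\<open>e' h = 0\<close> because \<open>t h = q g\<close>, while
    \<open>d' q = 0\<close> as a composite of consecutive maps of a triangle.\<close>
  have "Shm n (sh1 D c \<cdot> d' \<cdot> t) \<cdot> h = Shm n (sh1 D c \<cdot> d') \<cdot> (Shm n t \<cdot> h)"
    using comp_assoc[OF t va(6) sc] shift.functor_comp[OF t cd, of n]
      comp_assoc[OF h tn shift.functor_arr[OF cd, of n]] by simp
  also have "\<dots> = Shm n (sh1 D c \<cdot> (d' \<cdot> q)) \<cdot> g"
    unfolding th[symmetric] using comp_assoc[OF va(5,6) sc] shift.functor_comp[OF va(5) cd, of n]
      comp_assoc[OF g qn shift.functor_arr[OF cd, of n]] by simp
  also have "\<dots> = zero_arr X (Sh n (sh0 D V1))"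
    unfolding dist_comp_zero[OF rotate[OF dV]] comp_zero_right[OF sc va(2)]
      shift.functor_zero[OF va(2) arr_obj(2)[OF sc]]
    using comp_zero_left[OF g shift.functor_obj[OF arr_obj(2)[OF sc]]] by simp
  finally show ?thesis
    using that[OF V2 V1 h arr_comp[OF t y(1)] a'(1) e' b_eq eq] by blast
qed

end

section \<open>Direct sums\<close>

context preadditive_category
begin

text \<open>\<open>is_direct_sum\<close> with the inclusions and projections exposed and typed by
  \<open>arr\<close>.\<close>

definition direct_sum_maps where
  "direct_sum_maps X Xs \<iota> \<pi> \<longleftrightarrow> X \<in> Obj C \<and> set Xs \<subseteq> Obj C \<and>
     (\<forall>k < length Xs. arr (\<iota> k) (Xs ! k) X \<and> arr (\<pi> k) X (Xs ! k)) \<and>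
     (\<forall>k < length Xs. \<forall>l < length Xs.
        \<pi> k \<cdot> \<iota> l = (if k = l then idm C (Xs ! k) else zero_arr (Xs ! l) (Xs ! k))) \<and>
     finprod (Hom C X X) (\<lambda>k. \<iota> k \<cdot> \<pi> k) {..<length Xs} = idm C X"

lemma is_direct_sum_iff: "is_direct_sum C X Xs \<longleftrightarrow> (\<exists>\<iota> \<pi>. direct_sum_maps X Xs \<iota> \<pi>)"
proof -
  have "Xs ! k \<in> Obj C" if "set Xs \<subseteq> Obj C" "k < length Xs" for k
    using that nth_mem by blast
  then show ?thesis
    unfolding is_direct_sum_def direct_sum_maps_def arr_def by blast
qed

lemma direct_sum_mapsD:
  assumes "direct_sum_maps X Xs \<iota> \<pi>"
  shows "X \<in> Obj C" "set Xs \<subseteq> Obj C"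
    "k < length Xs \<Longrightarrow> arr (\<iota> k) (Xs ! k) X" "k < length Xs \<Longrightarrow> arr (\<pi> k) X (Xs ! k)"
    "k < length Xs \<Longrightarrow> \<pi> k \<cdot> \<iota> k = idm C (Xs ! k)"
    "k < length Xs \<Longrightarrow> l < length Xs \<Longrightarrow> k \<noteq> l \<Longrightarrow> \<pi> k \<cdot> \<iota> l = zero_arr (Xs ! l) (Xs ! k)"
    "finprod (Hom C X X) (\<lambda>k. \<iota> k \<cdot> \<pi> k) {..<length Xs} = idm C X"
  using assms unfolding direct_sum_maps_def by auto

lemma sum_delta:
  assumes "X \<in> Obj C" "Y \<in> Obj C" "finite I" "k \<in> I" "arr (f k) X Y"
    "\<And>l. l \<in> I \<Longrightarrow> l \<noteq> k \<Longrightarrow> f l = zero_arr X Y"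
  shows "finprod (Hom C X Y) f I = f k"
proof -
  interpret comm_group "Hom C X Y" using hom_group assms by blast
  have "f l \<in> carrier (Hom C X Y)" if "l \<in> I" for l
    using assms(5,6) that by (cases "l = k") (auto simp: arr_def)
  note assms = assms this
  have "finprod (Hom C X Y) f I = finprod (Hom C X Y) (\<lambda>l. if k = l then f l else zero_arr X Y) I"
    by (rule finprod_cong') (use assms in \<open>auto simp: arr_def\<close>)
  also have "\<dots> = f k"
    by (rule finprod_singleton) (use assms in \<open>auto simp: arr_def Pi_def\<close>)
  finally show ?thesis .
qed

lemma direct_sum_iso:
  assumes "is_direct_sum C X Xs" "Y \<in> Obj C" "isomorphic C X Y"
  shows "is_direct_sum C Y Xs"
proof -
  obtain \<iota> \<pi> where d: "direct_sum_maps X Xs \<iota> \<pi>" using assms is_direct_sum_iff by blast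
  note d = direct_sum_mapsD[OF d]
  obtain s t where s: "arr s X Y" and t: "arr t Y X" "t \<cdot> s = idm C X" "s \<cdot> t = idm C Y"
    using assms(2,3) d(1) is_iso_iff unfolding isomorphic_def by blast
  have "direct_sum_maps Y Xs (\<lambda>k. s \<cdot> \<iota> k) (\<lambda>k. \<pi> k \<cdot> t)"
    unfolding direct_sum_maps_def
  proof (intro conjI allI impI)
    fix k l assume k: "k < length Xs" and l: "l < length Xs"
    have "(\<pi> k \<cdot> t) \<cdot> (s \<cdot> \<iota> l) = \<pi> k \<cdot> (t \<cdot> s) \<cdot> \<iota> l"
      using comp_assoc[OF arr_comp[OF d(3)[OF l] s] t(1) d(4)[OF k]] comp_assoc[OF d(3)[OF l] s t(1)] by simp
    also have "\<dots> = \<pi> k \<cdot> \<iota> l" using t(2) comp_id_left[OF d(3)[OF l]] by simp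
    finally show "(\<pi> k \<cdot> t) \<cdot> (s \<cdot> \<iota> l) = (if k = l then idm C (Xs ! k) else zero_arr (Xs ! l) (Xs ! k))"
      using d(5)[OF k] d(6)[OF k l] by auto
  next
    have "finprod (Hom C Y Y) (\<lambda>k. (s \<cdot> \<iota> k) \<cdot> (\<pi> k \<cdot> t)) {..<length Xs} =
        finprod (Hom C Y Y) (\<lambda>k. s \<cdot> ((\<iota> k \<cdot> \<pi> k) \<cdot> t)) {..<length Xs}"
    proof (rule sum_cong[OF assms(2,2)])
      fix k assume "k \<in> {..<length Xs}" then have k: "k < length Xs" by simp
      show "arr (s \<cdot> ((\<iota> k \<cdot> \<pi> k) \<cdot> t)) Y Y"
        using arr_comp[OF arr_comp[OF t(1) arr_comp[OF d(4)[OF k] d(3)[OF k]]] s] .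
      show "(s \<cdot> \<iota> k) \<cdot> (\<pi> k \<cdot> t) = s \<cdot> ((\<iota> k \<cdot> \<pi> k) \<cdot> t)"
        using comp_assoc[OF t(1) d(4)[OF k] d(3)[OF k]] comp_assoc[OF arr_comp[OF t(1) d(4)[OF k]] d(3)[OF k] s] by simp
    qed
    also have "\<dots> = s \<cdot> (finprod (Hom C X X) (\<lambda>k. \<iota> k \<cdot> \<pi> k) {..<length Xs} \<cdot> t)"
    proof -
      have a: "arr (\<iota> k \<cdot> \<pi> k) X X" if "k \<in> {..<length Xs}" for k using that arr_comp d(3,4) by blast
      show ?thesis
        using comp_sum_left[OF t(1) d(1), of "{..<length Xs}" "\<lambda>k. \<iota> k \<cdot> \<pi> k"] a
          comp_sum_right[OF s assms(2), of "{..<length Xs}" "\<lambda>k. (\<iota> k \<cdot> \<pi> k) \<cdot> t"] arr_comp[OF t(1)] by simp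
    qed
    finally show "finprod (Hom C Y Y) (\<lambda>k. (s \<cdot> \<iota> k) \<cdot> (\<pi> k \<cdot> t)) {..<length Xs} = idm C Y"
      using d(7) comp_id_left[OF t(1)] t(3) by simp
  qed (use d(1,2) arr_comp[OF d(3) s] arr_comp[OF t(1) d(4)] assms(2) in auto)
  then show ?thesis using is_direct_sum_iff by blast
qed

end

context additive_autoequivalence
begin

lemma functor_direct_sum:
  assumes "is_direct_sum C X Xs"
  shows "is_direct_sum C (F0 X) (map F0 Xs)"
proof -
  obtain \<iota> \<pi> where d: "direct_sum_maps X Xs \<iota> \<pi>" using assms is_direct_sum_iff by blast
  note d = direct_sum_mapsD[OF d]
  have o: "Xs ! k \<in> Obj C" if "k < length Xs" for k using d(2) that nth_mem by blast
  have "direct_sum_maps (F0 X) (map F0 Xs) (\<lambda>k. F1 (\<iota> k)) (\<lambda>k. F1 (\<pi> k))"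
    unfolding direct_sum_maps_def
  proof (intro conjI allI impI)
    fix k l assume "k < length (map F0 Xs)" "l < length (map F0 Xs)"
    then have k: "k < length Xs" and l: "l < length Xs" by auto
    show "F1 (\<pi> k) \<cdot> F1 (\<iota> l) = (if k = l then idm C (map F0 Xs ! k) else zero_arr (map F0 Xs ! l) (map F0 Xs ! k))"
      using functor_comp[OF d(3)[OF l] d(4)[OF k]] d(5)[OF k] d(6)[OF k l] functor_id[OF o[OF k]]
        functor_zero[OF o[OF l] o[OF k]] k l by auto
  next
    have a: "arr (\<iota> k \<cdot> \<pi> k) X X" if "k \<in> {..<length Xs}" for k using that arr_comp d(3,4) by blast
    have "finprod (Hom C (F0 X) (F0 X)) (\<lambda>k. F1 (\<iota> k) \<cdot> F1 (\<pi> k)) {..<length Xs} =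
        finprod (Hom C (F0 X) (F0 X)) (\<lambda>k. F1 (\<iota> k \<cdot> \<pi> k)) {..<length Xs}"
      using functor_comp[OF d(4) d(3)] functor_arr[OF a] functor_obj[OF d(1)] by (intro sum_cong) auto
    then show "finprod (Hom C (F0 X) (F0 X)) (\<lambda>k. F1 (\<iota> k) \<cdot> F1 (\<pi> k)) {..<length (map F0 Xs)} = idm C (F0 X)"
      using functor_sum[OF d(1,1), of "{..<length Xs}" "\<lambda>k. \<iota> k \<cdot> \<pi> k"] a d(7) functor_id[OF d(1)] by simp
  qed (use d functor_arr functor_obj in auto)
  then show ?thesis using is_direct_sum_iff by blast
qed

end

context triangulated_category
begin

text \<open>The inclusion of the first summand splits, so its cone \<open>C\<close> is a direct sum
  of the other summands, and \<open>X\<close> is an extension of \<open>C\<close> by the first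
  one.\<close>

lemma direct_sum_closed:
  assumes P: "ext_closed_with_zero P"
  shows "\<lbrakk>is_direct_sum D X Xs; set Xs \<subseteq> P\<rbrakk> \<Longrightarrow> X \<in> P"
proof (induction Xs arbitrary: X)
  case Nil
  then show ?case using direct_sum_Nil P unfolding ext_closed_with_zero_def by blast
next
  case (Cons X1 Xs)
  from Cons.prems obtain \<iota> \<pi> where d: "direct_sum_maps X (X1 # Xs) \<iota> \<pi>" using is_direct_sum_iff by blast
  note d = direct_sum_mapsD[OF d]
  have i0: "arr (\<iota> 0) X1 X" and p0: "arr (\<pi> 0) X X1" and pi0: "\<pi> 0 \<cdot> \<iota> 0 = idm D X1"
    using d(3)[of 0] d(4)[of 0] d(5)[of 0] by auto
  have i: "arr (\<iota> (Suc k)) (Xs ! k) X" and p: "arr (\<pi> (Suc k)) X (Xs ! k)" if "k < length Xs" for k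
    using d(3)[of "Suc k"] d(4)[of "Suc k"] that by auto
  obtain C c h where dC: "(X1, X, C, \<iota> 0, c, h) \<in> dist D" using TR1_complete[OF arr_obj[OF i0] arr_hom[OF i0]] by blast
  note a = dist_arr[OF dC]
  \<comment> \<open>Consecutive maps compose to zero, so the shift of \<open>\<iota> 0\<close>
    annihilates \<open>h\<close>; the retraction \<open>\<pi> 0\<close> cancels it.\<close>
  have h0: "h = zero_arr C (sh0 D X1)"
  proof -
    have "inv\<^bsub>Hom D (sh0 D X1) (sh0 D X)\<^esub> (sh1 D (\<iota> 0)) \<cdot> h = zero_arr C (sh0 D X)"
      using dist_comp_zero[OF rotate[OF rotate[OF dC]]] .
    then have "inv\<^bsub>Hom D C (sh0 D X)\<^esub> (sh1 D (\<iota> 0) \<cdot> h) = zero_arr C (sh0 D X)"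
      using comp_inv_left[OF a(6) shift_arr[OF i0]] by simp
    then have "sh1 D (\<iota> 0) \<cdot> h = zero_arr C (sh0 D X)"
      using group.inv_eq_1_iff[OF hom_is_group[OF a(3) shift_obj[OF a(2)]]] arr_hom[OF arr_comp[OF a(6) shift_arr[OF i0]]] by simp
    then have "sh1 D (\<pi> 0) \<cdot> (sh1 D (\<iota> 0) \<cdot> h) = zero_arr C (sh0 D X1)"
      using comp_zero_right[OF shift_arr[OF p0] a(3)] by simp
    then show ?thesis
      using comp_assoc[OF a(6) shift_arr[OF i0] shift_arr[OF p0]] shift_comp[OF i0 p0] pi0
        shift_id[OF a(1)] comp_id_left[OF a(6)] by simp
  qed
  have "h \<cdot> idm D C = zero_arr C (sh0 D X1)" using h0 comp_id_right[OF a(6)] by simp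
  then obtain s where s: "arr s C X" "c \<cdot> s = idm D C"
    using dist_lift[OF rotate[OF dC] arr_id[OF a(3)]] by blast
  have "\<exists>q. arr q C (Xs ! k) \<and> q \<cdot> c = \<pi> (Suc k)" if k: "k < length Xs" for k
  proof -
    have "\<pi> (Suc k) \<cdot> \<iota> 0 = zero_arr X1 (Xs ! k)" using d(6)[of "Suc k" 0] k by simp
    then show ?thesis using dist_extend[OF dC p[OF k]] by blast
  qed
  then obtain q where q: "\<And>k. k < length Xs \<Longrightarrow> arr (q k) C (Xs ! k)" "\<And>k. k < length Xs \<Longrightarrow> q k \<cdot> c = \<pi> (Suc k)"
    by metis
  have ci: "arr (c \<cdot> \<iota> (Suc k)) (Xs ! k) C" if "k < length Xs" for k using arr_comp[OF i[OF that] a(5)] .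
  have "direct_sum_maps C Xs (\<lambda>k. c \<cdot> \<iota> (Suc k)) q"
    unfolding direct_sum_maps_def
  proof (intro conjI allI impI)
    fix k l assume k: "k < length Xs" and l: "l < length Xs"
    have "q k \<cdot> (c \<cdot> \<iota> (Suc l)) = \<pi> (Suc k) \<cdot> \<iota> (Suc l)"
      using comp_assoc[OF i[OF l] a(5) q(1)[OF k]] q(2)[OF k] by simp
    then show "q k \<cdot> (c \<cdot> \<iota> (Suc l)) = (if k = l then idm D (Xs ! k) else zero_arr (Xs ! l) (Xs ! k))"
      using d(5)[of "Suc k"] d(6)[of "Suc k" "Suc l"] k l by auto
  next
    let ?S = "finprod (Hom D C C) (\<lambda>k. (c \<cdot> \<iota> (Suc k)) \<cdot> q k) {..<length Xs}"
    have aq: "arr ((c \<cdot> \<iota> (Suc k)) \<cdot> q k) C C" if "k \<in> {..<length Xs}" for k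
      using arr_comp[OF q(1) ci] that by simp
    have S: "arr ?S C C" by (rule arr_sum[OF a(3,3)]) (rule aq)
    have ip: "arr (\<iota> k \<cdot> \<pi> k) X X" if "k \<in> {..<Suc (length Xs)}" for k
      using arr_comp[OF d(4) d(3)] that by simp
    interpret H: comm_group "Hom D X C" using hom_group a by blast
    have cip: "arr (c \<cdot> \<iota> k \<cdot> \<pi> k) X C" if "k \<in> {..<Suc (length Xs)}" for k
      using arr_comp[OF ip[OF that] a(5)] .
    have "?S \<cdot> c = finprod (Hom D X C) (\<lambda>k. ((c \<cdot> \<iota> (Suc k)) \<cdot> q k) \<cdot> c) {..<length Xs}"
      by (rule comp_sum_left[OF a(5) a(3)]) (rule aq)
    also have "\<dots> = finprod (Hom D X C) (\<lambda>k. c \<cdot> (\<iota> (Suc k) \<cdot> \<pi> (Suc k))) {..<length Xs}"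
    proof (rule sum_cong[OF a(2,3)])
      fix k assume "k \<in> {..<length Xs}" then have k: "k < length Xs" by simp
      show "arr (c \<cdot> (\<iota> (Suc k) \<cdot> \<pi> (Suc k))) X C" using cip[of "Suc k"] k by simp
      show "((c \<cdot> \<iota> (Suc k)) \<cdot> q k) \<cdot> c = c \<cdot> (\<iota> (Suc k) \<cdot> \<pi> (Suc k))"
        using comp_assoc[OF a(5) q(1)[OF k] ci[OF k]] comp_assoc[OF p[OF k] i[OF k] a(5)] q(2)[OF k] by simp
    qed
    \<comment> \<open>The summand with index \<open>0\<close> may be added because \<open>c\<close>
      annihilates \<open>\<iota> 0\<close>; it completes the sum to the identity of
      \<open>X\<close>.\<close>
    also have "\<dots> = c \<cdot> \<iota> 0 \<cdot> \<pi> 0 \<otimes>\<^bsub>Hom D X C\<^esub> finprod (Hom D X C) (\<lambda>k. c \<cdot> (\<iota> (Suc k) \<cdot> \<pi> (Suc k))) {..<length Xs}"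
    proof -
      have "c \<cdot> \<iota> 0 \<cdot> \<pi> 0 = zero_arr X C"
        using comp_assoc[OF p0 i0 a(5)] dist_comp_zero[OF dC] comp_zero_left[OF p0 a(3)] by simp
      moreover have "finprod (Hom D X C) (\<lambda>k. c \<cdot> (\<iota> (Suc k) \<cdot> \<pi> (Suc k))) {..<length Xs} \<in> carrier (Hom D X C)"
        using cip by (intro arr_hom arr_sum a) auto
      ultimately show ?thesis by simp
    qed
    also have "\<dots> = finprod (Hom D X C) (\<lambda>k. c \<cdot> (\<iota> k \<cdot> \<pi> k)) {..<Suc (length Xs)}"
    proof -
      have e: "{..<Suc (length Xs)} = insert 0 (Suc ` {..<length Xs})" by (rule lessThan_Suc_eq_insert_0)
      have "finprod (Hom D X C) (\<lambda>k. c \<cdot> (\<iota> k \<cdot> \<pi> k)) (Suc ` {..<length Xs}) =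
          finprod (Hom D X C) (\<lambda>k. c \<cdot> (\<iota> (Suc k) \<cdot> \<pi> (Suc k))) {..<length Xs}"
        using cip by (subst H.finprod_reindex) (auto simp: arr_def)
      then show ?thesis
        unfolding e using cip by (subst H.finprod_insert) (auto simp: arr_def)
    qed
    also have "\<dots> = c \<cdot> idm D X"
      using comp_sum_right[OF a(5) a(2), of "{..<Suc (length Xs)}" "\<lambda>k. \<iota> k \<cdot> \<pi> k"] ip d(7) by simp
    finally have "?S \<cdot> c = c" using comp_id_right[OF a(5)] by simp
    \<comment> \<open>The map \<open>c\<close> has the section \<open>s\<close> and can be cancelled
      on the right.\<close>
    then have "(?S \<cdot> c) \<cdot> s = c \<cdot> s" by simp
    then show "?S = idm D C"
      using comp_assoc[OF s(1) a(5) S] s(2) comp_id_right[OF S] by simp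
  qed (use d(2) a(3) ci q in auto)
  then have "C \<in> P" using Cons.IH[of C] is_direct_sum_iff Cons.prems(2) by auto
  moreover have "X1 \<in> P" using Cons.prems(2) by simp
  ultimately show "X \<in> P"
    using P dC unfolding ext_closed_with_zero_def closed_under_extensions_def by blast
qed

text \<open>The identity of \<open>W\<close> is inserted between the two factors and expanded over
  the summands: a composite through a direct sum is a row times a column.\<close>

lemma comp_through_direct_sum:
  assumes W: "direct_sum_maps W Ws \<iota> \<pi>" and z: "arr z W U" and g: "arr g X (Sh n W)"
  shows "Shm n z \<cdot> g = finprod (Hom D X (Sh n U))
    (\<lambda>k. Shm n (z \<cdot> \<iota> k) \<cdot> (Shm n (\<pi> k) \<cdot> g)) {..<length Ws}"
proof -
  note d = direct_sum_mapsD[OF W]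
  note zn = shift.functor_arr[OF z, of n] and X = arr_obj(1)[OF g] and U = arr_obj(2)[OF shift.functor_arr[OF z, of n]]
  have a: "arr (\<iota> k \<cdot> \<pi> k) W W" if "k \<in> {..<length Ws}" for k using that arr_comp d(3,4) by blast
  note an = shift.functor_arr[OF a, where n = n]
  have "Shm n z \<cdot> g = Shm n z \<cdot> (Shm n (finprod (Hom D W W) (\<lambda>k. \<iota> k \<cdot> \<pi> k) {..<length Ws}) \<cdot> g)"
    using d(7) shift.functor_id[OF d(1)] comp_id_left[OF g] by simp
  also have "\<dots> = Shm n z \<cdot> finprod (Hom D X (Sh n W)) (\<lambda>k. Shm n (\<iota> k \<cdot> \<pi> k) \<cdot> g) {..<length Ws}"
    using shift.functor_sum[OF d(1,1), of "{..<length Ws}" "\<lambda>k. \<iota> k \<cdot> \<pi> k" n] a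
      comp_sum_left[OF g arr_obj(2)[OF g], of "{..<length Ws}" "\<lambda>k. Shm n (\<iota> k \<cdot> \<pi> k)"] an by simp
  also have "\<dots> = finprod (Hom D X (Sh n U)) (\<lambda>k. Shm n z \<cdot> (Shm n (\<iota> k \<cdot> \<pi> k) \<cdot> g)) {..<length Ws}"
    by (rule comp_sum_right[OF zn X]) (rule arr_comp[OF g an])
  also have "\<dots> = finprod (Hom D X (Sh n U))
    (\<lambda>k. Shm n (z \<cdot> \<iota> k) \<cdot> (Shm n (\<pi> k) \<cdot> g)) {..<length Ws}"
  proof (rule sum_cong[OF X U])
    fix k assume "k \<in> {..<length Ws}" then have k: "k < length Ws" by simp
    note i = d(3)[OF k] and p = d(4)[OF k]
    note i' = shift.functor_arr[OF i, of n] and p' = shift.functor_arr[OF p, of n]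
    show "arr (Shm n (z \<cdot> \<iota> k) \<cdot> (Shm n (\<pi> k) \<cdot> g)) X (Sh n U)"
      using arr_comp[OF arr_comp[OF g p'] shift.functor_arr[OF arr_comp[OF i z]]] .
    show "Shm n z \<cdot> (Shm n (\<iota> k \<cdot> \<pi> k) \<cdot> g) = Shm n (z \<cdot> \<iota> k) \<cdot> (Shm n (\<pi> k) \<cdot> g)"
      using shift.functor_comp[OF p i, of n] shift.functor_comp[OF i z, of n] comp_assoc[OF g p' i']
        comp_assoc[OF arr_comp[OF g p'] i' zn] by simp
  qed
  finally show ?thesis .
qed

end

section \<open>Relations in diagonal cohomology\<close>

context triangulated_autoequivalence
begin

lemma twist_arr_one:
  assumes "Z \<in> Obj D" "arr a Y (sh0 D (T0 Z))"
  shows "arr (twist_arr m 1 Z a) ((T0 ^^ m) Y) (sh0 D ((T0 ^^ Suc m) Z))"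
  using twist_arr_arr[of Z a Y 1 m] assms by simp

text \<open>The part of \<open>twist_arr_bij\<close> by which a map
  \<open>Y(m) \<rightarrow> Z(m + 1)[1]\<close> becomes an element of degree one of the
  ring.\<close>

lemma twist_arr_one_surj:
  assumes "Z \<in> Obj D" "Y \<in> Obj D" "arr c ((T0 ^^ m) Y) (sh0 D ((T0 ^^ Suc m) Z))"
  shows "\<exists>a. arr a Y (sh0 D (T0 Z)) \<and> twist_arr m 1 Z a = c"
proof -
  have "c \<in> twist_arr m 1 Z ` carrier (Hom D Y (sh0 D (T0 Z)))"
    using twist_arr_bij[OF assms(1,2), of m 1] arr_hom[OF assms(3)] by (simp add: bij_betw_def)
  then show ?thesis
    using assms functor_obj shift_obj by (auto simp: arr_def)
qed

end

context silly_filtration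
begin

lemma funpow_twist_E: "X \<in> E 0 \<Longrightarrow> (T0 ^^ n) X \<in> E (int n)"
proof (induction n)
  case (Suc n)
  then show ?case using twist_E[of "(T0 ^^ n) X" "int n"] by (simp add: add.commute)
qed simp

text \<open>By \<open>E_twist\<close> an object of the next class is a twist only up to isomorphism;
  the direct sum is carried along it.\<close>

lemma E_direct_sum:
  assumes J_gen: "\<And>X. X \<in> E 0 \<Longrightarrow> \<exists>Xs. set Xs \<subseteq> J \<and> is_direct_sum D X Xs"
  shows "V \<in> E (int n) \<Longrightarrow> \<exists>Vs. set Vs \<subseteq> J \<and> is_direct_sum D V (map (T0 ^^ n) Vs)"
proof (induction n arbitrary: V)
  case 0
  then show ?case using J_gen[of V] by simp
next
  case (Suc n)
  have V: "V \<in> E (int n + 1)" using Suc.prems by (simp add: add.commute)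
  then obtain X where X: "X \<in> E (int n)" "isomorphic D (T0 X) V"
    using E_twist by blast
  obtain Vs where Vs: "set Vs \<subseteq> J" "is_direct_sum D X (map (T0 ^^ n) Vs)" using Suc.IH[OF X(1)] by blast
  have "is_direct_sum D V (map T0 (map (T0 ^^ n) Vs))"
    using direct_sum_iso[OF functor_direct_sum[OF Vs(2)] E_obj[OF V] X(2)] .
  then show ?case using Vs(1) by (auto simp: o_def)
qed

context
  fixes J
  assumes J_sub: "J \<subseteq> E 0"
    and J_gen: "\<And>X. X \<in> E 0 \<Longrightarrow> \<exists>Xs. set Xs \<subseteq> J \<and> is_direct_sum D X Xs"
begin

interpretation A: big_graded_ring J "diag"
  using J_sub E_obj by (intro big_graded_ring_diagonal_cohomology) blast

lemma J_obj: "X \<in> J \<Longrightarrow> X \<in> Obj D"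
  using J_sub E_obj by blast

text \<open>The middle object of \<open>diagonal_factor\<close> is a direct sum of objects
  \<open>\<tau>(n)\<close> with \<open>\<tau> \<in> J\<close>. Each summand gives one term; its map
  to the target is untwisted \<open>n\<close> times to become an element of degree one.\<close>

lemma diagonal_cohomology_linearly_generated: "A.linearly_generated"
  unfolding A.linearly_generated_def
proof (intro allI impI ballI)
  fix n :: nat and \<sigma> \<rho> f
  assume n: "1 \<le> n" and S: "\<sigma> \<in> J" "\<rho> \<in> J"
    and f': "f \<in> carrier (cpt diag \<sigma> \<rho> (Suc n))"
  let ?Y = "(T0 ^^ Suc n) \<sigma>"
  note o = J_obj[OF S(1)] J_obj[OF S(2)]
  have Y: "?Y \<in> E (int n + 1)" using funpow_twist_E[of \<sigma> "Suc n"] S J_sub by (auto simp: add.commute)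
  have X: "\<rho> \<in> E 0" using S J_sub by blast
  have f: "arr f \<rho> (Sh (Suc n) ?Y)" using f' unfolding cpt_diagonal_cohomology by (rule arr_shift_twist[OF o(2,1)])
  from diagonal_factor[OF n X Y f] obtain W z g where W: "W \<in> E (int n)" and z: "arr z W (sh0 D ?Y)"
    and g: "arr g \<rho> (Sh n W)" and fz: "f = Shm n z \<cdot> g" .
  obtain Vs \<iota> \<pi> where Vs: "set Vs \<subseteq> J" and d: "direct_sum_maps W (map (T0 ^^ n) Vs) \<iota> \<pi>"
    using E_direct_sum[OF J_gen W] is_direct_sum_iff by blast
  note ds = direct_sum_mapsD[OF d]
  have V: "Vs ! k \<in> J" if "k < length Vs" for k using Vs that nth_mem by blast
  have i: "arr (\<iota> k) ((T0 ^^ n) (Vs ! k)) W" and p: "arr (\<pi> k) W ((T0 ^^ n) (Vs ! k))" if "k < length Vs" for k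
    using ds(3)[of k] ds(4)[of k] that by auto
  have "\<forall>k. \<exists>a. k < length Vs \<longrightarrow> arr a (Vs ! k) (sh0 D (T0 \<sigma>)) \<and> twist_arr n 1 \<sigma> a = z \<cdot> \<iota> k"
    using twist_arr_one_surj[OF o(1) J_obj[OF V] arr_comp[OF i z]] by blast
  then obtain a where a: "\<And>k. k < length Vs \<Longrightarrow> arr (a k) (Vs ! k) (sh0 D (T0 \<sigma>))"
    "\<And>k. k < length Vs \<Longrightarrow> twist_arr n 1 \<sigma> (a k) = z \<cdot> \<iota> k"
    by metis
  define b where "b = (\<lambda>k. Shm n (\<pi> k) \<cdot> g)"
  have b: "arr (b k) \<rho> (Sh n ((T0 ^^ n) (Vs ! k)))" if "k < length Vs" for k
    unfolding b_def using arr_comp[OF g shift.functor_arr[OF p[OF that]]] .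
  have so: "Sh n (sh0 D ?Y) = Sh (Suc n) ?Y" by (simp add: funpow_swap1)
  have "f = finprod (Hom D \<rho> (Sh (Suc n) ?Y))
      (\<lambda>k. Shm n (z \<cdot> \<iota> k) \<cdot> (Shm n (\<pi> k) \<cdot> g)) {..<length Vs}"
    unfolding fz using comp_through_direct_sum[OF d z g] so by simp
  also have "\<dots> = finprod (Hom D \<rho> (Sh (Suc n) ?Y))
      (\<lambda>k. Shm n (twist_arr n 1 \<sigma> (a k)) \<cdot> b k) {..<length Vs}"
  proof (rule sum_cong)
    fix k assume "k \<in> {..<length Vs}" then have k: "k < length Vs" by simp
    show "arr (Shm n (twist_arr n 1 \<sigma> (a k)) \<cdot> b k) \<rho> (Sh (Suc n) ?Y)"
      using arr_comp[OF b[OF k] shift.functor_arr[OF twist_arr_one[OF o(1) a(1)[OF k], of n], of n]] unfolding so .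
    show "Shm n (z \<cdot> \<iota> k) \<cdot> (Shm n (\<pi> k) \<cdot> g) = Shm n (twist_arr n 1 \<sigma> (a k)) \<cdot> b k"
      using a(2)[OF k] by (simp add: b_def)
  qed (use arr_obj[OF f] in auto)
  finally have feq: "f = finprod (cpt diag \<sigma> \<rho> (Suc n))
      (\<lambda>k. mul diag \<sigma> (Vs ! k) \<rho> 1 n (a k) (b k)) {..<length Vs}"
    by simp
  show "\<exists>(N :: nat) \<tau> a b.
       (\<forall>k<N. \<tau> k \<in> J \<and> a k \<in> carrier (cpt diag \<sigma> (\<tau> k) 1) \<and>
          b k \<in> carrier (cpt diag (\<tau> k) \<rho> n)) \<and>
       f = finprod (cpt diag \<sigma> \<rho> (Suc n))
         (\<lambda>k. mul diag \<sigma> (\<tau> k) \<rho> 1 n (a k) (b k)) {..<N}"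
    by (rule exI[of _ "length Vs"], rule exI[of _ "\<lambda>k. Vs ! k"], rule exI[of _ a], rule exI[of _ b],
        rule conjI, (use V a b in \<open>auto simp: arr_def\<close>)[1], rule feq)
qed

text \<open>A relation among several products is a single relation
  \<open>\<alpha> \<beta> = 0\<close> through the direct sum of their middle objects.
  \<open>diagonal_relation\<close> applies to it, and its result is expanded over summands from
  \<open>J\<close>.\<close>

lemma diagonal_cohomology_quadratically_related: "A.quadratically_related"
  unfolding A.quadratically_related_def
proof (intro allI impI ballI)
  fix n :: nat and \<sigma> \<rho> and N :: nat and \<tau> a b
  assume n: "1 \<le> n" and S: "\<sigma> \<in> J" "\<rho> \<in> J"
    and ab: "\<forall>k<N. \<tau> k \<in> J \<and> a k \<in> carrier (cpt diag \<sigma> (\<tau> k) 1) \<and>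
        b k \<in> carrier (cpt diag (\<tau> k) \<rho> (Suc n))"
    and sum0: "finprod (cpt diag \<sigma> \<rho> (Suc (Suc n)))
        (\<lambda>k. mul diag \<sigma> (\<tau> k) \<rho> 1 (Suc n) (a k) (b k)) {..<N} =
      \<one>\<^bsub>cpt diag \<sigma> \<rho> (Suc (Suc n))\<^esub>"
  let ?Y = "(T0 ^^ Suc (Suc n)) \<sigma>"
  note o = J_obj[OF S(1)] J_obj[OF S(2)]
  have X: "\<rho> \<in> E 0" using S J_sub by blast
  have Y: "?Y \<in> E (int n + 2)"
    using funpow_twist_E[of \<sigma> "Suc (Suc n)"] S J_sub by (auto simp: add.commute)
  have \<tau>: "\<tau> k \<in> J" "\<tau> k \<in> Obj D" if "k < N" for k using ab that J_obj by blast+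
  have a: "arr (a k) (\<tau> k) (sh0 D (T0 \<sigma>))" if "k < N" for k
    using arr_shift_twist[OF \<tau>(2)[OF that] o(1), of "a k" 1 1] ab that by simp
  have b: "arr (b k) \<rho> (Sh (Suc n) ((T0 ^^ Suc n) (\<tau> k)))" if "k < N" for k
    using arr_shift_twist[OF o(2) \<tau>(2)[OF that], of "b k" "Suc n" "Suc n"] ab that by simp
  note ta = twist_arr_one[OF o(1) a, of _ "Suc n"]
  \<comment> \<open>The middle objects \<open>\<tau> k\<close>, each twisted by the degree
    \<open>n + 1\<close> of \<open>b k\<close>.\<close>
  define Ws where "Ws = map (\<lambda>k. (T0 ^^ Suc n) (\<tau> k)) [0..<N]"
  have Ws: "length Ws = N" "\<And>k. k < N \<Longrightarrow> Ws ! k = (T0 ^^ Suc n) (\<tau> k)"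
    by (simp_all add: Ws_def)
  have Ws_E: "set Ws \<subseteq> E (int n + 1)"
  proof
    fix V assume "V \<in> set Ws"
    then obtain k where k: "k < N" "V = (T0 ^^ Suc n) (\<tau> k)" by (auto simp: Ws_def)
    then have "\<tau> k \<in> E 0" using \<tau>(1) J_sub by blast
    from funpow_twist_E[OF this, of "Suc n"] show "V \<in> E (int n + 1)" by (simp add: k(2) add.commute)
  qed
  then obtain W where W': "is_direct_sum D W Ws" using ex_direct_sum E_obj by (meson subset_iff)
  have W: "W \<in> E (int n + 1)" using direct_sum_closed[OF E_closed W' Ws_E] .
  obtain \<iota> \<pi> where d: "direct_sum_maps W Ws \<iota> \<pi>" using W' is_direct_sum_iff by blast
  note ds = direct_sum_mapsD[OF d, unfolded Ws(1)]
  have i: "arr (\<iota> k) ((T0 ^^ Suc n) (\<tau> k)) W" and p: "arr (\<pi> k) W ((T0 ^^ Suc n) (\<tau> k))" if "k < N" for k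
    using ds(3)[OF that] ds(4)[OF that] Ws(2)[OF that] by auto
  note WO = E_obj[OF W] and YO = E_obj[OF Y]
  note sYO = shift_obj[OF YO] and sWO = shift.functor_obj[OF WO, of "Suc n"]

  \<comment> \<open>The row with the entries \<open>a k\<close>, twisted and joined to one map out
    of \<open>W\<close>.\<close>
  define \<alpha> where "\<alpha> = finprod (Hom D W (sh0 D ?Y)) (\<lambda>k. twist_arr (Suc n) 1 \<sigma> (a k) \<cdot> \<pi> k) {..<N}"
  have \<alpha>t: "arr (twist_arr (Suc n) 1 \<sigma> (a k) \<cdot> \<pi> k) W (sh0 D ?Y)" if "k \<in> {..<N}" for k
    using arr_comp[OF p ta] that by simp
  have \<alpha>: "arr \<alpha> W (sh0 D ?Y)" unfolding \<alpha>_def by (rule arr_sum[OF WO sYO]) (rule \<alpha>t)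
  have \<alpha>\<iota>: "\<alpha> \<cdot> \<iota> k = twist_arr (Suc n) 1 \<sigma> (a k)" if k: "k < N" for k
  proof -
    have e: "(twist_arr (Suc n) 1 \<sigma> (a l) \<cdot> \<pi> l) \<cdot> \<iota> k = twist_arr (Suc n) 1 \<sigma> (a l) \<cdot> (\<pi> l \<cdot> \<iota> k)" if "l < N" for l
      using comp_assoc[OF i[OF k] p[OF that] ta[OF that]] .
    have kk: "(twist_arr (Suc n) 1 \<sigma> (a k) \<cdot> \<pi> k) \<cdot> \<iota> k = twist_arr (Suc n) 1 \<sigma> (a k)"
      unfolding e[OF k] using ds(5)[OF k] Ws(2)[OF k] comp_id_right[OF ta[OF k]] by simp
    have "\<alpha> \<cdot> \<iota> k = finprod (Hom D ((T0 ^^ Suc n) (\<tau> k)) (sh0 D ?Y))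
        (\<lambda>l. (twist_arr (Suc n) 1 \<sigma> (a l) \<cdot> \<pi> l) \<cdot> \<iota> k) {..<N}"
      unfolding \<alpha>_def by (rule comp_sum_left[OF i[OF k] sYO]) (rule \<alpha>t)
    also have "\<dots> = (twist_arr (Suc n) 1 \<sigma> (a k) \<cdot> \<pi> k) \<cdot> \<iota> k"
    proof (rule sum_delta[OF arr_obj(1)[OF i[OF k]] sYO, of "{..<N}" k "\<lambda>l. (twist_arr (Suc n) 1 \<sigma> (a l) \<cdot> \<pi> l) \<cdot> \<iota> k"])
      show "arr ((twist_arr (Suc n) 1 \<sigma> (a k) \<cdot> \<pi> k) \<cdot> \<iota> k) ((T0 ^^ Suc n) (\<tau> k)) (sh0 D ?Y)"
        unfolding kk using ta[OF k] .
      fix l assume "l \<in> {..<N}" "l \<noteq> k"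
      then show "(twist_arr (Suc n) 1 \<sigma> (a l) \<cdot> \<pi> l) \<cdot> \<iota> k = zero_arr ((T0 ^^ Suc n) (\<tau> k)) (sh0 D ?Y)"
        using e[of l] ds(6)[of l k] k Ws(2) comp_zero_right[OF ta arr_obj(1)[OF i[OF k]]] by simp
    qed (use k in auto)
    finally show ?thesis unfolding kk .
  qed

  \<comment> \<open>The column with the entries \<open>b k\<close>, joined to one map into a shift
    of \<open>W\<close>.\<close>
  define \<beta> where "\<beta> = finprod (Hom D \<rho> (Sh (Suc n) W)) (\<lambda>k. Shm (Suc n) (\<iota> k) \<cdot> b k) {..<N}"
  have \<beta>t: "arr (Shm (Suc n) (\<iota> k) \<cdot> b k) \<rho> (Sh (Suc n) W)" if "k \<in> {..<N}" for k
    using arr_comp[OF b shift.functor_arr[OF i]] that by blast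
  have \<beta>: "arr \<beta> \<rho> (Sh (Suc n) W)" unfolding \<beta>_def by (rule arr_sum[OF o(2) sWO]) (rule \<beta>t)
  have \<pi>\<beta>: "Shm (Suc n) (\<pi> k) \<cdot> \<beta> = b k" if k: "k < N" for k
  proof -
    let ?B = "Sh (Suc n) ((T0 ^^ Suc n) (\<tau> k))"
    note pk = shift.functor_arr[OF p[OF k], of "Suc n"]
    have e: "Shm (Suc n) (\<pi> k) \<cdot> (Shm (Suc n) (\<iota> l) \<cdot> b l) = Shm (Suc n) (\<pi> k \<cdot> \<iota> l) \<cdot> b l" if "l < N" for l
      unfolding shift.functor_comp[OF i[OF that] p[OF k], of "Suc n"]
      using comp_assoc[OF b[OF that] shift.functor_arr[OF i[OF that], of "Suc n"] pk] by (rule sym)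
    have kk: "Shm (Suc n) (\<pi> k) \<cdot> (Shm (Suc n) (\<iota> k) \<cdot> b k) = b k"
      unfolding e[OF k] ds(5)[OF k] Ws(2)[OF k] shift.functor_id[OF arr_obj(1)[OF i[OF k]]] using comp_id_left[OF b[OF k]] .
    have "Shm (Suc n) (\<pi> k) \<cdot> \<beta> = finprod (Hom D \<rho> ?B)
        (\<lambda>l. Shm (Suc n) (\<pi> k) \<cdot> (Shm (Suc n) (\<iota> l) \<cdot> b l)) {..<N}"
      unfolding \<beta>_def by (rule comp_sum_right[OF pk o(2)]) (rule \<beta>t)
    also have "\<dots> = Shm (Suc n) (\<pi> k) \<cdot> (Shm (Suc n) (\<iota> k) \<cdot> b k)"
    proof (rule sum_delta[OF o(2) arr_obj(2)[OF pk], of "{..<N}" k "\<lambda>l. Shm (Suc n) (\<pi> k) \<cdot> (Shm (Suc n) (\<iota> l) \<cdot> b l)"])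
      show "arr (Shm (Suc n) (\<pi> k) \<cdot> (Shm (Suc n) (\<iota> k) \<cdot> b k)) \<rho> ?B"
        unfolding kk using b[OF k] .
      fix l assume "l \<in> {..<N}" "l \<noteq> k"
      then have l: "l < N" "k \<noteq> l" by auto
      show "Shm (Suc n) (\<pi> k) \<cdot> (Shm (Suc n) (\<iota> l) \<cdot> b l) = zero_arr \<rho> ?B"
        unfolding e[OF l(1)] ds(6)[OF k l] Ws(2)[OF k] Ws(2)[OF l(1)]
          shift.functor_zero[OF arr_obj(1)[OF i[OF l(1)]] arr_obj(1)[OF i[OF k]]]
        using comp_zero_left[OF b[OF l(1)] arr_obj(2)[OF pk]] .
    qed (use k in auto)
    finally show ?thesis unfolding kk .
  qed

  have so: "Sh (Suc n) (sh0 D ?Y) = Sh (Suc (Suc n)) ?Y" by (simp add: funpow_swap1)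
  have \<alpha>\<beta>: "Shm (Suc n) \<alpha> \<cdot> \<beta> = zero_arr \<rho> (Sh (Suc n) (sh0 D ?Y))"
  proof -
    have "Shm (Suc n) \<alpha> \<cdot> \<beta> = finprod (Hom D \<rho> (Sh (Suc n) (sh0 D ?Y)))
        (\<lambda>k. Shm (Suc n) (\<alpha> \<cdot> \<iota> k) \<cdot> (Shm (Suc n) (\<pi> k) \<cdot> \<beta>)) {..<N}"
      using comp_through_direct_sum[OF d \<alpha> \<beta>] unfolding Ws(1) .
    also have "\<dots> = finprod (Hom D \<rho> (Sh (Suc n) (sh0 D ?Y)))
        (\<lambda>k. Shm (Suc n) (twist_arr (Suc n) 1 \<sigma> (a k)) \<cdot> b k) {..<N}"
      using \<alpha>\<iota> \<pi>\<beta> arr_comp[OF b shift.functor_arr[OF ta, of _ "Suc n"]]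
      by (intro sum_cong[OF o(2) shift.functor_obj[OF sYO]]) (auto simp del: funpow.simps)
    also have "\<dots> = zero_arr \<rho> (Sh (Suc n) (sh0 D ?Y))"
      using sum0 unfolding cpt_diagonal_cohomology mul_diagonal_cohomology so .
    finally show ?thesis .
  qed

  from diagonal_relation[OF n X W Y \<alpha> \<beta> \<alpha>\<beta>] obtain V1 V2 h e a' e' where
    V2: "V2 \<in> E (int n)" and V1: "V1 \<in> E (int n + 1)"
    and h: "arr h \<rho> (Sh n V2)" and e: "arr e V2 (sh0 D W)" and a': "arr a' V1 (sh0 D ?Y)"
    and e': "arr e' V2 (sh0 D V1)"
    and \<beta>e: "\<beta> = Shm n e \<cdot> h" and \<alpha>e: "sh1 D \<alpha> \<cdot> e = sh1 D a' \<cdot> e'"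
    and e'h: "Shm n e' \<cdot> h = zero_arr \<rho> (Sh n (sh0 D V1))" .
  have V1': "V1 \<in> E (int (Suc n))" using V1 by (simp add: add.commute)
  obtain Vs \<iota>2 \<pi>2 where Vs: "set Vs \<subseteq> J" and d2: "direct_sum_maps V2 (map (T0 ^^ n) Vs) \<iota>2 \<pi>2"
    using E_direct_sum[OF J_gen V2] is_direct_sum_iff by blast
  obtain Us \<iota>1 \<pi>1 where Us: "set Us \<subseteq> J" and d1: "direct_sum_maps V1 (map (T0 ^^ Suc n) Us) \<iota>1 \<pi>1"
    using E_direct_sum[OF J_gen V1'] is_direct_sum_iff by blast
  define L where "L = length Vs"
  define M where "M = length Us"
  have VJ: "Vs ! l \<in> J" if "l < L" for l using Vs that nth_mem unfolding L_def by blast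
  have UJ: "Us ! m \<in> J" if "m < M" for m using Us that nth_mem unfolding M_def by blast
  have i2: "arr (\<iota>2 l) ((T0 ^^ n) (Vs ! l)) V2" and p2: "arr (\<pi>2 l) V2 ((T0 ^^ n) (Vs ! l))" if "l < L" for l
    using direct_sum_mapsD(3,4)[OF d2, of l] that by (auto simp: L_def)
  have i1: "arr (\<iota>1 m) ((T0 ^^ Suc n) (Us ! m)) V1" and p1: "arr (\<pi>1 m) V1 ((T0 ^^ Suc n) (Us ! m))" if "m < M" for m
    using direct_sum_mapsD(3,4)[OF d1, of m] that by (auto simp: M_def simp del: funpow.simps)
  define hh where "hh = (\<lambda>l. Shm n (\<pi>2 l) \<cdot> h)"
  have hh: "arr (hh l) \<rho> (Sh n ((T0 ^^ n) (Vs ! l)))" if "l < L" for l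
    unfolding hh_def using arr_comp[OF h shift.functor_arr[OF p2[OF that]]] .
  have pe: "arr (sh1 D (\<pi> k) \<cdot> e) V2 (sh0 D ((T0 ^^ Suc n) (\<tau> k)))" if "k < N" for k
    using arr_comp[OF e shift_arr[OF p[OF that]]] .
  have pe': "arr (sh1 D (\<pi>1 m) \<cdot> e') V2 (sh0 D ((T0 ^^ Suc n) (Us ! m)))" if "m < M" for m
    using arr_comp[OF e' shift_arr[OF p1[OF that]]] .
  \<comment> \<open>The matrix entries of \<open>e\<close>, and below those of \<open>a'\<close> and
    \<open>e'\<close>, as elements of degree one: those of \<open>e\<close> and \<open>e'\<close>
    are untwisted \<open>n\<close> times, those of \<open>a'\<close> once more.\<close>
  have "\<forall>k l. \<exists>c. k < N \<longrightarrow> l < L \<longrightarrow>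
      arr c (Vs ! l) (sh0 D (T0 (\<tau> k))) \<and> twist_arr n 1 (\<tau> k) c = (sh1 D (\<pi> k) \<cdot> e) \<cdot> \<iota>2 l"
    using twist_arr_one_surj[OF \<tau>(2) J_obj[OF VJ] arr_comp[OF i2 pe]] by blast
  then obtain ee where ee: "\<And>k l. k < N \<Longrightarrow> l < L \<Longrightarrow> arr (ee k l) (Vs ! l) (sh0 D (T0 (\<tau> k)))"
    "\<And>k l. k < N \<Longrightarrow> l < L \<Longrightarrow> twist_arr n 1 (\<tau> k) (ee k l) = (sh1 D (\<pi> k) \<cdot> e) \<cdot> \<iota>2 l"
    by metis
  have "\<forall>m. \<exists>c. m < M \<longrightarrow> arr c (Us ! m) (sh0 D (T0 \<sigma>)) \<and> twist_arr (Suc n) 1 \<sigma> c = a' \<cdot> \<iota>1 m"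
    using twist_arr_one_surj[OF o(1) J_obj[OF UJ] arr_comp[OF i1 a']] by blast
  then obtain aa where aa: "\<And>m. m < M \<Longrightarrow> arr (aa m) (Us ! m) (sh0 D (T0 \<sigma>))"
    "\<And>m. m < M \<Longrightarrow> twist_arr (Suc n) 1 \<sigma> (aa m) = a' \<cdot> \<iota>1 m"
    by metis
  have "\<forall>m l. \<exists>c. m < M \<longrightarrow> l < L \<longrightarrow>
      arr c (Vs ! l) (sh0 D (T0 (Us ! m))) \<and> twist_arr n 1 (Us ! m) c = (sh1 D (\<pi>1 m) \<cdot> e') \<cdot> \<iota>2 l"
    using twist_arr_one_surj[OF J_obj[OF UJ] J_obj[OF VJ] arr_comp[OF i2 pe']] by blast
  then obtain ff where ff: "\<And>m l. m < M \<Longrightarrow> l < L \<Longrightarrow> arr (ff m l) (Vs ! l) (sh0 D (T0 (Us ! m)))"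
    "\<And>m l. m < M \<Longrightarrow> l < L \<Longrightarrow> twist_arr n 1 (Us ! m) (ff m l) = (sh1 D (\<pi>1 m) \<cdot> e') \<cdot> \<iota>2 l"
    by metis

  \<comment> \<open>Multiplying a row with the entries \<open>u \<iota>2 l\<close> by the column
    \<open>hh\<close> undoes the expansion over the summands of \<open>V2\<close>.\<close>
  have sum_h: "finprod (Hom D \<rho> (Sh (Suc n) Q)) (\<lambda>l. Shm n (c l) \<cdot> hh l) {..<L} = Shm n u \<cdot> h"
    if u: "arr u V2 (sh0 D Q)" and c: "\<And>l. l < L \<Longrightarrow> c l = u \<cdot> \<iota>2 l" for u Q c
  proof -
    have so: "Sh (Suc n) Q = Sh n (sh0 D Q)" by (simp add: funpow_swap1)
    have "Shm n u \<cdot> h = finprod (Hom D \<rho> (Sh n (sh0 D Q)))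
        (\<lambda>l. Shm n (u \<cdot> \<iota>2 l) \<cdot> hh l) {..<L}"
      using comp_through_direct_sum[OF d2 u h] by (simp add: L_def hh_def)
    also have "\<dots> = finprod (Hom D \<rho> (Sh n (sh0 D Q))) (\<lambda>l. Shm n (c l) \<cdot> hh l) {..<L}"
      using arr_obj[OF arr_comp[OF h shift.functor_arr[OF u]]] arr_comp[OF hh shift.functor_arr[OF arr_comp[OF i2 u]]] c
      by (intro sum_cong) auto
    finally show ?thesis unfolding so ..
  qed
  have sum_b: "finprod (Hom D \<rho> (Sh (Suc n) ((T0 ^^ Suc n) (\<tau> k))))
      (\<lambda>l. Shm n (twist_arr n 1 (\<tau> k) (ee k l)) \<cdot> hh l) {..<L} = b k" if k: "k < N" for k
  proof -
    have "finprod (Hom D \<rho> (Sh (Suc n) ((T0 ^^ Suc n) (\<tau> k))))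
      (\<lambda>l. Shm n (twist_arr n 1 (\<tau> k) (ee k l)) \<cdot> hh l) {..<L} = Shm n (sh1 D (\<pi> k) \<cdot> e) \<cdot> h"
      by (rule sum_h[OF pe[OF k] ee(2)[OF k]])
    also have "\<dots> = Shm n (sh1 D (\<pi> k)) \<cdot> (Shm n e \<cdot> h)"
      using shift.functor_comp[OF e shift_arr[OF p[OF k]], of n]
        comp_assoc[OF h shift.functor_arr[OF e, of n] shift.functor_arr[OF shift_arr[OF p[OF k]], of n]] by simp
    also have "\<dots> = b k" using \<pi>\<beta>[OF k] \<beta>e by (simp add: funpow_swap1)
    finally show ?thesis .
  qed
  have sum_f: "finprod (Hom D \<rho> (Sh (Suc n) ((T0 ^^ Suc n) (Us ! m))))
      (\<lambda>l. Shm n (twist_arr n 1 (Us ! m) (ff m l)) \<cdot> hh l) {..<L} =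
      zero_arr \<rho> (Sh (Suc n) ((T0 ^^ Suc n) (Us ! m)))" if m: "m < M" for m
  proof -
    have "finprod (Hom D \<rho> (Sh (Suc n) ((T0 ^^ Suc n) (Us ! m))))
      (\<lambda>l. Shm n (twist_arr n 1 (Us ! m) (ff m l)) \<cdot> hh l) {..<L} = Shm n (sh1 D (\<pi>1 m) \<cdot> e') \<cdot> h"
      by (rule sum_h[OF pe'[OF m] ff(2)[OF m]])
    also have "\<dots> = Shm n (sh1 D (\<pi>1 m)) \<cdot> (Shm n e' \<cdot> h)"
      using shift.functor_comp[OF e' shift_arr[OF p1[OF m]], of n]
        comp_assoc[OF h shift.functor_arr[OF e', of n] shift.functor_arr[OF shift_arr[OF p1[OF m]], of n]] by simp
    also have "\<dots> = zero_arr \<rho> (Sh n (sh0 D ((T0 ^^ Suc n) (Us ! m))))"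
      unfolding e'h using comp_zero_right[OF shift.functor_arr[OF shift_arr[OF p1[OF m]], of n] o(2)] .
    finally show ?thesis by (simp add: funpow_swap1)
  qed

  have tw11: "arr (sh1 D (twist_arr 1 1 \<sigma> c)) (sh0 D (T0 \<nu>)) (sh0 D (sh0 D (T0 (T0 \<sigma>))))"
    if "arr c \<nu> (sh0 D (T0 \<sigma>))" for c \<nu>
    using shift_arr[OF twist_arr_one[OF o(1) that, of 1]] by simp
  \<comment> \<open>In the category the equality of the two products of degree two holds between
    objects twisted at least \<open>n\<close> times, while the ring asks for it untwisted. A sum of
    such products, twisted \<open>n\<close> times, is the composite through the direct sum
    \<open>Q\<close>; this is applied to both sides.\<close>
  have quad: "twist_arr n 2 \<sigma> (finprod (Hom D (Vs ! l) (sh0 D (sh0 D (T0 (T0 \<sigma>)))))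
        (\<lambda>k. sh1 D (twist_arr 1 1 \<sigma> (c k)) \<cdot> f k) {..<K}) = sh1 D u \<cdot> (v \<cdot> \<iota>2 l)"
    if l: "l < L" and dd: "direct_sum_maps Q Qs \<iota>' \<pi>'" "length Qs = K" and u: "arr u Q (sh0 D ?Y)" and v: "arr v V2 (sh0 D Q)"
      and \<nu>: "\<And>k. k < K \<Longrightarrow> \<nu> k \<in> J" and Qs: "\<And>k. k < K \<Longrightarrow> Qs ! k = (T0 ^^ Suc n) (\<nu> k)"
      and c: "\<And>k. k < K \<Longrightarrow> arr (c k) (\<nu> k) (sh0 D (T0 \<sigma>))" "\<And>k. k < K \<Longrightarrow> twist_arr (Suc n) 1 \<sigma> (c k) = u \<cdot> \<iota>' k"
      and f: "\<And>k. k < K \<Longrightarrow> arr (f k) (Vs ! l) (sh0 D (T0 (\<nu> k)))"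
        "\<And>k. k < K \<Longrightarrow> twist_arr n 1 (\<nu> k) (f k) = (sh1 D (\<pi>' k) \<cdot> v) \<cdot> \<iota>2 l"
    for l Q Qs \<iota>' \<pi>' K u v \<nu> c f
  proof -
    let ?V = "Vs ! l" and ?S = "sh0 D (sh0 D (T0 (T0 \<sigma>)))"
    let ?H = "Hom D ((T0 ^^ n) ?V) (sh0 D (sh0 D ?Y))"
    have VO: "?V \<in> Obj D" using J_obj VJ l by blast
    have SO: "?S \<in> Obj D" using shift_obj functor_obj o by blast
    have two: "Sh 2 ((T0 ^^ 2) \<sigma>) = ?S" "Sh 2 ((T0 ^^ (2 + n)) \<sigma>) = sh0 D (sh0 D ?Y)"
      by (simp_all add: numeral_2_eq_2)
    have cf: "arr (sh1 D (twist_arr 1 1 \<sigma> (c k)) \<cdot> f k) ?V ?S" if "k \<in> {..<K}" for k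
      using arr_comp[OF f(1) tw11[OF c(1)]] that by simp
    have "twist_arr n 2 \<sigma> (finprod (Hom D ?V ?S) (\<lambda>k. sh1 D (twist_arr 1 1 \<sigma> (c k)) \<cdot> f k) {..<K}) =
        finprod ?H (\<lambda>k. twist_arr n 2 \<sigma> (sh1 D (twist_arr 1 1 \<sigma> (c k)) \<cdot> f k)) {..<K}"
      by (rule hom_finprod[OF hom_group[OF VO SO] hom_group[OF twist.functor_obj[OF VO] shift_obj[OF sYO]]
          twist_arr_hom[OF o(1) VO, of n 2, unfolded two]]) (rule arr_hom[OF cf])
    also have "\<dots> = finprod ?H (\<lambda>k. Shm 1 (u \<cdot> \<iota>' k) \<cdot> (Shm 1 (\<pi>' k) \<cdot> (v \<cdot> \<iota>2 l))) {..<K}"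
    proof (rule sum_cong[OF twist.functor_obj[OF VO] shift_obj[OF sYO]])
      fix k assume "k \<in> {..<K}" then have k: "k < K" by simp
      have i': "arr (\<iota>' k) ((T0 ^^ Suc n) (\<nu> k)) Q" and p': "arr (\<pi>' k) Q ((T0 ^^ Suc n) (\<nu> k))"
        using direct_sum_mapsD(3,4)[OF dd(1), of k] dd(2) Qs[OF k] k by auto
      note vi = arr_comp[OF i2[OF l] v]
      show "arr (Shm 1 (u \<cdot> \<iota>' k) \<cdot> (Shm 1 (\<pi>' k) \<cdot> (v \<cdot> \<iota>2 l))) ((T0 ^^ n) ?V) (sh0 D (sh0 D ?Y))"
        using arr_comp[OF arr_comp[OF vi shift_arr[OF p']] shift_arr[OF arr_comp[OF i' u]]] by simp
      have "twist_arr n 2 \<sigma> (sh1 D (twist_arr 1 1 \<sigma> (c k)) \<cdot> f k) = sh1 D (twist_arr (Suc n) 1 \<sigma> (c k)) \<cdot> twist_arr n 1 (\<nu> k) (f k)"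
        using twist_arr_comp[OF o(1) J_obj[OF \<nu>[OF k]], of "c k" 1 "f k" ?V 1 n] c(1)[OF k] f(1)[OF k]
        by (simp add: numeral_2_eq_2)
      also have "\<dots> = sh1 D (u \<cdot> \<iota>' k) \<cdot> (sh1 D (\<pi>' k) \<cdot> (v \<cdot> \<iota>2 l))"
        unfolding c(2)[OF k] f(2)[OF k] using comp_assoc[OF i2[OF l] v shift_arr[OF p']] by simp
      finally show "twist_arr n 2 \<sigma> (sh1 D (twist_arr 1 1 \<sigma> (c k)) \<cdot> f k) =
          Shm 1 (u \<cdot> \<iota>' k) \<cdot> (Shm 1 (\<pi>' k) \<cdot> (v \<cdot> \<iota>2 l))" by simp
    qed
    also have "\<dots> = sh1 D u \<cdot> (v \<cdot> \<iota>2 l)"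
      using comp_through_direct_sum[OF dd(1) u, of "v \<cdot> \<iota>2 l" "(T0 ^^ n) ?V" 1] arr_comp[OF i2[OF l] v]
      by (simp add: dd(2))
    finally show ?thesis .
  qed

  have sum_q: "finprod (Hom D (Vs ! l) (sh0 D (sh0 D (T0 (T0 \<sigma>))))) (\<lambda>k. sh1 D (twist_arr 1 1 \<sigma> (a k)) \<cdot> ee k l) {..<N} =
      finprod (Hom D (Vs ! l) (sh0 D (sh0 D (T0 (T0 \<sigma>))))) (\<lambda>m. sh1 D (twist_arr 1 1 \<sigma> (aa m)) \<cdot> ff m l) {..<M}"
    if l: "l < L" for l
  proof -
    let ?S = "sh0 D (sh0 D (T0 (T0 \<sigma>)))"
    have VO: "Vs ! l \<in> Obj D" using J_obj VJ l by blast
    have SO: "?S \<in> Obj D" using shift_obj functor_obj o by blast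
    have "twist_arr n 2 \<sigma> (finprod (Hom D (Vs ! l) ?S) (\<lambda>k. sh1 D (twist_arr 1 1 \<sigma> (a k)) \<cdot> ee k l) {..<N}) = sh1 D \<alpha> \<cdot> (e \<cdot> \<iota>2 l)"
      by (rule quad[OF l d Ws(1) \<alpha> e, of \<tau>]) (use \<tau> Ws a \<alpha>\<iota> ee l in auto)
    also have "\<dots> = sh1 D a' \<cdot> (e' \<cdot> \<iota>2 l)"
      using \<alpha>e comp_assoc[OF i2[OF l] e shift_arr[OF \<alpha>]] comp_assoc[OF i2[OF l] e' shift_arr[OF a']] by simp
    also have "\<dots> = twist_arr n 2 \<sigma> (finprod (Hom D (Vs ! l) ?S) (\<lambda>m. sh1 D (twist_arr 1 1 \<sigma> (aa m)) \<cdot> ff m l) {..<M})"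
      by (rule quad[OF l d1 _ a' e', of M "\<lambda>m. Us ! m", symmetric]) (use UJ aa ff l in \<open>auto simp: M_def\<close>)
    finally have eq: "twist_arr n 2 \<sigma> (finprod (Hom D (Vs ! l) ?S) (\<lambda>k. sh1 D (twist_arr 1 1 \<sigma> (a k)) \<cdot> ee k l) {..<N}) =
        twist_arr n 2 \<sigma> (finprod (Hom D (Vs ! l) ?S) (\<lambda>m. sh1 D (twist_arr 1 1 \<sigma> (aa m)) \<cdot> ff m l) {..<M})" .
    have two: "Sh 2 ((T0 ^^ 2) \<sigma>) = ?S"
      by (simp add: numeral_2_eq_2)
    \<comment> \<open>Twisting is faithful, so the equality descends to degree two of the
      ring.\<close>
    have "inj_on (twist_arr n 2 \<sigma>) (carrier (Hom D (Vs ! l) ?S))"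
      using twist_arr_bij[OF o(1) VO, of n 2] unfolding two by (rule bij_betw_imp_inj_on)
    moreover have "finprod (Hom D (Vs ! l) ?S) (\<lambda>k. sh1 D (twist_arr 1 1 \<sigma> (a k)) \<cdot> ee k l) {..<N} \<in> carrier (Hom D (Vs ! l) ?S)"
      using arr_comp[OF ee(1) tw11[OF a]] l
      by (intro arr_hom arr_sum[OF VO SO]) simp
    moreover have "finprod (Hom D (Vs ! l) ?S) (\<lambda>m. sh1 D (twist_arr 1 1 \<sigma> (aa m)) \<cdot> ff m l) {..<M} \<in> carrier (Hom D (Vs ! l) ?S)"
      using arr_comp[OF ff(1) tw11[OF aa(1)]] l
      by (intro arr_hom arr_sum[OF VO SO]) simp
    ultimately show ?thesis
      using eq unfolding inj_on_def by blast
  qed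

  show "\<exists>(L :: nat) \<mu> h e (M :: nat) \<upsilon> a' e'.
       (\<forall>l<L. \<mu> l \<in> J \<and> h l \<in> carrier (cpt diag (\<mu> l) \<rho> n)) \<and>
       (\<forall>k<N. \<forall>l<L. e k l \<in> carrier (cpt diag (\<tau> k) (\<mu> l) 1)) \<and>
       (\<forall>m<M. \<upsilon> m \<in> J \<and> a' m \<in> carrier (cpt diag \<sigma> (\<upsilon> m) 1)) \<and>
       (\<forall>m<M. \<forall>l<L. e' m l \<in> carrier (cpt diag (\<upsilon> m) (\<mu> l) 1)) \<and>
       (\<forall>k<N. finprod (cpt diag (\<tau> k) \<rho> (Suc n))
          (\<lambda>l. mul diag (\<tau> k) (\<mu> l) \<rho> 1 n (e k l) (h l)) {..<L} = b k) \<and>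
       (\<forall>l<L. finprod (cpt diag \<sigma> (\<mu> l) 2)
            (\<lambda>k. mul diag \<sigma> (\<tau> k) (\<mu> l) 1 1 (a k) (e k l)) {..<N} =
          finprod (cpt diag \<sigma> (\<mu> l) 2)
            (\<lambda>m. mul diag \<sigma> (\<upsilon> m) (\<mu> l) 1 1 (a' m) (e' m l)) {..<M}) \<and>
       (\<forall>m<M. finprod (cpt diag (\<upsilon> m) \<rho> (Suc n))
            (\<lambda>l. mul diag (\<upsilon> m) (\<mu> l) \<rho> 1 n (e' m l) (h l)) {..<L} =
          \<one>\<^bsub>cpt diag (\<upsilon> m) \<rho> (Suc n)\<^esub>)"
    unfolding cpt_diagonal_cohomology mul_diagonal_cohomology
    apply (rule exI[of _ L], rule exI[of _ "\<lambda>l. Vs ! l"], rule exI[of _ hh], rule exI[of _ ee],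
        rule exI[of _ M], rule exI[of _ "\<lambda>m. Us ! m"], rule exI[of _ aa], rule exI[of _ ff])
    apply (intro conjI allI impI)
    subgoal by (rule VJ)
    subgoal by (rule arr_hom[OF hh])
    subgoal using arr_hom[OF ee(1)] by simp
    subgoal by (rule UJ)
    subgoal using arr_hom[OF aa(1)] by simp
    subgoal using arr_hom[OF ff(1)] by simp
    subgoal by (rule sum_b)
    subgoal using sum_q by (simp add: numeral_2_eq_2)
    subgoal by (rule sum_f)
    done
qed

theorem quadratic_diagonal_cohomology: "quadratic J diag"
  using A.quadratic_if_linearly_generated_and_quadratically_related
    diagonal_cohomology_linearly_generated diagonal_cohomology_quadratically_related .

end

end

section \<open>Closure under zero objects and isomorphisms\<close>

context additive_autoequivalence
begin

lemma functor_reflects_isomorphic: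
  assumes "X \<in> Obj C" "Y \<in> Obj C" "isomorphic C (F0 X) (F0 Y)"
  shows "isomorphic C X Y"
proof -
  obtain s t where s: "arr s (F0 X) (F0 Y)" and t: "arr t (F0 Y) (F0 X)"
    and st: "t \<cdot> s = idm C (F0 X)" "s \<cdot> t = idm C (F0 Y)"
    using assms(3) is_iso_iff[OF functor_obj[OF assms(1)] functor_obj[OF assms(2)]]
    unfolding isomorphic_def by blast
  obtain f where f: "arr f X Y" "F1 f = s" using functor_full[OF assms(1,2) s] .
  obtain g where g: "arr g Y X" "F1 g = t" using functor_full[OF assms(2,1) t] .
  have "g \<cdot> f = idm C X"
    using functor_faithful[OF arr_comp[OF f(1) g(1)] arr_id[OF assms(1)]] functor_comp[OF f(1) g(1)]
      f(2) g(2) st(1) functor_id[OF assms(1)] by simp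
  moreover have "f \<cdot> g = idm C Y"
    using functor_faithful[OF arr_comp[OF g(1) f(1)] arr_id[OF assms(2)]] functor_comp[OF g(1) f(1)]
      f(2) g(2) st(2) functor_id[OF assms(2)] by simp
  ultimately show ?thesis
    unfolding isomorphic_def using is_isoI[OF f(1) g(1)] by blast
qed

end

context triangulated_category
begin

text \<open>The maps \<open>f\<close> and \<open>h\<close> vanish, which gives \<open>g\<close> a
  left and a right inverse.\<close>

lemma dist_first_zero:
  assumes d: "(X, Y, Z, f, g, h) \<in> dist D" and X: "is_zero_object D X"
  shows "isomorphic D Y Z"
proof -
  note a = dist_arr[OF d]
  have "h \<cdot> idm D Z = zero_arr Z (sh0 D X)"
    using arr_to_zero[OF shift_zero_object[OF X] a(6)] comp_id_right[OF a(6)] by simp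
  then obtain s where s: "arr s Z Y" "g \<cdot> s = idm D Z"
    using dist_lift[OF rotate[OF d] arr_id[OF a(3)]] by blast
  have "idm D Y \<cdot> f = zero_arr X Y"
    using arr_from_zero[OF X a(4)] comp_id_left[OF a(4)] by simp
  then obtain v where v: "arr v Z Y" "v \<cdot> g = idm D Y"
    using dist_extend[OF d arr_id[OF a(2)]] by blast
  have "v = s"
    using comp_assoc[OF s(1) a(5) v(1)] v(2) s(2) comp_id_left[OF s(1)] comp_id_right[OF v(1)] by simp
  then show ?thesis
    unfolding isomorphic_def using is_isoI[OF a(5) s(1)] v(2) s(2) by blast
qed

text \<open>Two rotations bring the zero object to the front; the resulting isomorphism between
  shifted objects is reflected by the shift.\<close>

lemma dist_third_zero:
  assumes d: "(X, Y, Z, f, g, h) \<in> dist D" and Z: "is_zero_object D Z"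
  shows "isomorphic D X Y"
  using dist_first_zero[OF rotate[OF rotate[OF d]] Z] shift.functor_reflects_isomorphic[of X Y 1] dist_arr[OF d]
  by simp

lemma zero_objects_isomorphic:
  assumes "is_zero_object D N" "is_zero_object D N'"
  shows "isomorphic D N N'"
  using dist_first_zero[OF dist_zero_first[OF assms(1) zero_object_obj[OF assms(2)]] assms(1)]
    dist_third_zero[OF dist_zero_first[OF assms(1) zero_object_obj[OF assms(2)]] assms(2)] by simp

lemma isomorphic_zero_object:
  assumes "is_zero_object D X" "Y \<in> Obj D" "isomorphic D X Y"
  shows "is_zero_object D Y"
proof -
  obtain s t where s: "arr s X Y" and t: "arr t Y X" "s \<cdot> t = idm D Y"
    using assms zero_object_obj is_iso_iff unfolding isomorphic_def by blast
  have "idm D Y = zero_arr Y Y"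
    using t(2) arr_from_zero[OF assms(1) s] comp_zero_left[OF t(1) assms(2)] by simp
  then show ?thesis using is_zero_object_iff assms(2) by simp
qed

text \<open>
  A class of objects closed under extensions need not contain the zero objects, and then it need not
  be closed under isomorphisms either. This closure repairs both.
\<close>

definition iso_zero_closure where
  "iso_zero_closure P = {X \<in> Obj D. is_zero_object D X \<or> (\<exists>Y \<in> P. isomorphic D Y X)}"

lemma subset_iso_zero_closure: "P \<subseteq> Obj D \<Longrightarrow> P \<subseteq> iso_zero_closure P"
  unfolding iso_zero_closure_def using isomorphic_refl by blast

lemma iso_zero_closure_iso:
  assumes "X \<in> iso_zero_closure P" "P \<subseteq> Obj D" "Y \<in> Obj D" "isomorphic D X Y"
  shows "Y \<in> iso_zero_closure P"
  using assms isomorphic_zero_object[of X Y] isomorphic_trans[of _ X Y]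
  unfolding iso_zero_closure_def by blast

text \<open>A zero object at one end makes the middle term isomorphic to the other end. Otherwise
  the ends are replaced by isomorphic ones in \<open>P\<close> while the middle term stays, so that
  it lies in \<open>P\<close> itself.\<close>

lemma iso_zero_closure_closed:
  assumes P: "closed_under_extensions D P"
  shows "ext_closed_with_zero (iso_zero_closure P)"
proof -
  have PO: "P \<subseteq> Obj D" using P unfolding closed_under_extensions_def by blast
  have "Y \<in> iso_zero_closure P"
    if d: "(X, Y, Z, f, g, h) \<in> dist D" and X: "X \<in> iso_zero_closure P" and Z: "Z \<in> iso_zero_closure P"
    for X Y Z f g h
  proof -
    note a = dist_arr[OF d]
    consider (x) "is_zero_object D X" | (z) "is_zero_object D Z"
      | (xz) X' Z' where "X' \<in> P" "isomorphic D X' X" "Z' \<in> P" "isomorphic D Z' Z"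
      using X Z unfolding iso_zero_closure_def by blast
    then show ?thesis
    proof cases
      case x
      show ?thesis
        using iso_zero_closure_iso[OF Z PO a(2)] isomorphic_sym[OF a(2,3) dist_first_zero[OF d x]] by blast
    next
      case z
      show ?thesis
        using iso_zero_closure_iso[OF X PO a(2)] dist_third_zero[OF d z] by blast
    next
      case xz
      have o: "X' \<in> Obj D" "Z' \<in> Obj D" using xz PO by auto
      obtain s where s: "is_iso D X X' s"
        using isomorphic_sym[OF o(1) a(1) xz(2)] unfolding isomorphic_def by blast
      then obtain s' where s': "arr s X X'" "arr s' X' X" "s' \<cdot> s = idm D X"
        using is_iso_iff[OF a(1) o(1)] by blast
      obtain t where t: "is_iso D Z Z' t"
        using isomorphic_sym[OF o(2) a(3) xz(4)] unfolding isomorphic_def by blast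
      then obtain t' where t': "arr t Z Z'" "arr t' Z' Z" "t' \<cdot> t = idm D Z"
        using is_iso_iff[OF a(3) o(2)] by blast
      have m: "arr (f \<cdot> s') X' Y" "arr (t \<cdot> g) Y Z'" "arr (sh1 D s \<cdot> h \<cdot> t') Z' (sh0 D X')"
        using arr_comp[OF s'(2) a(4)] arr_comp[OF a(5) t'(1)]
          arr_comp[OF arr_comp[OF t'(2) a(6)] shift_arr[OF s'(1)]] by blast+
      have "(X', Y, Z', f \<cdot> s', t \<cdot> g, sh1 D s \<cdot> h \<cdot> t') \<in> dist D"
      proof (rule TR1_iso[OF d o(1) a(2) o(2), of _ _ _ s "idm D Y" t])
        show "idm D Y \<cdot> f = (f \<cdot> s') \<cdot> s"
          using comp_id_left[OF a(4)] comp_assoc[OF s'(1,2) a(4)] s'(3) comp_id_right[OF a(4)] by simp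
        show "t \<cdot> g = (t \<cdot> g) \<cdot> idm D Y" using comp_id_right[OF m(2)] by simp
        show "sh1 D s \<cdot> h = (sh1 D s \<cdot> h \<cdot> t') \<cdot> t"
          using comp_assoc[OF t'(1) arr_comp[OF t'(2) a(6)] shift_arr[OF s'(1)]]
            comp_assoc[OF t'(1,2) a(6)] t'(3) comp_id_right[OF a(6)] by simp
      qed (use m s t is_iso_id a in \<open>auto simp: arr_def\<close>)
      then have "Y \<in> P" using P xz unfolding closed_under_extensions_def by blast
      then show ?thesis using subset_iso_zero_closure[OF PO] by blast
    qed
  qed
  then show ?thesis
    unfolding ext_closed_with_zero_def closed_under_extensions_def
    using zero_object_obj by (auto simp: iso_zero_closure_def)
qed

lemma iso_zero_closure_minimal:
  assumes "ext_closed_with_zero S" "P \<subseteq> S"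
  shows "iso_zero_closure P \<subseteq> S"
  using assms ext_closed_iso[OF assms(1)] unfolding iso_zero_closure_def ext_closed_with_zero_def by blast

lemma orth_zero_left: "is_zero_object D X \<Longrightarrow> orth X U"
  unfolding orth_def using arr_from_zero by blast

lemma orth_zero_right: "is_zero_object D U \<Longrightarrow> orth X U"
  unfolding orth_def using arr_to_zero by blast

lemma orth_iff: "X \<in> Obj D \<Longrightarrow> Y \<in> Obj D \<Longrightarrow> orth X Y \<longleftrightarrow> carrier (Hom D X Y) = {zero_arr X Y}"
  using arr_hom[OF arr_zero] unfolding orth_def by (auto simp: arr_def)

text \<open>The objects with vanishing maps to or from a fixed one are closed under extensions and
  contain the zero objects, so the closure is among them; this is applied to one variable at a
  time.\<close>

lemma orth_iso_zero_closure:
  assumes "\<And>X Y. X \<in> P \<Longrightarrow> Y \<in> Q \<Longrightarrow> orth X (sh0 D Y)" "P \<subseteq> Obj D" "Q \<subseteq> Obj D"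
    "X \<in> iso_zero_closure P" "Y \<in> iso_zero_closure Q"
  shows "orth X (sh0 D Y)"
proof -
  have right: "iso_zero_closure Q \<subseteq> {V \<in> Obj D. orth X (sh0 D V)}" if "X \<in> P" for X
  proof (rule iso_zero_closure_minimal)
    show "ext_closed_with_zero {V \<in> Obj D. orth X (sh0 D V)}"
      unfolding ext_closed_with_zero_def closed_under_extensions_def
      using orth_extension_right[of _ _ _ _ _ _ X 1] dist_arr(2) orth_zero_right shift_zero_object zero_object_obj
      by auto
  qed (use assms(1,3) that in blast)
  have "iso_zero_closure P \<subseteq> {V \<in> Obj D. orth V (sh0 D Y)}"
  proof (rule iso_zero_closure_minimal)
    have "Y \<in> Obj D" using assms(5) unfolding iso_zero_closure_def by blast
    then show "ext_closed_with_zero {V \<in> Obj D. orth V (sh0 D Y)}"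
      unfolding ext_closed_with_zero_def closed_under_extensions_def
      using orth_extension_left[OF _ _ _ shift_obj] dist_arr(2) orth_zero_left zero_object_obj
      by blast
  qed (use assms(2,5) right in blast)
  then show ?thesis using assms(4) by blast
qed

lemma chain_cmp_arr:
  assumes "\<And>i. i \<in> {1..n} \<Longrightarrow> arr (z i) (Z (i - 1)) (sh0 D (Z i))" "Z 0 \<in> Obj D"
  shows "arr (chain_cmp D Z z n) (Z 0) (Sh n (Z n))"
  using assms(1)
proof (induction n)
  case 0
  then show ?case using arr_id assms(2) by simp
next
  case (Suc n)
  have "arr (z (Suc n)) (Z n) (sh0 D (Z (Suc n)))" using Suc.prems[of "Suc n"] by simp
  moreover have "arr (chain_cmp D Z z n) (Z 0) (Sh n (Z n))" using Suc by simp
  ultimately show ?case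
    using arr_comp[OF _ shift.functor_arr[of "z (Suc n)" "Z n" "sh0 D (Z (Suc n))" n]] by (simp add: funpow_swap1)
qed

text \<open>Isomorphisms at both ends carry \<open>f\<close> to objects of \<open>M\<close>, where
  the chain condition splits off the last step; the factorization is then carried back. If an end is
  a zero object, \<open>f\<close> is zero and factors through a zero object.\<close>

lemma factor_iso_zero_closure:
  assumes M: "closed_under_extensions D M"
    and chain: "\<And>X Y n f. \<lbrakk>X \<in> M; Y \<in> M; n \<ge> 2; f \<in> carrier (Hom D X (Sh n Y))\<rbrakk>
          \<Longrightarrow> \<exists>Z z. Z 0 = X \<and> Z n = Y \<and> (\<forall>i \<le> n. Z i \<in> M) \<and>
                (\<forall>i \<in> {1..n}. z i \<in> carrier (Hom D (Z (i - 1)) (sh0 D (Z i)))) \<and>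
                f = chain_cmp D Z z n"
    and X: "X \<in> iso_zero_closure M" and Y: "Y \<in> iso_zero_closure M" and n: "n \<ge> 1"
    and f: "arr f X (Sh (Suc n) Y)"
  shows "\<exists>V \<in> iso_zero_closure M. \<exists>g z. arr g X (Sh n V) \<and> arr z V (sh0 D Y) \<and> f = Shm n z \<cdot> g"
proof -
  have MO: "M \<subseteq> Obj D" using M unfolding closed_under_extensions_def by blast
  have XY: "X \<in> Obj D" "Y \<in> Obj D" using X Y unfolding iso_zero_closure_def by auto
  note sw = funpow_swap1[symmetric, where f = "sh0 D"] funpow_swap1[symmetric, where f = "sh1 D"]
  consider (zero) "orth X (Sh (Suc n) Y)"
    | (iso) X' Y' where "X' \<in> M" "isomorphic D X' X" "Y' \<in> M" "isomorphic D Y' Y"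
  proof -
    have "is_zero_object D (Sh k Y)" if "is_zero_object D Y" for k
      by (induction k) (use that shift_zero_object in auto)
    then show ?thesis
      using that X Y orth_zero_left orth_zero_right unfolding iso_zero_closure_def by blast
  qed
  then show ?thesis
  proof cases
    case zero
    obtain N where N: "is_zero_object D N" using ex_zero_object by blast
    then have NM: "N \<in> iso_zero_closure M" unfolding iso_zero_closure_def using zero_object_obj by blast
    note NO = zero_object_obj[OF N]
    note z1 = arr_zero[OF XY(1) shift.functor_obj[OF NO, of n]] and z2 = arr_zero[OF NO shift_obj[OF XY(2)]]
    have "f = zero_arr X (Sh (Suc n) Y)" using zero f unfolding orth_def by blast
    also have "\<dots> = Shm n (zero_arr N (sh0 D Y)) \<cdot> zero_arr X (Sh n N)"
      using comp_zero_right[OF shift.functor_arr[OF z2, of n] XY(1)] by (simp add: sw)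
    finally show ?thesis using NM z1 z2 by blast
  next
    case iso
    have o: "X' \<in> Obj D" "Y' \<in> Obj D" using iso MO by auto
    obtain s t where s: "arr s X' X" and t: "arr t X X'" and st: "s \<cdot> t = idm D X"
      using iso(2) is_iso_iff[OF o(1) XY(1)] unfolding isomorphic_def by blast
    obtain u v where u: "arr u Y' Y" and v: "arr v Y Y'" and uv: "u \<cdot> v = idm D Y"
      using iso(4) is_iso_iff[OF o(2) XY(2)] unfolding isomorphic_def by blast
    note vn = shift.functor_arr[OF v, of "Suc n"] and un = shift.functor_arr[OF u, of "Suc n"]
    define f' where "f' = Shm (Suc n) v \<cdot> f \<cdot> s"
    have f': "arr f' X' (Sh (Suc n) Y')"
      unfolding f'_def using arr_comp[OF arr_comp[OF s f] vn] .
    have "2 \<le> Suc n" using n by simp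
    from chain[OF iso(1,3) this arr_hom[OF f']] obtain Z z where Z: "Z 0 = X'" "Z (Suc n) = Y'"
      "\<forall>i \<le> Suc n. Z i \<in> M" "\<forall>i \<in> {1..Suc n}. z i \<in> carrier (Hom D (Z (i - 1)) (sh0 D (Z i)))"
      "f' = chain_cmp D Z z (Suc n)" by blast
    have ZO: "Z i \<in> Obj D" if "i \<le> Suc n" for i using Z(3) MO that by blast
    have z: "arr (z i) (Z (i - 1)) (sh0 D (Z i))" if "i \<in> {1..Suc n}" for i
      using Z(4) that ZO[of i] ZO[of "i - 1"] shift_obj by (intro arrI) auto
    have c: "arr (chain_cmp D Z z n) X' (Sh n (Z n))"
      using chain_cmp_arr[of n z Z] z ZO[of 0] Z(1) by simp
    have zn: "arr (z (Suc n)) (Z n) (sh0 D Y')" using z[of "Suc n"] Z(2) by simp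
    note szn = shift.functor_arr[OF zn, of n] and su = shift_arr[OF u]
    note ct = arr_comp[OF t c]
    have "Shm n (sh1 D u \<cdot> z (Suc n)) \<cdot> (chain_cmp D Z z n \<cdot> t) = Shm (Suc n) u \<cdot> (f' \<cdot> t)"
      using shift.functor_comp[OF zn su, of n] comp_assoc[OF ct szn shift.functor_arr[OF su, of n]]
        comp_assoc[OF t c szn] by (simp add: Z(5) sw)
    also have "f' \<cdot> t = Shm (Suc n) v \<cdot> f"
      using comp_assoc[OF t arr_comp[OF s f] vn] comp_assoc[OF t s f] st comp_id_right[OF f] by (simp add: f'_def)
    also have "Shm (Suc n) u \<cdot> (Shm (Suc n) v \<cdot> f) = f"
      using comp_assoc[OF f vn un] shift.functor_comp[OF v u, of "Suc n"] uv shift.functor_id[OF XY(2), of "Suc n"]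
        comp_id_left[OF f] by simp
    finally have "f = Shm n (sh1 D u \<cdot> z (Suc n)) \<cdot> (chain_cmp D Z z n \<cdot> t)" ..
    moreover have "Z n \<in> iso_zero_closure M"
      using subset_iso_zero_closure[OF MO] Z(3) by auto
    ultimately show ?thesis using ct arr_comp[OF zn su] by blast
  qed
qed

end

text \<open>An autoequivalence need not hit an object of \<open>E (i + 1)\<close> on the nose, so
  essential surjectivity stands for one half of the equality between the twisted class and the
  next.\<close>

theorem mainTheorem8:
  fixes D :: "('o, 'm) triangulated_data"
    and T0 :: "'o \<Rightarrow> 'o" and T1 :: "'m \<Rightarrow> 'm" and \<phi> :: "'o \<Rightarrow> 'm"
    and E :: "int \<Rightarrow> 'o set" and J M :: "'o set"
  assumes D: "triangulated_category D"
    and E_ext: "\<And>i. closed_under_extensions D (E i)"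
    and E_hom: "\<And>i j X Y. \<lbrakk>X \<in> E i; Y \<in> E j; i \<ge> j\<rbrakk>
          \<Longrightarrow> carrier (Hom D X (sh0 D Y)) = {\<one>\<^bsub>Hom D X (sh0 D Y)\<^esub>}"
    and twist: "triangulated_autoequivalence D T0 T1 \<phi>"
    and twist_E: "\<And>i X. X \<in> E i \<Longrightarrow> T0 X \<in> E (i + 1)"
    and E_twist: "\<And>i Y. Y \<in> E (i + 1) \<Longrightarrow> \<exists>X \<in> E i. isomorphic D (T0 X) Y"
    and J_sub: "J \<subseteq> E 0"
    and J_gen: "\<And>X. X \<in> E 0 \<Longrightarrow> \<exists>Xs. set Xs \<subseteq> J \<and> is_direct_sum D X Xs"
    and M_def: "M = closed_under_extensions D hull (\<Union>i. E i)"
    and chain: "\<And>X Y n f. \<lbrakk>X \<in> M; Y \<in> M; n \<ge> 2; f \<in> carrier (Hom D X ((sh0 D ^^ n) Y))\<rbrakk>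
          \<Longrightarrow> \<exists>Z z. Z 0 = X \<and> Z n = Y \<and> (\<forall>i \<le> n. Z i \<in> M) \<and>
                (\<forall>i \<in> {1..n}. z i \<in> carrier (Hom D (Z (i - 1)) (sh0 D (Z i)))) \<and>
                f = chain_cmp D Z z n"
  shows "(\<forall>i j X Y n. X \<in> E i \<longrightarrow> Y \<in> E j \<longrightarrow> n \<ge> 1 \<longrightarrow> int n > j - i \<longrightarrow>
            carrier (Hom D X ((sh0 D ^^ n) Y)) = {\<one>\<^bsub>Hom D X ((sh0 D ^^ n) Y)\<^esub>}) \<and>
         quadratic J (diagonal_cohomology D T0 T1 \<phi>)"
proof -
  interpret triangulated_autoequivalence D T0 T1 \<phi> by (rule twist)
  have EO: "E i \<subseteq> Obj D" for i using E_ext[of i] unfolding closed_under_extensions_def by blast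
  have M: "closed_under_extensions D M"
    unfolding M_def using EO by (intro hull_closed_under_extensions) blast
  then have MO: "M \<subseteq> Obj D" unfolding closed_under_extensions_def by blast
  have EM: "E i \<subseteq> M" for i unfolding M_def by (rule order_trans[OF _ hull_subset]) blast
  have E_orth: "orth X (sh0 D Y)" if "X \<in> E i" "Y \<in> E j" "i \<ge> j" for X Y i j
    using E_hom[OF that] orth_iff[of X "sh0 D Y"] EO shift_obj that by blast
  note sub = subset_iso_zero_closure[OF EO]
  \<comment> \<open>The argument runs in the closures. They contain the original classes, to which
    (1) therefore restricts, and the ring depends on \<open>J\<close> alone.\<close>
  interpret S: silly_filtration D T0 T1 \<phi> "\<lambda>i. iso_zero_closure (E i)" "iso_zero_closure M"
  proof unfold_locales
    fix i show "ext_closed_with_zero (iso_zero_closure (E i))" by (rule iso_zero_closure_closed[OF E_ext])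
  next
    fix X Y i j assume "X \<in> iso_zero_closure (E i)" "Y \<in> iso_zero_closure (E j)" "j \<le> i"
    then show "orth X (sh0 D Y)"
      using orth_iso_zero_closure[of "E i" "E j" X Y] E_orth[of _ i _ j] EO by blast
  next
    fix X i assume X: "X \<in> iso_zero_closure (E i)"
    then have XO: "X \<in> Obj D" unfolding iso_zero_closure_def by blast
    from X consider "is_zero_object D X" | Y where "Y \<in> E i" "isomorphic D Y X"
      unfolding iso_zero_closure_def by blast
    then show "T0 X \<in> iso_zero_closure (E (i + 1))"
    proof cases
      case 1
      then have "is_zero_object D (T0 X)"
        unfolding is_zero_object_iff using functor_id functor_zero functor_obj by metis
      then show ?thesis unfolding iso_zero_closure_def using functor_obj[OF XO] by blast
    next
      case 2
      then show ?thesis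
        unfolding iso_zero_closure_def
        using functor_obj[OF XO] functor_isomorphic[of Y X] twist_E[OF 2(1)] EO XO by blast
    qed
  next
    fix Y i assume Y: "Y \<in> iso_zero_closure (E (i + 1))"
    then have YO: "Y \<in> Obj D" unfolding iso_zero_closure_def by blast
    from Y consider "is_zero_object D Y" | Y' where "Y' \<in> E (i + 1)" "isomorphic D Y' Y"
      unfolding iso_zero_closure_def by blast
    then show "\<exists>X \<in> iso_zero_closure (E i). isomorphic D (T0 X) Y"
    proof cases
      case 1
      obtain N where N: "is_zero_object D N" using ex_zero_object by blast
      then have "is_zero_object D (T0 N)"
        unfolding is_zero_object_iff using functor_id functor_zero functor_obj by metis
      moreover have "N \<in> iso_zero_closure (E i)" using N zero_object_obj unfolding iso_zero_closure_def by blast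
      ultimately show ?thesis using zero_objects_isomorphic[OF _ 1] by blast
    next
      case 2
      obtain X where "X \<in> E i" "isomorphic D (T0 X) Y'" using E_twist[OF 2(1)] by blast
      then show ?thesis
        using isomorphic_trans[of "T0 X" Y' Y] 2 sub[of i] EO functor_obj YO by blast
    qed
  next
    show "ext_closed_with_zero (iso_zero_closure M)" by (rule iso_zero_closure_closed[OF M])
  next
    fix i show "iso_zero_closure (E i) \<subseteq> iso_zero_closure M"
      using EM[of i] unfolding iso_zero_closure_def by blast
  next
    fix S assume S: "closed_under_extensions D S" "\<And>i. iso_zero_closure (E i) \<subseteq> S"
    \<comment> \<open>\<open>S\<close> contains the closure of \<open>E 0\<close> and with it every
      zero object.\<close>
    have "ext_closed_with_zero S"
      unfolding ext_closed_with_zero_def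
      using S(1) S(2)[of 0] zero_object_obj unfolding iso_zero_closure_def by blast
    moreover have "M \<subseteq> S"
      unfolding M_def using S sub by (intro hull_minimal) blast+
    ultimately show "iso_zero_closure M \<subseteq> S" by (rule iso_zero_closure_minimal)
  next
    fix X Y n f
    assume "X \<in> iso_zero_closure M" "Y \<in> iso_zero_closure M" "1 \<le> n" "arr f X ((sh0 D ^^ Suc n) Y)"
    then show "\<exists>V\<in>iso_zero_closure M. \<exists>g z. arr g X ((sh0 D ^^ n) V) \<and> arr z V (sh0 D Y) \<and> f = (sh1 D ^^ n) z \<cdot>\<^bsub>D\<^esub> g"
      by (rule factor_iso_zero_closure[OF M, rotated]) (rule chain)
  qed
  have "J \<subseteq> iso_zero_closure (E 0)" using J_sub sub by blast
  moreover have "\<exists>Xs. set Xs \<subseteq> J \<and> is_direct_sum D X Xs" if X: "X \<in> iso_zero_closure (E 0)" for X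
  proof -
    from X have XO: "X \<in> Obj D" unfolding iso_zero_closure_def by blast
    from X consider "is_zero_object D X" | Y where "Y \<in> E 0" "isomorphic D Y X"
      unfolding iso_zero_closure_def by blast
    then show ?thesis
    proof cases
      case 1
      \<comment> \<open>A zero object is a direct sum of the empty family.\<close>
      obtain N where N: "is_direct_sum D N []" using ex_direct_sum[of "[]"] by auto
      then show ?thesis
        using direct_sum_iso[OF N XO zero_objects_isomorphic[OF direct_sum_Nil[OF N] 1]]
        by (intro exI[of _ "[]"]) simp
    next
      case 2
      then show ?thesis using J_gen[OF 2(1)] direct_sum_iso[OF _ XO 2(2)] by blast
    qed
  qed
  ultimately have "quadratic J (diagonal_cohomology D T0 T1 \<phi>)"
    by (rule S.quadratic_diagonal_cohomology)
  moreover have "carrier (Hom D X ((sh0 D ^^ n) Y)) = {\<one>\<^bsub>Hom D X ((sh0 D ^^ n) Y)\<^esub>}"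
    if "X \<in> E i" "Y \<in> E j" "n \<ge> 1" "int n > j - i" for i j X Y n
  proof -
    have "orth X ((sh0 D ^^ n) Y)"
      using S.orth_shift[OF that(3) _ _ that(4)] that(1,2) sub by blast
    then show ?thesis
      using orth_iff[of X "(sh0 D ^^ n) Y"] that(1,2) EO shift.functor_obj by blast
  qed
  ultimately show ?thesis by blast
qed

end
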